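(* Fix $T>0$, $N\in\mathbb N$. Assume (for each dimension $D$) that $X$ satisfies Condition (C3)$_p$ for some $p>2$ including all properties in its item 2(c), and that $g$ satisfies Condition (C5). Then for every $n=0,\dots,N-1$ there exist constants $c_{n+1},q_{n+1},\tau_{n+1}\in[1,\infty)$, independent of $D$, such that for every $D$, every $\varepsilon>0$ and every $N_0\in\mathbb N$ there exists a ReLU neural network $\hat V_{n+1}:\mathbb R^D\to\mathbb R$ with $$\Big(\int_{\mathbb R^D}(V_{n+1}(z)-\hat V_{n+1}(z))^2\,d\tilde\rho^{N_0}_{n+1}(z)\Big)^{1/2}\le\varepsilon,$$ $$\mathrm{size}(\hat V_{n+1})\le c_{n+1}D^{q_{n+1}}\varepsilon^{-\tau_{n+1}},\qquad \mathrm{Growth}(\hat V_{n+1})\le c_{n+1}D^{q_{n+1}}\varepsilon^{-\tau_{n+1}}.$$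
   Context: Dimension convention: $D$ varies; "independent of $D$" means uniform over all $D$. Setting: $(\Omega,\mathcal F,\mathbb F=(\mathcal F_t)_{t\in[0,T]},\mathbb P)$ carries a $D$-dimensional $\mathbb F$-Brownian motion $W$ and an $\mathbb F$-adapted $\mathbb R^D$-valued process $X$ with $X_0=x_0$. $t_n=nT/N$, $\mathbb F^{dis}=(\mathcal F_{t_n})_n$. For $N_0\in\mathbb N$: $\Delta t=T/(NN_0)$, $t^n_k=t_n+k\Delta t$, $\Delta W_{t^n_k}=W_{t^n_{k+1}}-W_{t^n_k}$, and $\tilde\rho^{N_0}_{n+1}(A)=\mathbb E\big[\sum_{k=0}^{N_0-1}\|\Delta W_{t^n_k}\|^2 1_A(X_{t_{n+1}})\big]$ for Borel $A\subset\mathbb R^D$. Value functions: $V_N(x)=g(t_N,x)$ and $V_n(x)=\max\big(g(t_n,x),\mathbb E[V_{n+1}(f_n(x,\cdot))]\big)$, so that $V_n(X_{t_n})$ is the Snell envelope $\operatorname{ess\,sup}_\tau\mathbb E[g(\tau,X_\tau)\mid\mathcal F_{t_n}]$. Neural networks: finite feed-forward ReLU networks; size = number of nonzero weights and biases; $\mathrm{Growth}(f)=\sup_x\|f(x)\|/(1+\|x\|)$; $\mathrm{Lip}$ = minimal Lipschitz constant. Random neural networks (RanNN): with $\sigma$ the componentwise ReLU, an infinite-width network of depth $I$ from $\mathbb R^{d_1}$ to $\mathbb R^{d_3}$ is $f=f_{I+1}\circ\cdots\circ f_1$ with hidden spaces $\ell^2(\mathbb N)$, $f_1(x)=W^1x+b^1$,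 $f_{i+1}(y)=W^{i+1}\sigma(y)+b^{i+1}$, where the layer parameters are $\mu_i=\sum_{m\ge0}w^{i+1}_m\delta_m$ ($b^{i+1}=w^{i+1}_0$, $W^{i+1}x=\sum_{m\ge1}w^{i+1}_mx_{m-1}$) with finite total variation norm $\sum_m\|w^{i+1}_m\|$; a RanNN is $\tilde f(x,\omega)=f(x,\mu(\omega))$ for a random parameter $\mu$; $\mathrm{size}(\tilde f)(\omega)$ counts nonzero scalar entries of all $w^{i+1}_m(\omega)$; $\mathrm{Growth}(\tilde f)(\omega)=\sup_x\|\tilde f(x,\omega)\|/(1+\|x\|)$. Condition (C3)$_p$ (constants $c,q>0$ independent of $D$): (1) $X$ is $\mathbb F^{dis}$-Markov and there are $\mathcal B(\mathbb R^D)\otimes\mathcal F_{t_{n+1}}$-measurable $f_n:\mathbb R^D\times\Omega\to\mathbb R^D$ with (a) $X_{t_{n+1}}=f_n(X_{t_n},\cdot)$ a.s.; (b) $f_n(x,\cdot)$ independent of $\mathcal F_{t_n}$ for each $x$; (c) $\mathbb E[X_{t_{n+1}}\mid\mathcal F_{t_n}]=\mathbb E[X_{t_{n+1}}\mid X_{t_n}]=\mathbb E[f_n(x,\cdot)]|_{x=X_{t_n}}$. (2)(a) $(\mathbb E|\mathrm{Growth}(f_n(\cdot,\omega))|^p)^{1/p}\le cD^q$; (b) there is a RanNN $\hat f_n$ of depth $\le cD^q$ with $f_n(x,\omega)=\hat f_n(x,\omega)$ for all $x$, a.s.; (c) $\mathbb E[\mathrm{size}(\hat f_n)]\le cD^q$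 and $\|x_0\|\le cD^q$. Condition (C5) (constants $c,q,r>0$ independent of $D$): for every $\varepsilon>0$, $n=0,\dots,N$ there is a ReLU network $\hat g_n$ with $|\hat g_n(x)-g(t_n,x)|\le\varepsilon cD^q(1+\|x\|)$, $\mathrm{size}(\hat g_n)\le cD^q\varepsilon^{-r}$, $\mathrm{Lip}(\hat g_n)\le cD^q$, $|g(t_n,0)|\le cD^q$. *)

theory Defs
  imports "HOL-Probability.Probability"
begin

definition RD :: "nat \<Rightarrow> (nat \<Rightarrow> real) measure" where
  "RD D = PiM {..<D} (\<lambda>_. borel)"

definition vnorm :: "nat \<Rightarrow> (nat \<Rightarrow> real) \<Rightarrow> real" where
  "vnorm D x = L2_set x {..<D}"

definition vzero :: "nat \<Rightarrow> (nat \<Rightarrow> real)" where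
  "vzero D = restrict (\<lambda>_. 0) {..<D}"

definition vdiff :: "nat \<Rightarrow> (nat \<Rightarrow> real) \<Rightarrow> (nat \<Rightarrow> real) \<Rightarrow> (nat \<Rightarrow> real)" where
  "vdiff D x y = restrict (\<lambda>i. x i - y i) {..<D}"

definition ennpow :: "ennreal \<Rightarrow> real \<Rightarrow> ennreal" where
  "ennpow x p = (if x = \<infinity> then \<infinity> else ennreal (enn2real x powr p))"

definition growth_vec :: "nat \<Rightarrow> nat \<Rightarrow> ((nat \<Rightarrow> real) \<Rightarrow> (nat \<Rightarrow> real)) \<Rightarrow> ennreal" where
  "growth_vec D E h = (SUP x\<in>space (RD D). ennreal (vnorm E (h x) / (1 + vnorm D x)))"

definition growth :: "nat \<Rightarrow> ((nat \<Rightarrow> real) \<Rightarrow> real) \<Rightarrow> ennreal" where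
  "growth D h = (SUP x\<in>space (RD D). ennreal (\<bar>h x\<bar> / (1 + vnorm D x)))"

definition lip :: "nat \<Rightarrow> ((nat \<Rightarrow> real) \<Rightarrow> real) \<Rightarrow> ennreal" where
  "lip D h = (SUP xy\<in>{(x,y). x \<in> space (RD D) \<and> y \<in> space (RD D) \<and> x \<noteq> y}.
                 ennreal (\<bar>h (fst xy) - h (snd xy)\<bar> / vnorm D (vdiff D (fst xy) (snd xy))))"

definition relu :: "real \<Rightarrow> real" where "relu x = max 0 x"

definition affine :: "real list list \<Rightarrow> real list \<Rightarrow> real list \<Rightarrow> real list" where
  "affine W b v = map2 (+) (map (\<lambda>row. sum_list (map2 (*) row v)) W) b"

fun nn_eval :: "(real list list \<times> real list) list \<Rightarrow> real list \<Rightarrow> real list" where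
  "nn_eval [] v = v"
| "nn_eval ((W,b) # L) v = (if L = [] then affine W b v else nn_eval L (map relu (affine W b v)))"

fun nn_dims_ok :: "nat \<Rightarrow> (real list list \<times> real list) list \<Rightarrow> nat \<Rightarrow> bool" where
  "nn_dims_ok d [] d' = (d = d')"
| "nn_dims_ok d ((W,b) # L) d' =
     (length b = length W \<and> (\<forall>row\<in>set W. length row = d) \<and> nn_dims_ok (length W) L d')"

definition nn_wf :: "nat \<Rightarrow> nat \<Rightarrow> (real list list \<times> real list) list \<Rightarrow> bool" where
  "nn_wf din dout L = (L \<noteq> [] \<and> nn_dims_ok din L dout)"

definition nn_size :: "(real list list \<times> real list) list \<Rightarrow> nat" where
  "nn_size L = (\<Sum>(W,b)\<leftarrow>L. length (filter (\<lambda>a. a \<noteq> 0) (concat W)) + length (filter (\<lambda>a. a \<noteq> 0) b))"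

definition nn_real :: "nat \<Rightarrow> (real list list \<times> real list) list \<Rightarrow> (nat \<Rightarrow> real) \<Rightarrow> real" where
  "nn_real D L x = hd (nn_eval L (map x [0..<D]))"

text \<open>Parameters u i m j: layer i (the map f_(i+1), i = 0..I), atom m of mu_i
  (m = 0 bias, m >= 1 column multiplying coordinate m-1), coordinate j of w^(i+1)_m.\<close>

fun rnn_layer :: "(nat \<Rightarrow> nat \<Rightarrow> nat \<Rightarrow> real) \<Rightarrow> nat \<Rightarrow> (nat \<Rightarrow> real) \<Rightarrow> nat \<Rightarrow> (nat \<Rightarrow> real)" where
  "rnn_layer u d1 x 0 = (\<lambda>j. u 0 0 j + (\<Sum>m<d1. u 0 (Suc m) j * x m))"
| "rnn_layer u d1 x (Suc i) =
     (\<lambda>j. u (Suc i) 0 j + (\<Sum>m. u (Suc i) (Suc m) j * relu (rnn_layer u d1 x i m)))"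

definition rnn_fun :: "nat \<Rightarrow> nat \<Rightarrow> nat \<Rightarrow> (nat \<Rightarrow> nat \<Rightarrow> nat \<Rightarrow> real) \<Rightarrow> (nat \<Rightarrow> real) \<Rightarrow> (nat \<Rightarrow> real)" where
  "rnn_fun d1 d3 I u x = restrict (rnn_layer u d1 x I) {..<d3}"

text \<open>admissible parameters of a depth-I network R^d1 -> R^d3 with hidden spaces l2(N):
  every w_m lies in l2, finite total variation norm in each layer; irrelevant entries vanish.\<close>
definition rnn_param :: "nat \<Rightarrow> nat \<Rightarrow> nat \<Rightarrow> (nat \<Rightarrow> nat \<Rightarrow> nat \<Rightarrow> real) \<Rightarrow> bool" where
  "rnn_param d1 d3 I u =
     ((\<forall>i m. summable (\<lambda>j. (u i m j)\<^sup>2)) \<and>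
      (\<forall>i\<le>I. summable (\<lambda>m. sqrt (\<Sum>j. (u i m j)\<^sup>2))) \<and>
      (\<forall>i>I. \<forall>m j. u i m j = 0) \<and>
      (\<forall>m>d1. \<forall>j. u 0 m j = 0) \<and>
      (\<forall>m. \<forall>j\<ge>d3. u I m j = 0))"

definition rnn_size :: "(nat \<Rightarrow> nat \<Rightarrow> nat \<Rightarrow> real) \<Rightarrow> ennreal" where
  "rnn_size u = emeasure (count_space UNIV) {(i,m,j). u i m j \<noteq> 0}"

definition tgrid :: "real \<Rightarrow> nat \<Rightarrow> nat \<Rightarrow> real" where
  "tgrid T N n = real n * T / real N"

definition is_filtration :: "'a measure \<Rightarrow> real \<Rightarrow> (real \<Rightarrow> 'a measure) \<Rightarrow> bool" where
  "is_filtration P T F =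
     ((\<forall>t\<in>{0..T}. subalgebra P (F t)) \<and>
      (\<forall>s t. 0 \<le> s \<longrightarrow> s \<le> t \<longrightarrow> t \<le> T \<longrightarrow> sets (F s) \<subseteq> sets (F t)))"

definition indep_of :: "'a measure \<Rightarrow> 'a measure \<Rightarrow> ('a \<Rightarrow> 'b) \<Rightarrow> 'b measure \<Rightarrow> bool" where
  "indep_of P G Y M =
     (\<forall>A\<in>sets G. \<forall>B\<in>sets M.
        measure P (A \<inter> (Y -` B \<inter> space P)) = measure P A * measure P (Y -` B \<inter> space P))"

definition is_BM :: "'a measure \<Rightarrow> real \<Rightarrow> (real \<Rightarrow> 'a measure) \<Rightarrow> nat \<Rightarrow> (real \<Rightarrow> 'a \<Rightarrow> nat \<Rightarrow> real) \<Rightarrow> bool" where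
  "is_BM P T F D W =
     ((\<forall>t\<in>{0..T}. W t \<in> measurable (F t) (RD D)) \<and>
      (\<forall>\<omega>\<in>space P. W 0 \<omega> = vzero D) \<and>
      (\<forall>\<omega>\<in>space P. \<forall>i<D. continuous_on {0..T} (\<lambda>t. W t \<omega> i)) \<and>
      (\<forall>s t. 0 \<le> s \<longrightarrow> s < t \<longrightarrow> t \<le> T \<longrightarrow>
          indep_of P (F s) (\<lambda>\<omega>. vdiff D (W t \<omega>) (W s \<omega>)) (RD D) \<and>
          distr P (RD D) (\<lambda>\<omega>. vdiff D (W t \<omega>) (W s \<omega>)) =
            PiM {..<D} (\<lambda>_. density lborel (normal_density 0 (sqrt (t - s))))))"

definition gen_alg :: "'a measure \<Rightarrow> ('a \<Rightarrow> 'b) \<Rightarrow> 'b measure \<Rightarrow> 'a measure" where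
  "gen_alg P Y M = vimage_algebra (space P) Y M"

definition markov_dis :: "'a measure \<Rightarrow> real \<Rightarrow> nat \<Rightarrow> (real \<Rightarrow> 'a measure) \<Rightarrow> nat \<Rightarrow> (real \<Rightarrow> 'a \<Rightarrow> nat \<Rightarrow> real) \<Rightarrow> bool" where
  "markov_dis P T N F D X =
     (\<forall>n<N. \<forall>B\<in>sets (RD D).
        AE \<omega> in P. real_cond_exp P (F (tgrid T N n)) (\<lambda>\<omega>. indicator B (X (tgrid T N (Suc n)) \<omega>)) \<omega>
                = real_cond_exp P (gen_alg P (X (tgrid T N n)) (RD D))
                    (\<lambda>\<omega>. indicator B (X (tgrid T N (Suc n)) \<omega>)) \<omega>)"

text \<open>Value functions: V_N = g(t_N,.), V_n(x) = max (g(t_n,x), E[V_(n+1)(f_n(x,.))]).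
  Vaux k = V_(N-k).\<close>
fun Vaux :: "'a measure \<Rightarrow> real \<Rightarrow> nat \<Rightarrow> (real \<Rightarrow> (nat \<Rightarrow> real) \<Rightarrow> real)
             \<Rightarrow> (nat \<Rightarrow> (nat \<Rightarrow> real) \<Rightarrow> 'a \<Rightarrow> (nat \<Rightarrow> real)) \<Rightarrow> nat \<Rightarrow> (nat \<Rightarrow> real) \<Rightarrow> real" where
  "Vaux P T N g f 0 x = g (tgrid T N N) x"
| "Vaux P T N g f (Suc k) x =
     max (g (tgrid T N (N - Suc k)) x) (\<integral>\<omega>. Vaux P T N g f k (f (N - Suc k) x \<omega>) \<partial>P)"

definition Vfun :: "'a measure \<Rightarrow> real \<Rightarrow> nat \<Rightarrow> (real \<Rightarrow> (nat \<Rightarrow> real) \<Rightarrow> real)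
             \<Rightarrow> (nat \<Rightarrow> (nat \<Rightarrow> real) \<Rightarrow> 'a \<Rightarrow> (nat \<Rightarrow> real)) \<Rightarrow> nat \<Rightarrow> (nat \<Rightarrow> real) \<Rightarrow> real" where
  "Vfun P T N g f n = Vaux P T N g f (N - n)"

definition rho_tilde :: "'a measure \<Rightarrow> real \<Rightarrow> nat \<Rightarrow> nat \<Rightarrow> (real \<Rightarrow> 'a \<Rightarrow> nat \<Rightarrow> real)
             \<Rightarrow> (real \<Rightarrow> 'a \<Rightarrow> nat \<Rightarrow> real) \<Rightarrow> nat \<Rightarrow> nat \<Rightarrow> (nat \<Rightarrow> real) measure" where
  "rho_tilde P T N D W X N0 n =
     (let dt = T / real (N * N0); tk = (\<lambda>k. tgrid T N n + real k * dt) in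
      measure_of (space (RD D)) (sets (RD D))
        (\<lambda>A. \<integral>\<^sup>+\<omega>. ennreal ((\<Sum>k<N0. (vnorm D (vdiff D (W (tk (Suc k)) \<omega>) (W (tk k) \<omega>)))\<^sup>2)
                             * indicator A (X (tgrid T N (Suc n)) \<omega>)) \<partial>P))"

end

theory Submission imports Defs begin

text \<open>
  Backward induction over the exercise dates, uniformly over all measures \<open>\<nu>\<close> with a polynomially
  bounded second moment. If \<open>h\<close> approximates the next value function in \<open>L\<^sup>2\<close> of the law of
  \<open>f(x, \<omega>)\<close> under \<open>\<nu> \<otimes> P\<close>, then by Jensen's inequality its conditional expectation approximates the
  continuation value in \<open>L\<^sup>2(\<nu>)\<close>, and this expectation is replaced by a Monte Carlo average
  over finitely many realisations of the random network \<open>f\<close>, chosen to have both small error and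
  small total size. The result is a ReLU network, the maximum with the approximate payoff costs
  one more neuron, and a final clipping controls the growth.
  The second moment of \<open>\<rho>\<close> is bounded independently of \<open>N\<^sub>0\<close> by Young's inequality, from the \<open>p\<close>-th
  moments of \<open>X\<close> and the moments of the Gaussian increments.
\<close>

section \<open>ReLU circuits\<close>

text \<open>The induction cannot be run for \<rho> alone: going back one date applies the hypothesis
  to the image of \<nu> \<otimes> P under the transition, of which only a moment bound is known, and
  it demands a larger moment and a smaller error. Both are therefore tied to one number \<kappa>
  that also dominates 2 and D. Constants and powers of D are then below powers of \<kappa>, and each
  date only replaces \<kappa> by a fixed power and enlarges a natural exponent that depends on
  neither D nor \<kappa>. Only at the end is \<kappa> set to a power of 2 D divided by the squared
  error. The obstacle in \<rho> is that X at the later date may depend on the increments of W that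
  weight it, so weight and position are separated by an inequality, which uses the margin p > 2. The
  weight is a sum of N0 D squares whose m-th moments are of order (T / (N N0))^m, so the power mean
  inequality cancels N0. The sampled transitions come without a common growth bound, so samples are
  judged in mean square only, and clipping can use the linear growth of the value function, which is
  known beforehand.\<close>

text \<open>Networks are handled through straight-line programs, in which a gate may read all inputs and
  all earlier gates. Only the number of gates is counted: passing to and from layered networks is
  polynomial in this number, and sums, maxima and compositions need no depth adjustment.\<close>

inductive_set aff_span :: "nat \<Rightarrow> ((nat \<Rightarrow> real) \<Rightarrow> real) set \<Rightarrow> ((nat \<Rightarrow> real) \<Rightarrow> real) set"
  for D S where
  const: "(\<lambda>x. c) \<in> aff_span D S"
| coord: "i < D \<Longrightarrow> (\<lambda>x. x i) \<in> aff_span D S"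
| gate: "h \<in> S \<Longrightarrow> h \<in> aff_span D S"
| add: "h \<in> aff_span D S \<Longrightarrow> h' \<in> aff_span D S \<Longrightarrow> (\<lambda>x. h x + h' x) \<in> aff_span D S"
| scale: "h \<in> aff_span D S \<Longrightarrow> (\<lambda>x. c * h x) \<in> aff_span D S"

text \<open>The newest gate stands at the head, so the tail lists exactly the gates that it may
  read. A gate is represented by the function of the input that it computes, which turns composition
  into precomposition.\<close>

inductive relu_circuit :: "nat \<Rightarrow> ((nat \<Rightarrow> real) \<Rightarrow> real) list \<Rightarrow> bool" for D where
  Nil: "relu_circuit D []"
| Cons: "relu_circuit D fs \<Longrightarrow> h \<in> aff_span D (set fs) \<Longrightarrow> relu_circuit D ((\<lambda>x. relu (h x)) # fs)"

definition relu_computable :: "nat \<Rightarrow> nat \<Rightarrow> ((nat \<Rightarrow> real) \<Rightarrow> real) \<Rightarrow> bool" where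
  "relu_computable D s h \<longleftrightarrow> (\<exists>fs. relu_circuit D fs \<and> length fs \<le> s \<and> h \<in> aff_span D (set fs))"

lemma aff_span_mono: "h \<in> aff_span D S \<Longrightarrow> S \<subseteq> S' \<Longrightarrow> h \<in> aff_span D S'"
  by (induction rule: aff_span.induct) (auto intro: aff_span.intros)

lemma aff_span_sum:
  assumes "\<And>i. i \<in> A \<Longrightarrow> h i \<in> aff_span D S"
  shows "(\<lambda>x. \<Sum>i\<in>A. h i x) \<in> aff_span D S"
  using assms by (induction A rule: infinite_finite_induct) (auto intro: aff_span.intros)

lemma aff_span_compose:
  assumes "h \<in> aff_span E G" and "\<And>i. i < E \<Longrightarrow> (\<lambda>x. \<phi> x i) \<in> aff_span D S"
  shows "(\<lambda>x. h (\<phi> x)) \<in> aff_span D ((\<lambda>g x. g (\<phi> x)) ` G \<union> S)"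
  using assms
proof (induction rule: aff_span.induct)
  case (coord i)
  then show ?case by (meson aff_span_mono Un_upper2)
qed (auto intro: aff_span.intros)

lemma relu_circuit_append:
  "relu_circuit D gs \<Longrightarrow> relu_circuit D fs \<Longrightarrow> relu_circuit D (gs @ fs)"
proof (induction rule: relu_circuit.induct)
  case (Cons gs h)
  then have "h \<in> aff_span D (set (gs @ fs))" by (auto intro: aff_span_mono)
  with Cons show ?case by (auto intro: relu_circuit.Cons)
qed simp

text \<open>The outer gates, precomposed with \<phi>, are stacked on a single copy of
  \<open>fs\<close> that all coordinates of \<phi> share. Hence composition adds the two gate
  counts, whatever the intermediate dimension \<open>E\<close> is.\<close>

lemma relu_circuit_compose:
  assumes "relu_circuit E gs" "relu_circuit D fs"
    and "\<And>i. i < E \<Longrightarrow> (\<lambda>x. \<phi> x i) \<in> aff_span D (set fs)"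
  shows "relu_circuit D (map (\<lambda>g x. g (\<phi> x)) gs @ fs)"
  using assms
proof (induction rule: relu_circuit.induct)
  case (Cons gs h)
  then have "(\<lambda>x. h (\<phi> x)) \<in> aff_span D (set (map (\<lambda>g x. g (\<phi> x)) gs @ fs))"
    using aff_span_compose[of h E "set gs" \<phi> D "set fs"] by simp
  with Cons show ?case by (auto intro: relu_circuit.Cons)
qed simp

lemma relu_computable_mono: "relu_computable D s h \<Longrightarrow> s \<le> t \<Longrightarrow> relu_computable D t h"
  unfolding relu_computable_def by (meson order_trans)

lemma relu_computable_const: "relu_computable D 0 (\<lambda>x. c)"
  unfolding relu_computable_def by (auto intro: aff_span.const relu_circuit.Nil)

lemma relu_computable_coord: "i < D \<Longrightarrow> relu_computable D 0 (\<lambda>x. x i)"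
  unfolding relu_computable_def by (auto intro: aff_span.coord relu_circuit.Nil)

lemma relu_computable_scale: "relu_computable D s h \<Longrightarrow> relu_computable D s (\<lambda>x. c * h x)"
  unfolding relu_computable_def by (auto intro: aff_span.scale)

lemma relu_computable_add:
  assumes "relu_computable D s h" "relu_computable D t k"
  shows "relu_computable D (s + t) (\<lambda>x. h x + k x)"
proof -
  obtain fs where fs: "relu_circuit D fs" "length fs \<le> s" "h \<in> aff_span D (set fs)"
    using assms unfolding relu_computable_def by auto
  obtain gs where gs: "relu_circuit D gs" "length gs \<le> t" "k \<in> aff_span D (set gs)"
    using assms unfolding relu_computable_def by auto
  have "h \<in> aff_span D (set (fs @ gs))" "k \<in> aff_span D (set (fs @ gs))"
    using fs gs by (auto intro: aff_span_mono)
  then show ?thesis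
    unfolding relu_computable_def using fs gs
    by (intro exI[of _ "fs @ gs"]) (auto intro: relu_circuit_append aff_span.add)
qed

lemma relu_computable_diff:
  assumes "relu_computable D s h" "relu_computable D t k"
  shows "relu_computable D (s + t) (\<lambda>x. h x - k x)"
  using relu_computable_add[OF assms(1) relu_computable_scale[OF assms(2), of "-1"]] by simp

lemma relu_computable_sum:
  assumes "finite A" "\<And>i. i \<in> A \<Longrightarrow> relu_computable D (s i) (h i)"
  shows "relu_computable D (\<Sum>i\<in>A. s i) (\<lambda>x. \<Sum>i\<in>A. h i x)"
  using assms by (induction A) (auto intro: relu_computable_const relu_computable_add)

lemma relu_computable_relu:
  assumes "relu_computable D s h"
  shows "relu_computable D (Suc s) (\<lambda>x. relu (h x))"
proof -
  obtain fs where fs: "relu_circuit D fs" "length fs \<le> s" "h \<in> aff_span D (set fs)"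
    using assms unfolding relu_computable_def by auto
  then show ?thesis
    unfolding relu_computable_def
    by (intro exI[of _ "(\<lambda>x. relu (h x)) # fs"]) (auto intro: relu_circuit.intros aff_span.gate)
qed

text \<open>In max a b = a + relu (b - a) the first argument occurs twice, and the rule for sums
  concatenates circuits without sharing; this is the factor 2 before \<open>s\<close>.\<close>

lemma relu_computable_max:
  assumes "relu_computable D s h" "relu_computable D t k"
  shows "relu_computable D (2 * s + t + 1) (\<lambda>x. max (h x) (k x))"
proof -
  have "(\<lambda>x. max (h x) (k x)) = (\<lambda>x. h x + relu (k x - h x))"
    by (auto simp: relu_def max_def)
  moreover have "relu_computable D (s + Suc (t + s)) (\<lambda>x. h x + relu (k x - h x))"
    by (intro relu_computable_add relu_computable_relu relu_computable_diff assms)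
  ultimately show ?thesis by (simp add: mult_2 add.commute add.left_commute)
qed

lemma relu_computable_min:
  assumes "relu_computable D s h" "relu_computable D t k"
  shows "relu_computable D (2 * s + t + 1) (\<lambda>x. min (h x) (k x))"
proof -
  have "(\<lambda>x. min (h x) (k x)) = (\<lambda>x. -1 * max (-1 * h x) (-1 * k x))"
    by (auto simp: min_def max_def)
  moreover have "relu_computable D (2 * s + t + 1) (\<lambda>x. -1 * max (-1 * h x) (-1 * k x))"
    by (intro relu_computable_scale relu_computable_max assms)
  ultimately show ?thesis by simp
qed

lemma relu_computable_compose:
  assumes "relu_computable E s h" "relu_circuit D fs"
    and "\<And>i. i < E \<Longrightarrow> (\<lambda>x. \<phi> x i) \<in> aff_span D (set fs)"
  shows "relu_computable D (s + length fs) (\<lambda>x. h (\<phi> x))"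
proof -
  obtain gs where gs: "relu_circuit E gs" "length gs \<le> s" "h \<in> aff_span E (set gs)"
    using assms unfolding relu_computable_def by auto
  have "(\<lambda>x. h (\<phi> x)) \<in> aff_span D (set (map (\<lambda>g x. g (\<phi> x)) gs @ fs))"
    using aff_span_compose[OF gs(3) assms(3)] by simp
  then show ?thesis
    unfolding relu_computable_def
    using relu_circuit_compose[OF gs(1) assms(2,3)] gs(2)
    by (intro exI[of _ "map (\<lambda>g x. g (\<phi> x)) gs @ fs"]) auto
qed

section \<open>Measurability and sequential continuity of circuits\<close>

lemma aff_span_measurable:
  assumes "h \<in> aff_span D S" "\<And>g. g \<in> S \<Longrightarrow> g \<in> borel_measurable (RD D)"
  shows "h \<in> borel_measurable (RD D)"
  using assms
proof (induction rule: aff_span.induct)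
  case (coord i)
  then show ?case unfolding RD_def by (intro measurable_component_singleton) simp
qed (auto intro: borel_measurable_add borel_measurable_times)

lemma relu_circuit_measurable:
  "relu_circuit D fs \<Longrightarrow> g \<in> set fs \<Longrightarrow> g \<in> borel_measurable (RD D)"
proof (induction arbitrary: g rule: relu_circuit.induct)
  case (Cons fs h)
  then have "h \<in> borel_measurable (RD D)" by (auto intro: aff_span_measurable)
  then have "(\<lambda>x. relu (h x)) \<in> borel_measurable (RD D)" unfolding relu_def by measurable
  with Cons show ?case by auto
qed simp

lemma relu_computable_measurable:
  "relu_computable D s h \<Longrightarrow> h \<in> borel_measurable (RD D)"
  unfolding relu_computable_def by (auto intro: aff_span_measurable relu_circuit_measurable)

lemma aff_span_tendsto:
  assumes "h \<in> aff_span D S" "\<And>i. i < D \<Longrightarrow> (\<lambda>k. y k i) \<longlonglongrightarrow> x i"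
    "\<And>g. g \<in> S \<Longrightarrow> (\<lambda>k. g (y k)) \<longlonglongrightarrow> g x"
  shows "(\<lambda>k. h (y k)) \<longlonglongrightarrow> h x"
  using assms by (induction rule: aff_span.induct) (auto intro: tendsto_intros)

lemma relu_circuit_tendsto:
  assumes "relu_circuit D fs" "\<And>i. i < D \<Longrightarrow> (\<lambda>k. y k i) \<longlonglongrightarrow> x i" "g \<in> set fs"
  shows "(\<lambda>k. g (y k)) \<longlonglongrightarrow> g x"
  using assms
proof (induction arbitrary: g rule: relu_circuit.induct)
  case (Cons fs h)
  have "(\<lambda>k. h (y k)) \<longlonglongrightarrow> h x"
    using Cons by (intro aff_span_tendsto[OF Cons.hyps(2)]) auto
  then have "(\<lambda>k. relu (h (y k))) \<longlonglongrightarrow> relu (h x)" unfolding relu_def by (intro tendsto_intros)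
  with Cons show ?case by auto
qed simp

text \<open>The new gates read only \<open>fs\<close> and not each other, so they can be added one
  by one. The cost is the number of distinct preactivations: neurons computing the same function are
  paid for once.\<close>

lemma relu_circuit_add_layer:
  assumes "relu_circuit D fs" "finite Y" "Y \<subseteq> aff_span D (set fs)"
  shows "\<exists>fs'. relu_circuit D fs' \<and> set fs \<subseteq> set fs' \<and> length fs' \<le> length fs + card Y \<and>
    (\<forall>y\<in>Y. (\<lambda>x. relu (y x)) \<in> aff_span D (set fs'))"
  using assms(2,3)
proof (induction Y)
  case empty
  then show ?case using assms(1) by auto
next
  case (insert y Y)
  then obtain gs where gs: "relu_circuit D gs" "set fs \<subseteq> set gs" "length gs \<le> length fs + card Y"
    "\<forall>y\<in>Y. (\<lambda>x. relu (y x)) \<in> aff_span D (set gs)" by auto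
  let ?gs = "(\<lambda>x. relu (y x)) # gs"
  have "y \<in> aff_span D (set gs)" using insert gs by (auto intro: aff_span_mono)
  then have "relu_circuit D ?gs" using gs by (intro relu_circuit.Cons)
  moreover have "\<forall>z\<in>insert y Y. (\<lambda>x. relu (z x)) \<in> aff_span D (set ?gs)"
    using gs(4) by (auto intro: aff_span.gate aff_span_mono)
  ultimately show ?case using gs insert by (intro exI[of _ ?gs]) auto
qed

text \<open>Only neurons with a nonzero parameter need a gate, so neither the depth nor the number of
  identically vanishing neurons matters.\<close>

lemma rnn_layer_circuit:
  assumes "finite {(i,m,j). u i m j \<noteq> 0}"
  shows "\<exists>fs. relu_circuit D fs \<and> length fs \<le> card {(i',m,j). u i' m j \<noteq> 0 \<and> i' < i} \<and>
    (\<forall>j. (\<lambda>x. rnn_layer u D x i j) \<in> aff_span D (set fs))"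
proof (induction i)
  case 0
  have "(\<lambda>x. rnn_layer u D x 0 j) \<in> aff_span D (set [])" for j
    by (auto intro!: aff_span.add aff_span.const aff_span_sum aff_span.scale aff_span.coord)
  then show ?case by (intro exI[of _ "[]"]) (auto intro: relu_circuit.Nil)
next
  case (Suc i)
  let ?Z = "\<lambda>i. {(i',m,j). u i' m j \<noteq> 0 \<and> i' < i}"
  let ?Y = "{(i',m,j). u i' m j \<noteq> 0 \<and> i' = i}"
  \<comment> \<open>A neuron of layer \<open>i\<close> outside \<open>J\<close> has zero bias and
    zero incoming weights, so its value is 0 and so is its \<open>relu\<close>. The infinite sum in
    layer \<open>Suc i\<close> thus runs over the finite set \<open>J\<close>. Gates for layer
    \<open>i\<close> are paid for only here, which is why the count in the claim stops strictly
    below the current layer.\<close>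
  define J where "J = {j. \<exists>m. u i m j \<noteq> 0}"
  obtain fs where fs: "relu_circuit D fs" "length fs \<le> card (?Z i)"
    "\<And>j. (\<lambda>x. rnn_layer u D x i j) \<in> aff_span D (set fs)" using Suc by auto
  have finY: "finite ?Y" and finZ: "finite (?Z i)"
    by (rule finite_subset[OF _ assms], auto)+
  have J: "J = (\<lambda>(i,m,j). j) ` ?Y" unfolding J_def by force
  then have finJ: "finite J" and cardJ: "card J \<le> card ?Y"
    using finY by (auto intro: card_image_le)
  let ?L = "(\<lambda>j x. rnn_layer u D x i j) ` J"
  obtain gs where gs: "relu_circuit D gs" "set fs \<subseteq> set gs" "length gs \<le> length fs + card ?L"
    "\<forall>y\<in>?L. (\<lambda>x. relu (y x)) \<in> aff_span D (set gs)"
    using relu_circuit_add_layer[OF fs(1), of ?L] finJ fs(3) by auto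
  have Z: "?Z (Suc i) = ?Z i \<union> ?Y" by auto
  have "card (?Z (Suc i)) = card (?Z i) + card ?Y"
    unfolding Z using finY finZ by (intro card_Un_disjoint) auto
  moreover have "card ?L \<le> card J" using finJ by (rule card_image_le)
  ultimately have len: "length gs \<le> card (?Z (Suc i))" using gs(3) fs(2) cardJ by linarith
  have zero: "rnn_layer u D x i m = 0" if "m \<notin> J" for m x
    using that by (cases i) (auto simp: J_def)
  have "(\<lambda>x. rnn_layer u D x (Suc i) j) \<in> aff_span D (set gs)" for j
  proof -
    have "(\<lambda>x. rnn_layer u D x (Suc i) j) =
      (\<lambda>x. u (Suc i) 0 j + (\<Sum>m\<in>J. u (Suc i) (Suc m) j * relu (rnn_layer u D x i m)))"
    proof
      fix x
      have "(\<Sum>m. u (Suc i) (Suc m) j * relu (rnn_layer u D x i m)) =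
            (\<Sum>m\<in>J. u (Suc i) (Suc m) j * relu (rnn_layer u D x i m))"
        using zero by (intro suminf_finite finJ) (auto simp: relu_def)
      then show "rnn_layer u D x (Suc i) j =
        u (Suc i) 0 j + (\<Sum>m\<in>J. u (Suc i) (Suc m) j * relu (rnn_layer u D x i m))" by simp
    qed
    moreover have "(\<lambda>x. relu (rnn_layer u D x i m)) \<in> aff_span D (set gs)" if "m \<in> J" for m
      using gs(4) that by auto
    ultimately show ?thesis
      by (simp only:) (intro aff_span.add aff_span.const aff_span_sum aff_span.scale, auto)
  qed
  then show ?case using gs len by blast
qed

lemma rnn_fun_circuit:
  assumes "rnn_size u \<le> of_nat s"
  obtains fs where "relu_circuit D fs" "length fs \<le> s"
    "\<And>i. i < E \<Longrightarrow> (\<lambda>x. rnn_fun D E I u x i) \<in> aff_span D (set fs)"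
proof -
  let ?Z = "{(i,m,j). u i m j \<noteq> 0}"
  have fin: "finite ?Z"
  proof (rule ccontr)
    assume "infinite ?Z"
    then have "rnn_size u = \<infinity>" unfolding rnn_size_def by simp
    with assms show False by (simp add: top_unique)
  qed
  then have card: "card ?Z \<le> s"
    using assms unfolding rnn_size_def by simp
  obtain fs where fs: "relu_circuit D fs" "length fs \<le> card {(i',m,j). u i' m j \<noteq> 0 \<and> i' < I}"
    "\<And>j. (\<lambda>x. rnn_layer u D x I j) \<in> aff_span D (set fs)"
    using rnn_layer_circuit[OF fin] by blast
  have "card {(i',m,j). u i' m j \<noteq> 0 \<and> i' < I} \<le> card ?Z"
    by (rule card_mono[OF fin]) auto
  then show ?thesis using that[of fs] fs card by (auto simp: rnn_fun_def)
qed

section \<open>From layered networks to circuits\<close>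

lemma affine_conv_zip:
  "affine W b v = map (\<lambda>rc. sum_list (map2 (*) (fst rc) v) + snd rc) (zip W b)"
  unfolding affine_def by (induction W b rule: list_induct2') auto

lemma sum_list_map2_aff_span:
  fixes row :: "real list"
  assumes "set S \<subseteq> aff_span D G"
  shows "(\<lambda>x. sum_list (map2 (*) row (map (\<lambda>h. h x) S))) \<in> aff_span D G"
  using assms
  by (induction row S rule: list_induct2')
     (auto intro: aff_span.const intro!: aff_span.add aff_span.scale)

lemma sum_list_map2_zero:
  fixes row :: "real list"
  shows "\<forall>a\<in>set row. a = 0 \<Longrightarrow> sum_list (map2 (*) row v) = 0"
  by (induction row v rule: list_induct2') auto

text \<open>\<open>nn_size\<close> ignores zero parameters, so a neuron may be charged only if it
  has a nonzero parameter; each such neuron accounts for at least one entry on the right.\<close>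

lemma length_filter_nonzero_rows:
  "length (filter (\<lambda>rc. snd rc \<noteq> 0 \<or> (\<exists>a\<in>set (fst rc). a \<noteq> 0)) (zip W b))
    \<le> length (filter (\<lambda>a. a \<noteq> (0::real)) (concat W)) + length (filter (\<lambda>a. a \<noteq> (0::real)) b)"
proof (induction W b rule: list_induct2')
  case (4 row W c b)
  have "1 \<le> length (filter (\<lambda>a. a \<noteq> 0) row)" if "\<exists>a\<in>set row. a \<noteq> 0"
    using that by (metis (mono_tags, lifting) One_nat_def Suc_leI filter_empty_conv length_greater_0_conv)
  with 4 show ?case by (cases "\<exists>a\<in>set row. a \<noteq> 0"; cases "c = 0") simp_all
qed auto

text \<open>\<open>S\<close> lists the functions computed by the layers already consumed. Letting
  them be arbitrary affine combinations of the gates so far makes the induction over the remaining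
  layers work.\<close>

lemma nn_eval_circuit:
  assumes "L \<noteq> []" "nn_dims_ok (length S) L d" "relu_circuit D fs" "set S \<subseteq> aff_span D (set fs)"
  shows "\<exists>fs' S'. relu_circuit D fs' \<and> length fs' \<le> length fs + nn_size L \<and>
    length S' = d \<and> set S' \<subseteq> aff_span D (set fs') \<and>
    (\<forall>x. nn_eval L (map (\<lambda>h. h x) S) = map (\<lambda>h. h x) S')"
  using assms
proof (induction L arbitrary: S fs)
  case (Cons Wb L)
  obtain W b where Wb: "Wb = (W, b)" by (cases Wb)
  define neu where "neu rc = (\<lambda>x. sum_list (map2 (*) (fst rc) (map (\<lambda>h. h x) S)) + snd rc)"
    for rc :: "real list \<times> real"
  have neu: "neu rc \<in> aff_span D (set fs)" for rc
    unfolding neu_def by (intro aff_span.add aff_span.const sum_list_map2_aff_span Cons.prems)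
  have aff: "affine W b (map (\<lambda>h. h x) S) = map (\<lambda>rc. neu rc x) (zip W b)" for x
    unfolding affine_conv_zip neu_def by simp
  have len: "length b = length W" "nn_dims_ok (length W) L d" using Cons.prems Wb by auto
  show ?case
  proof (cases "L = []")
    case True
    with len Wb Cons.prems neu show ?thesis
      by (intro exI[of _ fs] exI[of _ "map neu (zip W b)"]) (auto simp: aff)
  next
    case False
    \<comment> \<open>The live neurons. A neuron outside \<open>?R\<close> outputs relu 0 = 0, a
      constant that needs no gate.\<close>
    let ?R = "filter (\<lambda>rc. snd rc \<noteq> 0 \<or> (\<exists>a\<in>set (fst rc). a \<noteq> 0)) (zip W b)"
    have "neu ` set ?R \<subseteq> aff_span D (set fs)" using neu by blast
    from relu_circuit_add_layer[OF Cons.prems(3) _ this]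
    obtain gs where gs: "relu_circuit D gs" "set fs \<subseteq> set gs"
      "length gs \<le> length fs + card (neu ` set ?R)"
      "\<forall>y\<in>neu ` set ?R. (\<lambda>x. relu (y x)) \<in> aff_span D (set gs)" by blast
    have "card (neu ` set ?R) \<le> card (set ?R)" by (rule card_image_le) simp
    also have "\<dots> \<le> length ?R" by (rule card_length)
    also note length_filter_nonzero_rows
    finally have lgs: "length gs + nn_size L \<le> length fs + nn_size (Wb # L)"
      using gs(3) by (simp add: nn_size_def Wb)
    define S1 where "S1 = map (\<lambda>rc x. relu (neu rc x)) (zip W b)"
    have "(\<lambda>x. relu (neu rc x)) \<in> aff_span D (set gs)" if "rc \<in> set (zip W b)" for rc
    proof (cases "rc \<in> set ?R")
      case False
      with that have "neu rc = (\<lambda>x. 0)" unfolding neu_def by (auto simp: sum_list_map2_zero)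
      then show ?thesis by (simp add: relu_def aff_span.const)
    next
      case True
      then show ?thesis using gs(4) by blast
    qed
    then have "set S1 \<subseteq> aff_span D (set gs)" by (auto simp: S1_def)
    moreover have "length S1 = length W" using len by (simp add: S1_def)
    ultimately obtain fs' S' where *: "relu_circuit D fs'" "length fs' \<le> length gs + nn_size L"
      "length S' = d" "set S' \<subseteq> aff_span D (set fs')"
      "\<And>x. nn_eval L (map (\<lambda>h. h x) S1) = map (\<lambda>h. h x) S'"
      using Cons.IH[of S1 gs] False len gs by auto
    have "nn_eval (Wb # L) (map (\<lambda>h. h x) S) = map (\<lambda>h. h x) S'" for x
      using False *(5)[of x] by (simp add: Wb aff S1_def comp_def)
    then show ?thesis using * lgs by (intro exI[of _ fs'] exI[of _ S']) auto
  qed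
qed simp

lemma nn_real_computable:
  assumes "nn_wf D 1 L"
  shows "relu_computable D (nn_size L) (nn_real D L)"
proof -
  let ?S = "map (\<lambda>i (x::nat \<Rightarrow> real). x i) [0..<D]"
  have 1: "set ?S \<subseteq> aff_span D (set [])" by (auto intro: aff_span.coord)
  have 2: "L \<noteq> []" "nn_dims_ok (length ?S) L 1" using assms by (auto simp: nn_wf_def)
  from nn_eval_circuit[OF 2 relu_circuit.Nil 1] obtain fs S where *: "relu_circuit D fs" "length fs \<le> length ([] :: ((nat \<Rightarrow> real) \<Rightarrow> real) list) + nn_size L" "length S = 1"
    "set S \<subseteq> aff_span D (set fs)" "\<forall>x. nn_eval L (map (\<lambda>h. h x) ?S) = map (\<lambda>h. h x) S" by blast
  have "nn_real D L = hd S"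
  proof
    fix x show "nn_real D L x = hd S x"
      using spec[OF *(5), of x] *(3) unfolding nn_real_def by (cases S) (auto simp: comp_def)
  qed
  then show ?thesis
    using * unfolding relu_computable_def by (cases S) auto
qed

section \<open>From circuits to layered networks\<close>

text \<open>In contrast to \<open>nn_eval\<close>, the activation is applied after the last layer
  too, so that networks can be extended at the output end, one gate at a time.\<close>

definition nn_hidden :: "(real list list \<times> real list) list \<Rightarrow> real list \<Rightarrow> real list" where
  "nn_hidden L v = foldl (\<lambda>v (W, b). map relu (affine W b v)) v L"

lemma nn_eval_snoc: "nn_eval (L @ [(W, b)]) v = affine W b (nn_hidden L v)"
  by (induction L arbitrary: v) (auto simp: nn_hidden_def)

lemma nn_dims_ok_snoc:
  assumes "nn_dims_ok d L k" "length b = length W" "\<forall>row\<in>set W. length row = k"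
  shows "nn_dims_ok d (L @ [(W, b)]) (length W)"
  using assms by (induction L arbitrary: d) auto

lemma nn_size_snoc_le:
  assumes "length b = length W" "\<forall>row\<in>set W. length row = k"
  shows "nn_size (L @ [(W, b)]) \<le> nn_size L + length W * (k + 1)"
proof -
  have "length (concat W) = length W * k" using assms(2) by (induction W) auto
  moreover have "length (filter (\<lambda>a. a \<noteq> 0) (concat W)) \<le> length (concat W)"
    "length (filter (\<lambda>a. a \<noteq> 0) b) \<le> length b" by auto
  ultimately show ?thesis using assms(1) by (simp add: nn_size_def)
qed

lemma sum_list_map2_upt:
  assumes "length v = l"
  shows "sum_list (map2 (*) (map w [0..<l]) v) = (\<Sum>k<l. w k * v ! k :: real)"
proof -
  have "map2 (*) (map w [0..<l]) v = map (\<lambda>k. w k * v ! k) [0..<l]"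
    using assms by (intro nth_equalityI) auto
  then show ?thesis by (simp add: sum_list_sum_nth atLeast0LessThan)
qed

definition unit_row :: "nat \<Rightarrow> nat \<Rightarrow> real \<Rightarrow> real list" where
  "unit_row l i a = map (\<lambda>j. if j = i then a else 0) [0..<l]"

lemma sum_list_map2_unit_row:
  assumes "length v = l" "i < l"
  shows "sum_list (map2 (*) (unit_row l i a) v) = a * v ! i"
proof -
  have "(\<Sum>k<l. (if k = i then a else 0) * v ! k) = (\<Sum>k<l. if k = i then a * v ! k else 0)"
    by (intro sum.cong) auto
  then show ?thesis unfolding unit_row_def sum_list_map2_upt[OF assms(1)] using assms(2) by simp
qed

text \<open>These nonnegative functions pass unchanged through every later \<open>relu\<close>, and
  their differences give back the input coordinates. Carrying them along keeps the input readable in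
  every layer.\<close>

definition pos_neg_coords :: "nat \<Rightarrow> ((nat \<Rightarrow> real) \<Rightarrow> real) list" where
  "pos_neg_coords D = map (\<lambda>i x. relu (x i)) [0..<D] @ map (\<lambda>i x. relu (- x i)) [0..<D]"

lemma length_pos_neg_coords [simp]: "length (pos_neg_coords D) = 2 * D"
  by (simp add: pos_neg_coords_def)

text \<open>The last layer offers only the entries of \<open>S\<close>, so a coordinate is expressed
  as its positive part minus its negative part. Functions with such a representation contain the
  generators and are closed under sums and scalings.\<close>

lemma aff_span_coefficients:
  assumes "h \<in> aff_span D G" "G \<union> set (pos_neg_coords D) \<subseteq> set S"
  shows "\<exists>w c. \<forall>x. h x = (\<Sum>k<length S. w k * (S ! k) x) + c"
proof -
  let ?P = "\<lambda>h. \<exists>w c. \<forall>x. h x = (\<Sum>k<length S. w k * (S ! k) x) + c"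
  have mem: "?P h" if h: "h \<in> set S" for h
  proof -
    obtain i where i: "i < length S" "S ! i = h" using h by (auto simp: in_set_conv_nth)
    have "(\<Sum>k<length S. (if k = i then 1 else 0) * (S ! k) x) = h x" for x
    proof -
      have "(\<Sum>k<length S. (if k = i then 1 else 0) * (S ! k) x) = (\<Sum>k<length S. if k = i then (S ! k) x else 0)"
        by (intro sum.cong) auto
      then show ?thesis using i by simp
    qed
    then show ?thesis by (intro exI[of _ "\<lambda>k. if k = i then 1 else 0"] exI[of _ 0]) auto
  qed
  have add: "?P (\<lambda>x. h x + h' x)" if "?P h" "?P h'" for h h'
  proof -
    from that obtain w c w' c' where "\<forall>x. h x = (\<Sum>k<length S. w k * (S ! k) x) + c"
      "\<forall>x. h' x = (\<Sum>k<length S. w' k * (S ! k) x) + c'" by auto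
    then show ?thesis
      by (intro exI[of _ "\<lambda>k. w k + w' k"] exI[of _ "c + c'"]) (simp add: sum.distrib distrib_right)
  qed
  have scale: "?P (\<lambda>x. a * h x)" if "?P h" for h a
  proof -
    from that obtain w c where "\<forall>x. h x = (\<Sum>k<length S. w k * (S ! k) x) + c" by auto
    then show ?thesis
      by (intro exI[of _ "\<lambda>k. a * w k"] exI[of _ "a * c"])
         (simp add: sum_distrib_left distrib_left mult.assoc)
  qed
  show ?thesis
    using assms
  proof (induction rule: aff_span.induct)
    case (const c)
    then show ?case by (intro exI[of _ "\<lambda>k. 0"] exI[of _ c]) auto
  next
    case (coord i)
    then have "(\<lambda>x. relu (x i)) \<in> set S" "(\<lambda>x. relu (- x i)) \<in> set S"
      by (auto simp: pos_neg_coords_def)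
    from add[OF mem[OF this(1)] scale[OF mem[OF this(2)], of "-1"]]
    obtain w c where "\<forall>x. relu (x i) + -1 * relu (- x i) = (\<Sum>k<length S. w k * (S ! k) x) + c"
      by blast
    moreover have "relu (x i) + -1 * relu (- x i) = x i" for x :: "nat \<Rightarrow> real"
      by (auto simp: relu_def max_def)
    ultimately have "\<forall>x. x i = (\<Sum>k<length S. w k * (S ! k) x) + c" by metis
    then show ?case by blast
  next
    case (gate h)
    then show ?case by (intro mem) auto
  next
    case (add h h')
    then show ?case using \<open>\<And>h h'. ?P h \<Longrightarrow> ?P h' \<Longrightarrow> ?P (\<lambda>x. h x + h' x)\<close> by blast
  next
    case (scale h c)
    then show ?case using \<open>\<And>h a. ?P h \<Longrightarrow> ?P (\<lambda>x. a * h x)\<close> by blast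
  qed
qed

text \<open>One layer per gate: it computes the new gate and copies everything else by unit rows.
  Together with the input layer this makes \<open>length fs + 1\<close> layers, each with at most (l
  + 1)^2 parameters for l = \<open>length fs + 2 * D\<close>.\<close>

lemma relu_circuit_hidden:
  assumes "relu_circuit D fs"
  shows "\<exists>L. nn_dims_ok D L (length fs + 2 * D) \<and>
    nn_size L \<le> (length fs + 1) * (length fs + 2 * D + 1)\<^sup>2 \<and>
    (\<forall>x. nn_hidden L (map x [0..<D]) = map (\<lambda>h. h x) (fs @ pos_neg_coords D))"
  using assms
proof (induction rule: relu_circuit.induct)
  case Nil
  let ?W = "map (\<lambda>i. unit_row D i 1) [0..<D] @ map (\<lambda>i. unit_row D i (-1)) [0..<D]"
  let ?b = "replicate (2 * D) (0::real)"
  have len: "length ?b = length ?W" "\<forall>row\<in>set ?W. length row = D" by (auto simp: unit_row_def)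
  have "nn_dims_ok D ([] @ [(?W, ?b)]) (length ?W)"
    by (rule nn_dims_ok_snoc) (use len in auto)
  moreover have "nn_size ([] @ [(?W, ?b)]) \<le> (2 * D + 1)\<^sup>2"
  proof -
    have "nn_size ([] @ [(?W, ?b)]) \<le> nn_size [] + length ?W * (D + 1)" by (rule nn_size_snoc_le[OF len])
    also have "\<dots> \<le> (2 * D + 1) * (2 * D + 1)"
      unfolding nn_size_def by (simp add: algebra_simps)
    finally show ?thesis unfolding power2_eq_square .
  qed
  moreover have "nn_hidden ([] @ [(?W, ?b)]) (map x [0..<D]) = map (\<lambda>h. h x) (pos_neg_coords D)" for x
    unfolding nn_hidden_def affine_conv_zip pos_neg_coords_def
    by (intro nth_equalityI) (auto simp: nth_append sum_list_map2_unit_row)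
  ultimately show ?case by (intro exI[of _ "[] @ [(?W, ?b)]"]) (auto simp: mult_2)
next
  case (Cons fs h)
  let ?S = "fs @ pos_neg_coords D"
  let ?l = "length fs + 2 * D"
  have lS: "length ?S = ?l" by simp
  obtain L where L: "nn_dims_ok D L ?l" "nn_size L \<le> (length fs + 1) * (?l + 1)\<^sup>2"
    "\<And>x. nn_hidden L (map x [0..<D]) = map (\<lambda>h. h x) ?S" using Cons.IH by auto
  obtain w c where w: "\<And>x. h x = (\<Sum>k<length ?S. w k * (?S ! k) x) + c"
    using aff_span_coefficients[OF Cons.hyps(2), of ?S] by auto
  let ?W = "map w [0..<?l] # map (\<lambda>i. unit_row ?l i 1) [0..<?l]"
  let ?b = "c # replicate ?l 0"
  have len: "length ?b = length ?W" "\<forall>row\<in>set ?W. length row = ?l" by (auto simp: unit_row_def)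
  \<comment> \<open>Every carried function is itself of the form relu (k x), hence nonnegative, so
    the activation does not disturb the copies.\<close>
  have nonneg: "relu (g x) = g x" if "g \<in> set ?S" for g x
  proof -
    have "\<exists>k. g = (\<lambda>x. relu (k x))"
      using Cons.hyps(1) that
    proof (induction rule: relu_circuit.induct)
      case Nil
      then show ?case by (auto simp: pos_neg_coords_def)
    qed auto
    then show ?thesis by (auto simp: relu_def)
  qed
  have "nn_hidden (L @ [(?W, ?b)]) (map x [0..<D]) =
      map (\<lambda>h. h x) (((\<lambda>x. relu (h x)) # fs) @ pos_neg_coords D)" for x
  proof -
    let ?v = "map (\<lambda>h. h x) ?S"
    have lv: "length ?v = ?l" using lS by simp
    have "affine ?W ?b ?v = h x # ?v"
    proof -
      have "sum_list (map2 (*) (map w [0..<?l]) ?v) + c = h x"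
        unfolding sum_list_map2_upt[OF lv] w[of x] lS by (auto simp: lS simp del: nth_append map_append intro!: sum.cong)
      moreover have "map (\<lambda>rc. sum_list (map2 (*) (fst rc) ?v) + snd rc)
          (zip (map (\<lambda>i. unit_row ?l i 1) [0..<?l]) (replicate ?l 0)) = ?v"
        using lv by (intro nth_equalityI) (auto simp: sum_list_map2_unit_row[OF lv] simp del: map_append)
      ultimately show ?thesis unfolding affine_conv_zip by simp
    qed
    moreover have "map relu ?v = ?v" using nonneg by (auto simp: comp_def)
    ultimately show ?thesis using L(3)[of x] by (simp add: nn_hidden_def)
  qed
  moreover have "nn_dims_ok D (L @ [(?W, ?b)]) (length ?W)"
    by (rule nn_dims_ok_snoc[OF L(1)]) (use len in auto)
  moreover have "nn_size (L @ [(?W, ?b)]) \<le> (Suc (length fs) + 1) * (Suc (length fs) + 2 * D + 1)\<^sup>2"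
  proof -
    have "nn_size (L @ [(?W, ?b)]) \<le> (length fs + 1) * (?l + 1)\<^sup>2 + (?l + 1) * (?l + 1)"
      using nn_size_snoc_le[OF len, of L] L(2) by simp
    also have "\<dots> = (length fs + 2) * (?l + 1)\<^sup>2" by (simp add: power2_eq_square algebra_simps)
    also have "\<dots> \<le> (length fs + 2) * (?l + 2)\<^sup>2" by (intro mult_left_mono power_mono) auto
    finally show ?thesis by simp
  qed
  ultimately show ?case by (intro exI[of _ "L @ [(?W, ?b)]"]) (simp del: nn_dims_ok.simps)
qed

text \<open>A final affine row reads off \<open>h\<close> from the carried values. The bound is
  cubic because there is one layer per gate and each layer is at most quadratic in its
  width.\<close>

lemma relu_computable_nn_real:
  assumes "relu_computable D s h"
  shows "\<exists>L. nn_wf D 1 L \<and> nn_size L \<le> (s + 2) * (s + 2 * D + 1)\<^sup>2 \<and> nn_real D L = h"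
proof -
  obtain fs where fs: "relu_circuit D fs" "length fs \<le> s" "h \<in> aff_span D (set fs)"
    using assms unfolding relu_computable_def by auto
  let ?S = "fs @ pos_neg_coords D"
  let ?l = "length fs + 2 * D"
  have lS: "length ?S = ?l" by simp
  obtain L where L: "nn_dims_ok D L ?l" "nn_size L \<le> (length fs + 1) * (?l + 1)\<^sup>2"
    "\<And>x. nn_hidden L (map x [0..<D]) = map (\<lambda>h. h x) ?S"
    using relu_circuit_hidden[OF fs(1)] by auto
  obtain w c where w: "\<And>x. h x = (\<Sum>k<length ?S. w k * (?S ! k) x) + c"
    using aff_span_coefficients[OF fs(3), of ?S] by auto
  let ?W = "[map w [0..<?l]]" and ?b = "[c]"
  have len: "length ?b = length ?W" "\<forall>row\<in>set ?W. length row = ?l" by auto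
  have "nn_real D (L @ [(?W, ?b)]) x = h x" for x
  proof -
    let ?v = "map (\<lambda>h. h x) ?S"
    have lv: "length ?v = ?l" using lS by simp
    have "sum_list (map2 (*) (map w [0..<?l]) ?v) + c = h x"
      unfolding sum_list_map2_upt[OF lv] w[of x] lS
      by (auto simp: lS simp del: nth_append map_append intro!: sum.cong)
    then show ?thesis unfolding nn_real_def nn_eval_snoc L(3) affine_conv_zip by simp
  qed
  moreover have "nn_wf D 1 (L @ [(?W, ?b)])"
    using nn_dims_ok_snoc[OF L(1) len] by (simp add: nn_wf_def)
  moreover have "nn_size (L @ [(?W, ?b)]) \<le> (s + 2) * (s + 2 * D + 1)\<^sup>2"
  proof -
    have "nn_size (L @ [(?W, ?b)]) \<le> (length fs + 1) * (?l + 1)\<^sup>2 + (?l + 1) * (?l + 1)"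
      using nn_size_snoc_le[OF len, of L] L(2) by simp
    also have "\<dots> = (length fs + 2) * (?l + 1)\<^sup>2" by (simp add: power2_eq_square algebra_simps)
    also have "\<dots> \<le> (s + 2) * (s + 2 * D + 1)\<^sup>2" using fs(2) by (intro mult_mono power_mono) auto
    finally show ?thesis .
  qed
  ultimately show ?thesis by blast
qed

section \<open>Sampling\<close>

lemma space_RD: "space (RD D) = extensional {..<D}"
  unfolding RD_def space_PiM by (auto simp: PiE_def)

lemma measurable_coord_RD: "i < D \<Longrightarrow> (\<lambda>x. x i) \<in> borel_measurable (RD D)"
  unfolding RD_def by (intro measurable_component_singleton) simp

lemma measurable_RD_I:
  assumes "\<And>i. i < D \<Longrightarrow> (\<lambda>\<omega>. g \<omega> i) \<in> borel_measurable M" "\<And>\<omega>. \<omega> \<in> space M \<Longrightarrow> g \<omega> \<in> extensional {..<D}"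
  shows "g \<in> measurable M (RD D)"
  unfolding RD_def using assms by (intro measurable_PiM_single') (auto simp: PiE_def)

lemma measurable_vnorm [measurable]: "vnorm D \<in> borel_measurable (RD D)"
proof -
  have "vnorm D = (\<lambda>x. sqrt (\<Sum>i<D. (x i)\<^sup>2))" by (auto simp: vnorm_def L2_set_def)
  moreover have "(\<lambda>x. sqrt (\<Sum>i<D. (x i)\<^sup>2)) \<in> borel_measurable (RD D)"
    unfolding RD_def by measurable
  ultimately show ?thesis by simp
qed

lemma vnorm_nonneg [simp]: "0 \<le> vnorm D x"
  by (simp add: vnorm_def L2_set_nonneg)

text \<open>The existence principle behind the choice of samples. If \<Psi> exceeded
  \<open>c\<close> at every point satisfying \<open>G\<close>, then \<Psi> - c would be positive
  almost everywhere, while a mean of at most \<open>c\<close> < \<infinity> forces its integral to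
  be 0.\<close>

lemma (in prob_space) ex_le_nn_integral:
  assumes "AE \<omega> in M. G \<omega>" "\<Psi> \<in> borel_measurable M" "(\<integral>\<^sup>+\<omega>. \<Psi> \<omega> \<partial>M) \<le> c" "c < \<infinity>"
  shows "\<exists>\<omega>\<in>space M. G \<omega> \<and> \<Psi> \<omega> \<le> c"
proof (rule ccontr)
  assume "\<not> ?thesis"
  then have *: "c < \<Psi> \<omega>" if "\<omega> \<in> space M" "G \<omega>" for \<omega> using that by (auto simp: not_le)
  have gt: "AE \<omega> in M. c < \<Psi> \<omega>" using assms(1) AE_space by eventually_elim (rule *)
  have "(\<integral>\<^sup>+\<omega>. c + (\<Psi> \<omega> - c) \<partial>M) = (\<integral>\<^sup>+\<omega>. \<Psi> \<omega> \<partial>M)"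
    using gt
    by (intro nn_integral_cong_AE, eventually_elim) (intro add_diff_inverse_ennreal less_imp_le)
  also have "(\<integral>\<^sup>+\<omega>. c + (\<Psi> \<omega> - c) \<partial>M) = c + (\<integral>\<^sup>+\<omega>. \<Psi> \<omega> - c \<partial>M)"
    using assms(2) by (subst nn_integral_add) (auto simp: emeasure_space_1)
  finally have "c + (\<integral>\<^sup>+\<omega>. \<Psi> \<omega> - c \<partial>M) \<le> c + 0" using assms(3) by simp
  then have "(\<integral>\<^sup>+\<omega>. \<Psi> \<omega> - c \<partial>M) = 0" using assms(4) by (subst (asm) ennreal_add_left_cancel_le) auto
  then have "AE \<omega> in M. \<Psi> \<omega> - c = 0" using assms(2) by (subst (asm) nn_integral_0_iff_AE) auto
  with gt have "AE \<omega> in M. False" by eventually_elim (auto simp: diff_eq_0_iff_ennreal)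
  then show False by simp
qed

text \<open>The centred variable is orthogonal to the constant \<open>a\<close>, so the left side
  equals a^2 plus the variance of \<phi>, and the variance is at most the second moment. With
  \<open>a\<close> as the error accumulated so far, this replaces the additivity of variances of
  independent samples.\<close>

lemma (in prob_space) nn_integral_square_centered_le:
  fixes \<phi> :: "'a \<Rightarrow> real"
  assumes [measurable]: "\<phi> \<in> borel_measurable M" and fin: "(\<integral>\<^sup>+\<omega>. ennreal ((\<phi> \<omega>)\<^sup>2) \<partial>M) < \<infinity>"
  shows "(\<integral>\<^sup>+\<omega>. ennreal ((a + (\<phi> \<omega> - (\<integral>\<omega>. \<phi> \<omega> \<partial>M)))\<^sup>2) \<partial>M)
    \<le> ennreal (a\<^sup>2) + (\<integral>\<^sup>+\<omega>. ennreal ((\<phi> \<omega>)\<^sup>2) \<partial>M)"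
proof -
  have sq: "integrable M (\<lambda>\<omega>. (\<phi> \<omega>)\<^sup>2)" using fin by (intro integrableI_bounded) auto
  then have int: "integrable M \<phi>" by (rule square_integrable_imp_integrable[rotated]) simp
  define m where "m = (\<integral>\<omega>. \<phi> \<omega> \<partial>M)"
  have eq: "(a + (\<phi> \<omega> - m))\<^sup>2 = (\<phi> \<omega>)\<^sup>2 + (2 * (a - m)) * \<phi> \<omega> + (a - m)\<^sup>2" for \<omega>
    by (simp add: power2_eq_square algebra_simps)
  have int2: "integrable M (\<lambda>\<omega>. (a + (\<phi> \<omega> - m))\<^sup>2)" unfolding eq using sq int by auto
  have "(\<integral>\<^sup>+\<omega>. ennreal ((a + (\<phi> \<omega> - m))\<^sup>2) \<partial>M) = ennreal (\<integral>\<omega>. (a + (\<phi> \<omega> - m))\<^sup>2 \<partial>M)"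
    using int2 by (intro nn_integral_eq_integral) auto
  also have "(\<integral>\<omega>. (a + (\<phi> \<omega> - m))\<^sup>2 \<partial>M) = (\<integral>\<omega>. (\<phi> \<omega>)\<^sup>2 \<partial>M) + 2 * (a - m) * m + (a - m)\<^sup>2"
    unfolding eq using sq int by (simp add: m_def prob_space)
  also have "\<dots> = a\<^sup>2 + (\<integral>\<omega>. (\<phi> \<omega>)\<^sup>2 \<partial>M) - m\<^sup>2" by (simp add: power2_eq_square algebra_simps)
  also have "ennreal \<dots> \<le> ennreal (a\<^sup>2 + (\<integral>\<omega>. (\<phi> \<omega>)\<^sup>2 \<partial>M))" by (intro ennreal_leI) auto
  also have "\<dots> = ennreal (a\<^sup>2) + (\<integral>\<^sup>+\<omega>. ennreal ((\<phi> \<omega>)\<^sup>2) \<partial>M)"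
    using sq by (subst nn_integral_eq_integral) auto
  finally show ?thesis unfolding m_def .
qed

lemma (in prob_space) square_integral_le_nn_integral:
  fixes \<phi> :: "'a \<Rightarrow> real"
  assumes [measurable]: "\<phi> \<in> borel_measurable M"
  shows "ennreal ((\<integral>\<omega>. \<phi> \<omega> \<partial>M)\<^sup>2) \<le> (\<integral>\<^sup>+\<omega>. ennreal ((\<phi> \<omega>)\<^sup>2) \<partial>M)"
proof (cases "(\<integral>\<^sup>+\<omega>. ennreal ((\<phi> \<omega>)\<^sup>2) \<partial>M) < \<infinity>")
  case True
  then have sq: "integrable M (\<lambda>\<omega>. (\<phi> \<omega>)\<^sup>2)" by (intro integrableI_bounded) auto
  have int: "integrable M \<phi>" using sq by (rule square_integrable_imp_integrable[rotated]) simp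
  have "variance \<phi> = expectation (\<lambda>x. (\<phi> x)\<^sup>2) - (expectation \<phi>)\<^sup>2" using int sq by (rule variance_eq)
  then have "(expectation \<phi>)\<^sup>2 \<le> expectation (\<lambda>x. (\<phi> x)\<^sup>2)"
    using variance_positive[of \<phi>] by linarith
  then show ?thesis using sq by (subst nn_integral_eq_integral) (auto intro: ennreal_leI)
next
  case False
  then show ?thesis by (simp add: less_top[symmetric])
qed

text \<open>Samples are chosen one at a time, each keeping the potential \<open>s \<cdot> error + v \<cdot> size\<close> below its
  mean; this replaces independent sampling from a product space.\<close>

lemma (in prob_space) monte_carlo_greedy:
  fixes \<phi> :: "'b \<Rightarrow> 'a \<Rightarrow> real" and sz :: "'a \<Rightarrow> ennreal"
  assumes \<nu>: "sigma_finite_measure \<nu>"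
    and \<phi>[measurable]: "(\<lambda>(x, \<omega>). \<phi> x \<omega>) \<in> borel_measurable (\<nu> \<Otimes>\<^sub>M M)"
    and sz[measurable]: "sz \<in> borel_measurable M"
    and sz_le: "(\<integral>\<^sup>+\<omega>. sz \<omega> \<partial>M) \<le> s" and s: "s < \<infinity>"
    and v_le: "(\<integral>\<^sup>+x. \<integral>\<^sup>+\<omega>. ennreal ((\<phi> x \<omega>)\<^sup>2) \<partial>M \<partial>\<nu>) \<le> v" and v: "v < \<infinity>"
    and good: "AE \<omega> in M. G \<omega>"
  shows "\<exists>\<omega>s::nat \<Rightarrow> 'a. (\<forall>i<n. \<omega>s i \<in> space M \<and> G (\<omega>s i)) \<and>
    s * (\<integral>\<^sup>+x. ennreal ((\<Sum>i<n. \<phi> x (\<omega>s i) - (\<integral>\<omega>. \<phi> x \<omega> \<partial>M))\<^sup>2) \<partial>\<nu>) + v * (\<Sum>i<n. sz (\<omega>s i))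
      \<le> 2 * of_nat n * (s * v)"
proof (induction n)
  case 0
  show ?case by simp
next
  case (Suc n)
  interpret \<nu>: sigma_finite_measure \<nu> by fact
  interpret pair: pair_sigma_finite \<nu> M ..
  define m where "m x = (\<integral>\<omega>. \<phi> x \<omega> \<partial>M)" for x
  have [measurable]: "m \<in> borel_measurable \<nu>"
    unfolding m_def using \<phi> by (rule borel_measurable_lebesgue_integral)
  obtain \<omega>s where \<omega>s: "\<forall>i<n. \<omega>s i \<in> space M \<and> G (\<omega>s i)"
    "s * (\<integral>\<^sup>+x. ennreal ((\<Sum>i<n. \<phi> x (\<omega>s i) - m x)\<^sup>2) \<partial>\<nu>) + v * (\<Sum>i<n. sz (\<omega>s i))
      \<le> 2 * of_nat n * (s * v)" using Suc by (auto simp: m_def)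
  define S where "S x = (\<Sum>i<n. \<phi> x (\<omega>s i) - m x)" for x
  have sect: "(\<lambda>x. \<phi> x \<omega>) \<in> borel_measurable \<nu>" if "\<omega> \<in> space M" for \<omega>
    using measurable_compose[OF measurable_Pair2'[OF that] \<phi>] by simp
  have [measurable]: "S \<in> borel_measurable \<nu>"
    unfolding S_def using \<omega>s(1) by (intro borel_measurable_sum borel_measurable_diff sect) auto
  have AEfin: "AE x in \<nu>. (\<integral>\<^sup>+\<omega>. ennreal ((\<phi> x \<omega>)\<^sup>2) \<partial>M) < \<infinity>"
  proof -
    have "AE x in \<nu>. (\<integral>\<^sup>+\<omega>. ennreal ((\<phi> x \<omega>)\<^sup>2) \<partial>M) \<noteq> \<infinity>"
      using le_less_trans[OF v_le v] by (intro nn_integral_PInf_AE) auto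
    then show ?thesis by eventually_elim (simp add: less_top)
  qed
  have err: "(\<integral>\<^sup>+\<omega>. \<integral>\<^sup>+x. ennreal ((S x + (\<phi> x \<omega> - m x))\<^sup>2) \<partial>\<nu> \<partial>M) \<le> (\<integral>\<^sup>+x. ennreal ((S x)\<^sup>2) \<partial>\<nu>) + v"
  proof -
    have "(\<integral>\<^sup>+\<omega>. \<integral>\<^sup>+x. ennreal ((S x + (\<phi> x \<omega> - m x))\<^sup>2) \<partial>\<nu> \<partial>M)
      = (\<integral>\<^sup>+x. \<integral>\<^sup>+\<omega>. ennreal ((S x + (\<phi> x \<omega> - m x))\<^sup>2) \<partial>M \<partial>\<nu>)"
      by (rule pair.Fubini') measurable
    also have "\<dots> \<le> (\<integral>\<^sup>+x. ennreal ((S x)\<^sup>2) + (\<integral>\<^sup>+\<omega>. ennreal ((\<phi> x \<omega>)\<^sup>2) \<partial>M) \<partial>\<nu>)"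
    proof (rule nn_integral_mono_AE)
      have "AE x in \<nu>. x \<in> space \<nu>" by (rule AE_space)
      with AEfin show "AE x in \<nu>. (\<integral>\<^sup>+\<omega>. ennreal ((S x + (\<phi> x \<omega> - m x))\<^sup>2) \<partial>M)
          \<le> ennreal ((S x)\<^sup>2) + (\<integral>\<^sup>+\<omega>. ennreal ((\<phi> x \<omega>)\<^sup>2) \<partial>M)"
      proof eventually_elim
        case (elim x)
        then show ?case unfolding m_def
          by (intro nn_integral_square_centered_le measurable_compose[OF measurable_Pair1'[OF elim(2)] \<phi>, simplified])
      qed
    qed
    also have "\<dots> = (\<integral>\<^sup>+x. ennreal ((S x)\<^sup>2) \<partial>\<nu>) + (\<integral>\<^sup>+x. \<integral>\<^sup>+\<omega>. ennreal ((\<phi> x \<omega>)\<^sup>2) \<partial>M \<partial>\<nu>)"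
      by (rule nn_integral_add) measurable
    finally show ?thesis using v_le by (meson add_left_mono order_trans)
  qed
  \<comment> \<open>The potential as a function of the next sample. In the mean, that sample adds at
    most \<open>v\<close> to the squared error and at most \<open>s\<close> to the size, so the
    weighted sum grows by at most 2 s v.\<close>
  define \<Psi> where "\<Psi> \<omega> = s * (\<integral>\<^sup>+x. ennreal ((S x + (\<phi> x \<omega> - m x))\<^sup>2) \<partial>\<nu>) + v * ((\<Sum>i<n. sz (\<omega>s i)) + sz \<omega>)" for \<omega>
  have [measurable]: "(\<lambda>\<omega>. \<integral>\<^sup>+x. ennreal ((S x + (\<phi> x \<omega> - m x))\<^sup>2) \<partial>\<nu>) \<in> borel_measurable M"
    by measurable
  have "(\<integral>\<^sup>+\<omega>. \<Psi> \<omega> \<partial>M) = s * (\<integral>\<^sup>+\<omega>. \<integral>\<^sup>+x. ennreal ((S x + (\<phi> x \<omega> - m x))\<^sup>2) \<partial>\<nu> \<partial>M)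
      + v * ((\<Sum>i<n. sz (\<omega>s i)) + (\<integral>\<^sup>+\<omega>. sz \<omega> \<partial>M))"
    unfolding \<Psi>_def by (simp add: nn_integral_add nn_integral_cmult emeasure_space_1)
  also have "\<dots> \<le> s * ((\<integral>\<^sup>+x. ennreal ((S x)\<^sup>2) \<partial>\<nu>) + v) + v * ((\<Sum>i<n. sz (\<omega>s i)) + s)"
    using err sz_le by (intro add_mono mult_left_mono) auto
  also have "\<dots> = (s * (\<integral>\<^sup>+x. ennreal ((S x)\<^sup>2) \<partial>\<nu>) + v * (\<Sum>i<n. sz (\<omega>s i))) + 2 * (s * v)"
    by (simp add: distrib_left mult_2 mult_2_right mult.commute add.assoc add.commute add.left_commute)
  also have "\<dots> \<le> 2 * of_nat n * (s * v) + 2 * (s * v)"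
    using \<omega>s(2) unfolding S_def by (intro add_mono) auto
  also have "\<dots> = 2 * of_nat (Suc n) * (s * v)" by (simp add: distrib_left distrib_right mult.assoc add.commute)
  finally have "(\<integral>\<^sup>+\<omega>. \<Psi> \<omega> \<partial>M) \<le> 2 * of_nat (Suc n) * (s * v)" .
  moreover have "2 * of_nat (Suc n) * (s * v) < \<infinity>" using s v by (auto simp: ennreal_mult_less_top of_nat_less_top)
  moreover have "\<Psi> \<in> borel_measurable M" unfolding \<Psi>_def by measurable
  ultimately obtain \<omega> where \<omega>: "\<omega> \<in> space M" "G \<omega>" "\<Psi> \<omega> \<le> 2 * of_nat (Suc n) * (s * v)"
    using ex_le_nn_integral[OF good] by blast
  let ?w = "\<omega>s(n := \<omega>)"
  have "(\<Sum>i<Suc n. \<phi> x (?w i) - m x) = S x + (\<phi> x \<omega> - m x)" for x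
    unfolding S_def by simp
  moreover have "(\<Sum>i<Suc n. sz (?w i)) = (\<Sum>i<n. sz (\<omega>s i)) + sz \<omega>" by simp
  ultimately have "s * (\<integral>\<^sup>+x. ennreal ((\<Sum>i<Suc n. \<phi> x (?w i) - m x)\<^sup>2) \<partial>\<nu>) + v * (\<Sum>i<Suc n. sz (?w i)) = \<Psi> \<omega>"
    unfolding \<Psi>_def by (simp only:)
  then have "s * (\<integral>\<^sup>+x. ennreal ((\<Sum>i<Suc n. \<phi> x (?w i) - m x)\<^sup>2) \<partial>\<nu>) + v * (\<Sum>i<Suc n. sz (?w i)) \<le> 2 * of_nat (Suc n) * (s * v)"
    using \<omega>(3) by simp
  moreover have "\<forall>i<Suc n. ?w i \<in> space M \<and> G (?w i)" using \<omega>s(1) \<omega> by (auto simp: less_Suc_eq)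
  ultimately show ?case unfolding m_def by blast
qed

text \<open>Restricting P to \<open>A\<close> changes the law of \<open>Y\<close> only by the factor
  P(A). Stated as an equality of measures, this extends from sets to all nonnegative measurable
  \<open>h\<close>.\<close>

lemma indep_of_nn_integral:
  assumes "prob_space P" "subalgebra P G" and Y[measurable]: "Y \<in> measurable P M"
    and "indep_of P G Y M" "A \<in> sets G" and h[measurable]: "h \<in> borel_measurable M"
  shows "(\<integral>\<^sup>+\<omega>. indicator A \<omega> * h (Y \<omega>) \<partial>P) = emeasure P A * (\<integral>\<^sup>+\<omega>. h (Y \<omega>) \<partial>P)"
proof -
  interpret prob_space P by fact
  have A[measurable]: "A \<in> sets P" using assms(2,5) by (auto simp: subalgebra_def)
  have eq: "distr (density P (indicator A)) M Y = scale_measure (emeasure P A) (distr P M Y)"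
  proof (rule measure_eqI)
    fix B assume "B \<in> sets (distr (density P (indicator A)) M Y)"
    then have B[measurable]: "B \<in> sets M" by simp
    have "emeasure (distr (density P (indicator A)) M Y) B = emeasure (density P (indicator A)) (Y -` B \<inter> space P)"
      using B by (subst emeasure_distr) auto
    also have "\<dots> = emeasure P (A \<inter> (Y -` B \<inter> space P))"
      by (subst emeasure_density) (auto simp: indicator_inter_arith[symmetric] simp del: Int_iff)
    also have "\<dots> = ennreal (measure P A * measure P (Y -` B \<inter> space P))"
      using assms(4,5) B by (simp add: emeasure_eq_measure indep_of_def)
    also have "\<dots> = emeasure (scale_measure (emeasure P A) (distr P M Y)) B"
      using B by (simp add: emeasure_distr emeasure_eq_measure ennreal_mult)
    finally show "emeasure (distr (density P (indicator A)) M Y) B = emeasure (scale_measure (emeasure P A) (distr P M Y)) B" .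
  qed simp
  have "(\<integral>\<^sup>+\<omega>. indicator A \<omega> * h (Y \<omega>) \<partial>P) = (\<integral>\<^sup>+y. h y \<partial>distr (density P (indicator A)) M Y)"
    by (subst nn_integral_distr) (auto simp: nn_integral_density)
  also have "\<dots> = emeasure P A * (\<integral>\<^sup>+\<omega>. h (Y \<omega>) \<partial>P)"
    unfolding eq by (simp add: nn_integral_scale_measure nn_integral_distr)
  finally show ?thesis .
qed

section \<open>Moments\<close>

lemma vnorm_tendsto:
  assumes "\<And>i. i < D \<Longrightarrow> (\<lambda>k. y k i) \<longlonglongrightarrow> x i"
  shows "(\<lambda>k. vnorm D (y k)) \<longlonglongrightarrow> vnorm D x"
  unfolding vnorm_def L2_set_def using assms by (intro tendsto_intros) auto

definition grid_round :: "nat \<Rightarrow> nat \<Rightarrow> (nat \<Rightarrow> real) \<Rightarrow> nat \<Rightarrow> real" where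
  "grid_round D k x = restrict (\<lambda>i. of_int \<lfloor>real (Suc k) * x i\<rfloor> / real (Suc k)) {..<D}"

lemma grid_round_measurable: "grid_round D k \<in> measurable (RD D) (RD D)"
proof (rule measurable_RD_I)
  fix i assume i: "i < D"
  have "(\<lambda>z::real. of_int \<lfloor>real (Suc k) * z\<rfloor> / real (Suc k)) \<in> borel_measurable borel" by measurable
  from measurable_compose[OF measurable_coord_RD[OF i] this]
  have "(\<lambda>x. of_int \<lfloor>real (Suc k) * x i\<rfloor> / real (Suc k)) \<in> borel_measurable (RD D)" .
  then show "(\<lambda>x. grid_round D k x i) \<in> borel_measurable (RD D)"
    using i unfolding grid_round_def by simp
qed (auto simp: grid_round_def)

lemma grid_round_diff:
  assumes "i < D"
  shows "\<bar>grid_round D k x i - x i\<bar> \<le> inverse (real (Suc k))"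
proof -
  have "\<bar>of_int \<lfloor>real (Suc k) * x i\<rfloor> - real (Suc k) * x i\<bar> \<le> 1" by linarith
  then have "\<bar>of_int \<lfloor>real (Suc k) * x i\<rfloor> - real (Suc k) * x i\<bar> / real (Suc k) \<le> 1 / real (Suc k)"
    by (intro divide_right_mono) auto
  moreover have "grid_round D k x i - x i = (of_int \<lfloor>real (Suc k) * x i\<rfloor> - real (Suc k) * x i) / real (Suc k)"
    using assms by (simp add: grid_round_def field_simps del: of_nat_Suc)
  ultimately show ?thesis by (simp add: abs_divide inverse_eq_divide del: of_nat_Suc)
qed

lemma grid_round_tendsto:
  assumes "i < D"
  shows "(\<lambda>k. grid_round D k x i) \<longlonglongrightarrow> x i"
proof (rule LIM_zero_cancel, rule Lim_null_comparison[OF _ LIMSEQ_inverse_real_of_nat])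
  show "\<forall>\<^sub>F k in sequentially. norm (grid_round D k x i - x i) \<le> inverse (real (Suc k))"
    using grid_round_diff[OF assms] by simp
qed

text \<open>A crude bound by the l1 norm, uniform in \<open>k\<close>. The additive \<open>D\<close>
  is harmless because all later bounds are polynomial in the dimension.\<close>

lemma vnorm_grid_round: "vnorm D (grid_round D k x) \<le> vnorm D x + real D"
proof -
  have "inverse (real (Suc k)) \<le> 1" by (simp add: inverse_le_1_iff del: of_nat_Suc)
  then have 1: "\<bar>grid_round D k x i - x i\<bar> \<le> 1" if "i < D" for i
    using grid_round_diff[OF that, of k x] by linarith
  have "vnorm D (grid_round D k x) = L2_set (\<lambda>i. x i + (grid_round D k x i - x i)) {..<D}"
    unfolding vnorm_def by simp
  also have "\<dots> \<le> vnorm D x + L2_set (\<lambda>i. grid_round D k x i - x i) {..<D}"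
    unfolding vnorm_def by (rule L2_set_triangle_ineq)
  also have "L2_set (\<lambda>i. grid_round D k x i - x i) {..<D} \<le> (\<Sum>i<D. \<bar>grid_round D k x i - x i\<bar>)"
    by (rule L2_set_le_sum_abs)
  also have "\<dots> \<le> (\<Sum>i<D. 1)" using 1 by (intro sum_mono) auto
  finally show ?thesis by simp
qed

text \<open>Independence is only assumed for each fixed \<open>x\<close>, so \<open>Z\<close> is first rounded to a grid,
  where conditioning is elementary; continuity in \<open>x\<close> and Fatou's lemma then pass to the limit.\<close>

lemma moment_freezing:
  fixes f :: "(nat \<Rightarrow> real) \<Rightarrow> 'a \<Rightarrow> nat \<Rightarrow> real"
  assumes ps: "prob_space P" and sub: "subalgebra P G" and Z: "Z \<in> measurable G (RD D)"
    and f[measurable]: "(\<lambda>(x, \<omega>). f x \<omega>) \<in> measurable (RD D \<Otimes>\<^sub>M P) (RD D)"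
    and ind: "\<And>x. x \<in> space (RD D) \<Longrightarrow> indep_of P G (f x) (RD D)"
    and cont: "AE \<omega> in P. \<forall>y x. x \<in> space (RD D) \<longrightarrow> (\<forall>k. y k \<in> space (RD D)) \<longrightarrow>
        (\<forall>i<D. (\<lambda>k. y k i) \<longlonglongrightarrow> x i) \<longrightarrow> (\<forall>i<D. (\<lambda>k. f (y k) \<omega> i) \<longlonglongrightarrow> f x \<omega> i)"
    and mom: "\<And>x. x \<in> space (RD D) \<Longrightarrow>
        (\<integral>\<^sup>+\<omega>. ennreal (vnorm D (f x \<omega>) powr p) \<partial>P) \<le> ennreal A * ennreal ((1 + vnorm D x) powr p)"
    and p: "p > 0"
  shows "(\<integral>\<^sup>+\<omega>. ennreal (vnorm D (f (Z \<omega>) \<omega>) powr p) \<partial>P)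
    \<le> ennreal A * (\<integral>\<^sup>+\<omega>. ennreal ((1 + real D + vnorm D (Z \<omega>)) powr p) \<partial>P)"
proof -
  interpret prob_space P by fact
  have Z'[measurable]: "Z \<in> measurable P (RD D)" using measurable_from_subalg[OF sub Z] .
  have spG: "space G = space P" using sub by (simp add: subalgebra_def)
  let ?d = "grid_round D"
  define \<phi> where "\<phi> y = ennreal (vnorm D y powr p)" for y
  have [measurable]: "\<phi> \<in> borel_measurable (RD D)" unfolding \<phi>_def by measurable
  have [measurable]: "grid_round D k \<in> measurable (RD D) (RD D)" for k by (rule grid_round_measurable)
  have fx[measurable]: "f x \<in> measurable P (RD D)" if "x \<in> space (RD D)" for x
    using measurable_compose[OF measurable_Pair1'[OF that] f] by simp
  have dsp: "?d k x \<in> space (RD D)" for k x by (simp add: space_RD grid_round_def)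
  have step: "(\<integral>\<^sup>+\<omega>. \<phi> (f (?d k (Z \<omega>)) \<omega>) \<partial>P)
      \<le> ennreal A * (\<integral>\<^sup>+\<omega>. ennreal ((1 + real D + vnorm D (Z \<omega>)) powr p) \<partial>P)" for k
  proof -
    define R where "R = (\<Pi>\<^sub>E i\<in>{..<D}. range (\<lambda>z::int. of_int z / real (Suc k)))"
    have R: "countable R" unfolding R_def by (intro countable_PiE) auto
    have dR: "?d k x \<in> R" for x unfolding R_def grid_round_def by auto
    have Rsp: "y \<in> space (RD D)" if "y \<in> R" for y using that by (auto simp: R_def space_RD PiE_def)
    define E where "E y = (\<lambda>\<omega>. ?d k (Z \<omega>)) -` {y} \<inter> space P" for y
    have singl: "{y} \<in> sets (RD D)" if "y \<in> R" for y
    proof -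
      have "{y} = (\<Pi>\<^sub>E i\<in>{..<D}. {y i})" using Rsp[OF that] by (auto simp: space_RD PiE_singleton)
      also have "\<dots> \<in> sets (RD D)" unfolding RD_def by (intro sets_PiM_I_finite) auto
      finally show ?thesis .
    qed
    have E_G: "E y \<in> sets G" if "y \<in> R" for y
      unfolding E_def spG[symmetric]
      using measurable_compose[OF Z grid_round_measurable, of k] singl[OF that] by (rule measurable_sets)
    have E_P[measurable]: "E y \<in> sets P" if "y \<in> R" for y using E_G[OF that] sub by (auto simp: subalgebra_def)
    \<comment> \<open>The rounded point ranges over the countable set \<open>R\<close>. Summing over
      \<open>R\<close> leaves only fixed points \<open>y\<close> as arguments of \<open>f\<close>,
      where independence from \<open>G\<close> applies to the event \<open>E y\<close>; the same
      expansion read backwards reassembles the bound.\<close>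
    have expand: "h (?d k (Z \<omega>)) = (\<integral>\<^sup>+y. indicator (E y) \<omega> * h y \<partial>count_space R)"
      if "\<omega> \<in> space P" for \<omega> and h :: "(nat \<Rightarrow> real) \<Rightarrow> ennreal"
    proof -
      have "(\<integral>\<^sup>+y. indicator (E y) \<omega> * h y \<partial>count_space R) = (\<integral>\<^sup>+y. h y * indicator {?d k (Z \<omega>)} y \<partial>count_space R)"
        using that by (intro nn_integral_cong) (auto simp: E_def split: split_indicator)
      also have "\<dots> = h (?d k (Z \<omega>))" using dR by (subst nn_integral_indicator_singleton) auto
      finally show ?thesis ..
    qed
    have "(\<integral>\<^sup>+\<omega>. \<phi> (f (?d k (Z \<omega>)) \<omega>) \<partial>P) = (\<integral>\<^sup>+\<omega>. \<integral>\<^sup>+y. indicator (E y) \<omega> * \<phi> (f y \<omega>) \<partial>count_space R \<partial>P)"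
      using expand[of _ "\<lambda>y. \<phi> (f y _)"] by (intro nn_integral_cong) auto
    also have "\<dots> = (\<integral>\<^sup>+y. \<integral>\<^sup>+\<omega>. indicator (E y) \<omega> * \<phi> (f y \<omega>) \<partial>P \<partial>count_space R)"
    proof (rule nn_integral_count_space_nn_integral[OF R])
      fix y assume y: "y \<in> R"
      note [measurable] = E_P[OF y] fx[OF Rsp[OF y]]
      show "(\<lambda>\<omega>. indicator (E y) \<omega> * \<phi> (f y \<omega>)) \<in> borel_measurable P" by measurable
    qed
    also have "\<dots> = (\<integral>\<^sup>+y. emeasure P (E y) * (\<integral>\<^sup>+\<omega>. \<phi> (f y \<omega>) \<partial>P) \<partial>count_space R)"
      by (intro nn_integral_cong indep_of_nn_integral[where h = \<phi>, OF ps sub, where M = "RD D"] fx ind E_G Rsp) auto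
    also have "\<dots> \<le> (\<integral>\<^sup>+y. emeasure P (E y) * (ennreal A * ennreal ((1 + vnorm D y) powr p)) \<partial>count_space R)"
      unfolding \<phi>_def using mom[OF Rsp] by (intro nn_integral_mono mult_left_mono) auto
    also have "\<dots> = (\<integral>\<^sup>+y. \<integral>\<^sup>+\<omega>. indicator (E y) \<omega> * (ennreal A * ennreal ((1 + vnorm D y) powr p)) \<partial>P \<partial>count_space R)"
      by (intro nn_integral_cong) (simp add: nn_integral_multc E_P)
    also have "\<dots> = (\<integral>\<^sup>+\<omega>. \<integral>\<^sup>+y. indicator (E y) \<omega> * (ennreal A * ennreal ((1 + vnorm D y) powr p)) \<partial>count_space R \<partial>P)"
    proof (rule nn_integral_count_space_nn_integral[OF R, symmetric])
      fix y assume y: "y \<in> R"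
      note [measurable] = E_P[OF y]
      show "(\<lambda>\<omega>. indicator (E y) \<omega> * (ennreal A * ennreal ((1 + vnorm D y) powr p))) \<in> borel_measurable P" by measurable
    qed
    also have "\<dots> = (\<integral>\<^sup>+\<omega>. ennreal A * ennreal ((1 + vnorm D (?d k (Z \<omega>))) powr p) \<partial>P)"
      using expand[symmetric] by (intro nn_integral_cong) auto
    also have "\<dots> \<le> (\<integral>\<^sup>+\<omega>. ennreal A * ennreal ((1 + real D + vnorm D (Z \<omega>)) powr p) \<partial>P)"
    proof (intro nn_integral_mono mult_left_mono ennreal_leI powr_mono2)
      show "1 + vnorm D (?d k (Z \<omega>)) \<le> 1 + real D + vnorm D (Z \<omega>)" for \<omega>
        using vnorm_grid_round[of D k "Z \<omega>"] by simp
    qed (use p in auto)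
    also have "\<dots> = ennreal A * (\<integral>\<^sup>+\<omega>. ennreal ((1 + real D + vnorm D (Z \<omega>)) powr p) \<partial>P)"
      by (rule nn_integral_cmult) measurable
    finally show ?thesis .
  qed
  have "(\<integral>\<^sup>+\<omega>. \<phi> (f (Z \<omega>) \<omega>) \<partial>P) \<le> (\<integral>\<^sup>+\<omega>. liminf (\<lambda>k. \<phi> (f (?d k (Z \<omega>)) \<omega>)) \<partial>P)"
  proof (rule nn_integral_mono_AE)
    show "AE \<omega> in P. \<phi> (f (Z \<omega>) \<omega>) \<le> liminf (\<lambda>k. \<phi> (f (?d k (Z \<omega>)) \<omega>))"
      using cont AE_space
    proof eventually_elim
      case (elim \<omega>)
      have "Z \<omega> \<in> space (RD D)" using measurable_space[OF Z'] elim(2) by auto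
      then have "\<forall>i<D. (\<lambda>k. f (?d k (Z \<omega>)) \<omega> i) \<longlonglongrightarrow> f (Z \<omega>) \<omega> i"
        using elim(1)[rule_format, of "Z \<omega>" "\<lambda>k. ?d k (Z \<omega>)"] dsp grid_round_tendsto by auto
      then have "(\<lambda>k. vnorm D (f (?d k (Z \<omega>)) \<omega>)) \<longlonglongrightarrow> vnorm D (f (Z \<omega>) \<omega>)"
        by (intro vnorm_tendsto) auto
      then have "(\<lambda>k. vnorm D (f (?d k (Z \<omega>)) \<omega>) powr p) \<longlonglongrightarrow> vnorm D (f (Z \<omega>) \<omega>) powr p"
        using p by (intro tendsto_powr2) auto
      then have "(\<lambda>k. \<phi> (f (?d k (Z \<omega>)) \<omega>)) \<longlonglongrightarrow> \<phi> (f (Z \<omega>) \<omega>)"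
        unfolding \<phi>_def by (rule tendsto_ennrealI)
      then show ?case by (simp add: lim_imp_Liminf)
    qed
  qed
  also have "\<dots> \<le> liminf (\<lambda>k. \<integral>\<^sup>+\<omega>. \<phi> (f (?d k (Z \<omega>)) \<omega>) \<partial>P)"
    by (rule nn_integral_liminf) measurable
  also have "\<dots> \<le> ennreal A * (\<integral>\<^sup>+\<omega>. ennreal ((1 + real D + vnorm D (Z \<omega>)) powr p) \<partial>P)"
    using step by (intro Liminf_le) auto
  finally show ?thesis unfolding \<phi>_def .
qed

section \<open>Gaussian increments and the second moment of rho\<close>

text \<open>Jensen's inequality for t^m at the uniform average, with the denominators cleared. For
  even \<open>m\<close> the power is convex on the whole line, so no sign condition on
  \<open>a\<close> arises.\<close>

lemma power_mean_sum:
  fixes a :: "'i \<Rightarrow> real"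
  assumes "finite I" "I \<noteq> {}" "even m"
  shows "real (card I) * (\<Sum>i\<in>I. a i) ^ m \<le> real (card I) ^ m * (\<Sum>i\<in>I. a i ^ m)"
proof -
  let ?n = "real (card I)"
  have n: "?n > 0" using assms by (simp add: card_gt_0_iff)
  have "(\<Sum>i\<in>I. (1 / ?n) *\<^sub>R a i) ^ m \<le> (\<Sum>i\<in>I. (1 / ?n) * a i ^ m)"
    using assms n by (intro convex_on_sum[OF _ _ convex_power_even[OF assms(3)]]) auto
  then have "(\<Sum>i\<in>I. a i) ^ m / ?n ^ m \<le> (\<Sum>i\<in>I. a i ^ m) / ?n"
    by (simp add: sum_divide_distrib[symmetric] power_divide)
  then show ?thesis using n by (simp add: field_simps)
qed

text \<open>Young's inequality with the conjugate exponents p/2 and p/(p-2), obtained without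
  constants by comparing Q with a^(p-2). Below it, Q a^2 is at most a^p; above it, a^2 is at most
  Q^(2/(p-2)) and Q \<ge> 1, so the exponent p/(p-2) may be rounded up to the natural number
  \<open>m\<close>, for which Gaussian moments are explicit.\<close>

lemma weighted_square_le:
  fixes a Q p :: real
  assumes "a \<ge> 1" "Q \<ge> 0" "p > 2" "real m \<ge> p / (p - 2)"
  shows "Q * a\<^sup>2 \<le> a powr p + 1 + Q ^ m"
proof (cases "Q \<le> a powr (p - 2)")
  case True
  then have "Q * a\<^sup>2 \<le> a powr (p - 2) * a powr 2"
    using assms by (intro mult_mono) auto
  also have "\<dots> = a powr p" by (simp add: powr_add[symmetric])
  finally show ?thesis using assms by (simp add: add_increasing2)
next
  case False
  then have lt: "a powr (p - 2) < Q" by simp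
  have Q1: "Q \<ge> 1" using lt assms ge_one_powr_ge_zero[of a "p - 2"] by auto
  have "a\<^sup>2 = (a powr (p - 2)) powr (2 / (p - 2))"
  proof -
    have "p - 2 \<noteq> 0" using assms by simp
    then have "(p - 2) * (2 / (p - 2)) = 2" by (metis nonzero_mult_div_cancel_left times_divide_eq_right)
    then show ?thesis unfolding powr_powr using assms by (simp only:) simp
  qed
  also have "\<dots> \<le> Q powr (2 / (p - 2))" using lt assms by (intro powr_mono2) auto
  finally have "Q * a\<^sup>2 \<le> Q powr 1 * Q powr (2 / (p - 2))"
    using Q1 by (intro mult_mono) auto
  also have "\<dots> = Q powr (p / (p - 2))"
  proof -
    have "1 + 2 / (p - 2) = p / (p - 2)" using assms by (simp add: field_simps)
    then show ?thesis unfolding powr_add[symmetric] by simp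
  qed
  also have "\<dots> \<le> Q powr real m" using Q1 assms by (intro powr_mono) auto
  also have "\<dots> = Q ^ m" using Q1 by (simp add: powr_realpow)
  finally show ?thesis using powr_ge_zero[of a p] by linarith
qed

text \<open>The factor fact (2m) / (2^m fact m) is the double factorial (2m-1)!!, the moment of
  order 2m of a standard normal variable.\<close>

lemma BM_increment_moment:
  assumes ps: "prob_space P" and fil: "is_filtration P T F" and BM: "is_BM P T F D W"
    and st: "0 \<le> s" "s < t" "t \<le> T" and i: "i < D"
  shows "(\<integral>\<^sup>+\<omega>. ennreal ((vdiff D (W t \<omega>) (W s \<omega>) i) ^ (2 * m)) \<partial>P)
      = ennreal (fact (2 * m) / (2 ^ m * fact m) * (t - s) ^ m)"
    and "(\<lambda>\<omega>. vdiff D (W t \<omega>) (W s \<omega>)) \<in> measurable P (RD D)"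
proof -
  let ?N = "density lborel (normal_density 0 (sqrt (t - s)))"
  let ?V = "\<lambda>\<omega>. vdiff D (W t \<omega>) (W s \<omega>)"
  have W: "W r \<in> measurable P (RD D)" if "r \<in> {0..T}" for r
  proof -
    have "subalgebra P (F r)" "W r \<in> measurable (F r) (RD D)"
      using that fil BM by (auto simp: is_filtration_def is_BM_def)
    then show ?thesis by (rule measurable_from_subalg)
  qed
  have Wi: "(\<lambda>\<omega>. W r \<omega> j) \<in> borel_measurable P" if "r \<in> {0..T}" "j < D" for r j
    using measurable_compose[OF W[OF that(1)] measurable_coord_RD[OF that(2)]] .
  show V: "?V \<in> measurable P (RD D)"
    using st by (intro measurable_RD_I) (auto simp: vdiff_def intro!: borel_measurable_diff Wi)
  have distr: "distr P (RD D) ?V = PiM {..<D} (\<lambda>_. ?N)" using BM st by (auto simp: is_BM_def)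
  have pN: "prob_space ?N" using st by (intro prob_space_normal_density) simp
  have hb: "has_bochner_integral lborel (\<lambda>z. normal_density 0 (sqrt (t - s)) z * z ^ (2 * m))
      (fact (2 * m) / ((2 / (sqrt (t - s))\<^sup>2) ^ m * fact m))"
    using normal_moment_even[of "sqrt (t - s)" 0 m] st unfolding diff_0_right by simp
  have "(\<integral>\<^sup>+\<omega>. ennreal ((?V \<omega> i) ^ (2 * m)) \<partial>P) = (\<integral>\<^sup>+y. ennreal (y i ^ (2 * m)) \<partial>distr P (RD D) ?V)"
    using measurable_coord_RD[OF i] V by (subst nn_integral_distr) auto
  also have "\<dots> = (\<integral>\<^sup>+z. ennreal (z ^ (2 * m)) \<partial>distr (PiM {..<D} (\<lambda>_. ?N)) ?N (\<lambda>y. y i))"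
    unfolding distr using i by (subst nn_integral_distr) auto
  also have "\<dots> = (\<integral>\<^sup>+z. ennreal (z ^ (2 * m)) \<partial>?N)"
    using i pN by (subst distr_PiM_component) auto
  also have "\<dots> = (\<integral>\<^sup>+z. ennreal (normal_density 0 (sqrt (t - s)) z * z ^ (2 * m)) \<partial>lborel)"
    by (subst nn_integral_density) (auto simp: ennreal_mult')
  also have "\<dots> = ennreal (fact (2 * m) / ((2 / (sqrt (t - s))\<^sup>2) ^ m * fact m))"
    using hb by (subst nn_integral_eq_integral) (auto simp only: has_bochner_integral_iff intro!: AE_I2 mult_nonneg_nonneg zero_le_even_power normal_density_nonneg even_mult_iff[THEN iffD2] disjI1 even_numeral)
  also have "fact (2 * m) / ((2 / (sqrt (t - s))\<^sup>2) ^ m * fact m) = fact (2 * m) / (2 ^ m * fact m) * (t - s) ^ m"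
    using st by (simp add: power_divide)
  finally show "(\<integral>\<^sup>+\<omega>. ennreal ((?V \<omega> i) ^ (2 * m)) \<partial>P)
      = ennreal (fact (2 * m) / (2 ^ m * fact m) * (t - s) ^ m)" .
qed

text \<open>The discrete quadratic variation of \<open>W\<close> between the dates n and n + 1 on
  \<open>N0\<close> substeps, that is, the random weight inside \<open>rho_tilde\<close>.\<close>

definition sq_var :: "real \<Rightarrow> nat \<Rightarrow> nat \<Rightarrow> (real \<Rightarrow> 'a \<Rightarrow> nat \<Rightarrow> real) \<Rightarrow> nat \<Rightarrow> nat \<Rightarrow> 'a \<Rightarrow> real" where
  "sq_var T N D W N0 n \<omega> = (let dt = T / real (N * N0); tk = (\<lambda>k. tgrid T N n + real k * dt) in
     \<Sum>k<N0. (vnorm D (vdiff D (W (tk (Suc k)) \<omega>) (W (tk k) \<omega>)))\<^sup>2)"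

lemma sq_var_nonneg: "0 \<le> sq_var T N D W N0 n \<omega>"
  by (auto simp: sq_var_def Let_def intro: sum_nonneg)

text \<open>The power mean inequality turns the m-th power of a sum of N0 D squares into (N0
  D)^(m-1) times the sum of their m-th powers, each with mean c dt^m. The total is c (N0 D dt)^m,
  and N0 D dt = D T / N no longer contains N0.\<close>

lemma sq_var_moment:
  assumes ps: "prob_space P" and fil: "is_filtration P T F" and BM: "is_BM P T F D W"
    and T: "T > 0" and n: "n < N" and N0: "N0 \<ge> 1" and D: "D \<ge> 1" and m: "even m"
  shows "sq_var T N D W N0 n \<in> borel_measurable P"
    and "(\<integral>\<^sup>+\<omega>. ennreal (sq_var T N D W N0 n \<omega> ^ m) \<partial>P)
      \<le> ennreal (fact (2 * m) / (2 ^ m * fact m) * (real D * T / real N) ^ m)"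
proof -
  let ?Q = "sq_var T N D W N0 n"
  define dt where "dt = T / real (N * N0)"
  define tk where "tk k = tgrid T N n + real k * dt" for k
  define I where "I = {..<N0} \<times> {..<D}"
  define \<Delta> where "\<Delta> ki \<omega> = vdiff D (W (tk (Suc (fst ki))) \<omega>) (W (tk (fst ki)) \<omega>) (snd ki)" for ki \<omega>
  define c where "c = (fact (2 * m) / (2 ^ m * fact m) :: real)"
  have N: "N \<ge> 1" using n by simp
  have dt: "dt > 0" using T N N0 by (simp add: dt_def)
  have I: "finite I" "I \<noteq> {}" "real (card I) = real N0 * real D"
    using N0 D by (auto simp: I_def card_cartesian_product lessThan_empty_iff)
  have Q: "?Q \<omega> = (\<Sum>ki\<in>I. (\<Delta> ki \<omega>)\<^sup>2)" for \<omega>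
  proof -
    have "(vnorm D v)\<^sup>2 = (\<Sum>i<D. (v i)\<^sup>2)" for v
      unfolding vnorm_def L2_set_def by (intro real_sqrt_pow2 sum_nonneg) auto
    then show ?thesis
      unfolding sq_var_def Let_def dt_def[symmetric] tk_def[symmetric]
      by (simp add: I_def \<Delta>_def sum.cartesian_product case_prod_unfold)
  qed
  have tk: "0 \<le> tk k" "tk k < tk (Suc k)" "tk (Suc k) \<le> T" if "k < N0" for k
  proof -
    show "0 \<le> tk k" using T dt by (simp add: tk_def tgrid_def)
    show "tk k < tk (Suc k)" using dt by (simp add: tk_def)
    have "real (Suc k) * dt \<le> real N0 * dt" using that dt by (intro mult_right_mono) auto
    also have "\<dots> = T / real N" using N0 by (simp add: dt_def)
    finally have "tk (Suc k) \<le> (real n + 1) * T / real N" unfolding tk_def tgrid_def by (simp add: add_divide_distrib distrib_right)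
    also have "\<dots> \<le> real N * T / real N" using n T by (intro divide_right_mono mult_right_mono) auto
    finally show "tk (Suc k) \<le> T" using N by simp
  qed
  have \<Delta>[measurable]: "\<Delta> ki \<in> borel_measurable P" if "ki \<in> I" for ki
    using measurable_compose[OF BM_increment_moment(2)[OF ps fil BM] measurable_coord_RD[of "snd ki" D]] tk[of "fst ki"] that
    unfolding \<Delta>_def I_def by fastforce
  have mom: "(\<integral>\<^sup>+\<omega>. ennreal (((\<Delta> ki \<omega>)\<^sup>2) ^ m) \<partial>P) = ennreal (c * dt ^ m)" if "ki \<in> I" for ki
  proof -
    have eq: "tk (Suc (fst ki)) - tk (fst ki) = dt" by (simp add: tk_def algebra_simps)
    have k: "fst ki < N0" "snd ki < D" using that by (auto simp: I_def)
    show ?thesis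
      using BM_increment_moment(1)[OF ps fil BM tk[OF k(1)] k(2), of m]
      unfolding \<Delta>_def eq c_def by (simp only: power_mult)
  qed
  show meas: "?Q \<in> borel_measurable P"
    unfolding Q[abs_def] by (intro borel_measurable_sum borel_measurable_power \<Delta>)
  let ?n = "real N0 * real D"
  have n0: "?n > 0" using N0 D by simp
  have "?Q \<omega> ^ m \<le> (\<Sum>ki\<in>I. ?n ^ m / ?n * ((\<Delta> ki \<omega>)\<^sup>2) ^ m)" for \<omega>
  proof -
    have "?n * ?Q \<omega> ^ m \<le> ?n ^ m * (\<Sum>ki\<in>I. ((\<Delta> ki \<omega>)\<^sup>2) ^ m)"
      using power_mean_sum[OF I(1,2) m, of "\<lambda>ki. (\<Delta> ki \<omega>)\<^sup>2"] unfolding Q I(3) .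
    then have "?Q \<omega> ^ m \<le> ?n ^ m / ?n * (\<Sum>ki\<in>I. ((\<Delta> ki \<omega>)\<^sup>2) ^ m)" using n0
      by (simp add: pos_le_divide_eq mult.commute)
    then show ?thesis by (simp add: sum_distrib_left)
  qed
  then have "(\<integral>\<^sup>+\<omega>. ennreal (?Q \<omega> ^ m) \<partial>P) \<le> (\<integral>\<^sup>+\<omega>. (\<Sum>ki\<in>I. ennreal (?n ^ m / ?n) * ennreal (((\<Delta> ki \<omega>)\<^sup>2) ^ m)) \<partial>P)"
    by (intro nn_integral_mono) (simp add: ennreal_mult[symmetric] sum_ennreal ennreal_leI)
  also have "\<dots> = (\<Sum>ki\<in>I. ennreal (?n ^ m / ?n) * (\<integral>\<^sup>+\<omega>. ennreal (((\<Delta> ki \<omega>)\<^sup>2) ^ m) \<partial>P))"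
  proof (subst nn_integral_sum)
    fix ki assume ki: "ki \<in> I"
    note [measurable] = \<Delta>[OF ki]
    show "(\<lambda>\<omega>. ennreal (?n ^ m / ?n) * ennreal (((\<Delta> ki \<omega>)\<^sup>2) ^ m)) \<in> borel_measurable P" by measurable
  next
    show "(\<Sum>ki\<in>I. \<integral>\<^sup>+\<omega>. ennreal (?n ^ m / ?n) * ennreal (((\<Delta> ki \<omega>)\<^sup>2) ^ m) \<partial>P)
      = (\<Sum>ki\<in>I. ennreal (?n ^ m / ?n) * (\<integral>\<^sup>+\<omega>. ennreal (((\<Delta> ki \<omega>)\<^sup>2) ^ m) \<partial>P))"
      by (intro sum.cong refl nn_integral_cmult measurable_compose[OF _ measurable_ennreal] borel_measurable_power \<Delta>)
  qed
  also have "\<dots> = (\<Sum>ki\<in>I. ennreal (?n ^ m / ?n * (c * dt ^ m)))"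
    by (intro sum.cong refl) (simp add: mom ennreal_mult'[symmetric])
  also have "\<dots> = ennreal (real (card I) * (?n ^ m / ?n * (c * dt ^ m)))"
    using dt by (subst sum_ennreal) (auto simp: c_def)
  also have "real (card I) * (?n ^ m / ?n * (c * dt ^ m)) = c * (?n * dt) ^ m"
    using N0 D unfolding I(3) by (simp add: power_mult_distrib)
  also have "?n * dt = real D * T / real N" using N0 by (simp add: dt_def)
  finally show "(\<integral>\<^sup>+\<omega>. ennreal (?Q \<omega> ^ m) \<partial>P) \<le> ennreal (fact (2 * m) / (2 ^ m * fact m) * (real D * T / real N) ^ m)"
    unfolding c_def .
qed

text \<open>\<open>measure_of\<close> keeps a set function only if it is countably additive.
  Recognising the set function as that of a weighted image measure settles this and makes integrals
  with respect to \<open>rho_tilde\<close> computable.\<close>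

lemma rho_tilde_eq_distr:
  assumes Q: "sq_var T N D W N0 n \<in> borel_measurable P"
    and X: "X (tgrid T N (Suc n)) \<in> measurable P (RD D)"
  shows "rho_tilde P T N D W X N0 n =
    distr (density P (\<lambda>\<omega>. ennreal (sq_var T N D W N0 n \<omega>))) (RD D) (X (tgrid T N (Suc n)))"
    (is "_ = ?R")
proof -
  let ?X = "X (tgrid T N (Suc n))"
  let ?\<mu> = "\<lambda>A. \<integral>\<^sup>+\<omega>. ennreal (sq_var T N D W N0 n \<omega> * indicator A (?X \<omega>)) \<partial>P"
  have "rho_tilde P T N D W X N0 n = measure_of (space (RD D)) (sets (RD D)) ?\<mu>"
    unfolding rho_tilde_def sq_var_def by (simp add: Let_def)
  also have "\<dots> = measure_of (space (RD D)) (sets (RD D)) (emeasure ?R)"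
  proof (rule measure_of_eq)
    show "sets (RD D) \<subseteq> Pow (space (RD D))" by (rule sets.space_closed)
  next
    fix A assume "A \<in> sigma_sets (space (RD D)) (sets (RD D))"
    then have A[measurable]: "A \<in> sets (RD D)" by (simp add: sets.sigma_sets_eq)
    note [measurable] = Q X
    have "emeasure ?R A = (\<integral>\<^sup>+\<omega>. ennreal (sq_var T N D W N0 n \<omega>) * indicator (?X -` A \<inter> space P) \<omega> \<partial>P)"
      by (subst emeasure_distr, simp, simp, subst emeasure_density) (auto intro!: measurable_sets[OF X])
    also have "\<dots> = ?\<mu> A"
      by (intro nn_integral_cong) (auto split: split_indicator)
    finally show "?\<mu> A = emeasure ?R A" ..
  qed
  also have "\<dots> = ?R"
    using measure_of_of_measure[of ?R] by simp
  finally show ?thesis .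
qed

lemma rho_tilde_moment:
  assumes ps: "prob_space P" and fil: "is_filtration P T F" and BM: "is_BM P T F D W"
    and T: "T > 0" and n: "n < N" and N0: "N0 \<ge> 1" and D: "D \<ge> 1"
    and X: "X (tgrid T N (Suc n)) \<in> measurable P (RD D)"
    and p: "p > 2" and m: "even m" "real m \<ge> p / (p - 2)"
  shows "(\<integral>\<^sup>+z. ennreal ((1 + vnorm D z)\<^sup>2) \<partial>rho_tilde P T N D W X N0 n)
    \<le> (\<integral>\<^sup>+\<omega>. ennreal ((1 + vnorm D (X (tgrid T N (Suc n)) \<omega>)) powr p) \<partial>P) + 1
       + ennreal (fact (2 * m) / (2 ^ m * fact m) * (real D * T / real N) ^ m)"
proof -
  interpret prob_space P by fact
  let ?Q = "sq_var T N D W N0 n" and ?X = "X (tgrid T N (Suc n))"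
  note Qm = sq_var_moment[OF ps fil BM T n N0 D m(1)]
  note [measurable] = Qm(1) X
  have "(\<integral>\<^sup>+z. ennreal ((1 + vnorm D z)\<^sup>2) \<partial>rho_tilde P T N D W X N0 n)
      = (\<integral>\<^sup>+\<omega>. ennreal (?Q \<omega>) * ennreal ((1 + vnorm D (?X \<omega>))\<^sup>2) \<partial>P)"
    unfolding rho_tilde_eq_distr[of T N D W N0 n P X, OF Qm(1) X]
    by (subst nn_integral_distr, simp, simp, subst nn_integral_density) auto
  also have "\<dots> \<le> (\<integral>\<^sup>+\<omega>. ennreal ((1 + vnorm D (?X \<omega>)) powr p) + 1 + ennreal (?Q \<omega> ^ m) \<partial>P)"
  proof (rule nn_integral_mono)
    fix \<omega>
    have "ennreal (?Q \<omega>) * ennreal ((1 + vnorm D (?X \<omega>))\<^sup>2) = ennreal (?Q \<omega> * (1 + vnorm D (?X \<omega>))\<^sup>2)"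
      by (rule ennreal_mult'[symmetric]) (rule sq_var_nonneg)
    also have "\<dots> \<le> ennreal ((1 + vnorm D (?X \<omega>)) powr p + 1 + ?Q \<omega> ^ m)"
      using p m by (intro ennreal_leI weighted_square_le) (auto simp: sq_var_nonneg)
    also have "\<dots> = ennreal ((1 + vnorm D (?X \<omega>)) powr p) + 1 + ennreal (?Q \<omega> ^ m)"
      by (simp add: sq_var_nonneg)
    finally show "ennreal (?Q \<omega>) * ennreal ((1 + vnorm D (?X \<omega>))\<^sup>2)
      \<le> ennreal ((1 + vnorm D (?X \<omega>)) powr p) + 1 + ennreal (?Q \<omega> ^ m)" .
  qed
  also have "\<dots> = (\<integral>\<^sup>+\<omega>. ennreal ((1 + vnorm D (?X \<omega>)) powr p) \<partial>P) + 1 + (\<integral>\<^sup>+\<omega>. ennreal (?Q \<omega> ^ m) \<partial>P)"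
    by (simp add: nn_integral_add emeasure_space_1)
  also have "\<dots> \<le> (\<integral>\<^sup>+\<omega>. ennreal ((1 + vnorm D (?X \<omega>)) powr p) \<partial>P) + 1
       + ennreal (fact (2 * m) / (2 ^ m * fact m) * (real D * T / real N) ^ m)"
    by (intro add_left_mono Qm(2))
  finally show ?thesis .
qed

section \<open>Value functions\<close>

text \<open>The size is a sum of countably many measurable indicators, one for each parameter
  index.\<close>

lemma rnn_size_measurable:
  assumes "\<And>i m j. (\<lambda>\<omega>. u \<omega> i m j) \<in> borel_measurable P"
  shows "(\<lambda>\<omega>. rnn_size (u \<omega>)) \<in> borel_measurable P"
proof -
  let ?h = "\<lambda>\<omega> (i, m, j). if u \<omega> i m j \<noteq> 0 then 1 else (0::ennreal)"
  have eq: "rnn_size (u \<omega>) = (\<integral>\<^sup>+z. ?h \<omega> z \<partial>count_space UNIV)" for \<omega>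
  proof -
    have "rnn_size (u \<omega>) = (\<integral>\<^sup>+z. indicator {(i,m,j). u \<omega> i m j \<noteq> 0} z \<partial>count_space UNIV)"
      unfolding rnn_size_def by simp
    also have "\<dots> = (\<integral>\<^sup>+z. ?h \<omega> z \<partial>count_space UNIV)"
      by (intro nn_integral_cong) (auto split: split_indicator)
    finally show ?thesis .
  qed
  interpret cs: sigma_finite_measure "count_space (UNIV :: (nat \<times> nat \<times> nat) set)"
    by (rule sigma_finite_measure_count_space_countable) auto
  have "(\<lambda>(z, \<omega>). ?h \<omega> z) \<in> borel_measurable (count_space UNIV \<Otimes>\<^sub>M P)"
  proof (rule measurable_pair_measure_countable1)
    fix z :: "nat \<times> nat \<times> nat"
    obtain i m j where z: "z = (i, m, j)" by (cases z)
    note [measurable] = assms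
    show "(\<lambda>\<omega>. case (z, \<omega>) of (z, \<omega>) \<Rightarrow> ?h \<omega> z) \<in> borel_measurable P"
      unfolding z by simp
  qed auto
  then have "(\<lambda>x. case (case x of (x, y) \<Rightarrow> (y, x)) of (z, \<omega>) \<Rightarrow> ?h \<omega> z) \<in> borel_measurable (P \<Otimes>\<^sub>M count_space UNIV)"
    by (rule measurable_compose[OF measurable_pair_swap'])
  then have "case_prod ?h \<in> borel_measurable (P \<Otimes>\<^sub>M count_space UNIV)"
    by (simp add: case_prod_unfold)
  then show ?thesis unfolding eq by (rule cs.borel_measurable_nn_integral)
qed

lemma rnn_size_finite_nat:
  assumes "rnn_size u < \<infinity>"
  shows "\<exists>k::nat. rnn_size u = of_nat k"
proof -
  have "finite {(i,m,j). u i m j \<noteq> 0}"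
    using assms unfolding rnn_size_def by (cases "finite {(i,m,j). u i m j \<noteq> 0}") auto
  then show ?thesis unfolding rnn_size_def by auto
qed

lemma nn_integral_transition:
  assumes ps: "prob_space P"
    and f: "(\<lambda>(x, \<omega>). f x \<omega>) \<in> measurable (RD D \<Otimes>\<^sub>M P) (RD D)"
    and \<nu>[measurable_cong]: "sets \<nu> = sets (RD D)" and q[measurable]: "q \<in> borel_measurable (RD D)"
  shows "(\<integral>\<^sup>+z. q z \<partial>distr (\<nu> \<Otimes>\<^sub>M P) (RD D) (\<lambda>(x, \<omega>). f x \<omega>)) = (\<integral>\<^sup>+x. \<integral>\<^sup>+\<omega>. q (f x \<omega>) \<partial>P \<partial>\<nu>)"
proof -
  interpret prob_space P by fact
  have [measurable]: "(\<lambda>(x, \<omega>). f x \<omega>) \<in> measurable (\<nu> \<Otimes>\<^sub>M P) (RD D)"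
    using f by (subst measurable_cong_sets[OF sets_pair_measure_cong[OF \<nu> refl] refl])
  have "(\<integral>\<^sup>+z. q z \<partial>distr (\<nu> \<Otimes>\<^sub>M P) (RD D) (\<lambda>(x, \<omega>). f x \<omega>)) = (\<integral>\<^sup>+y. q (case y of (x, \<omega>) \<Rightarrow> f x \<omega>) \<partial>(\<nu> \<Otimes>\<^sub>M P))"
    by (rule nn_integral_distr) measurable
  also have "\<dots> = (\<integral>\<^sup>+x. \<integral>\<^sup>+\<omega>. q (case (x, \<omega>) of (x, \<omega>) \<Rightarrow> f x \<omega>) \<partial>P \<partial>\<nu>)"
    by (rule nn_integral_fst[symmetric]) measurable
  finally show ?thesis by simp
qed

lemma transition_moment:
  assumes ps: "prob_space P"
    and f: "(\<lambda>(x, \<omega>). f x \<omega>) \<in> measurable (RD D \<Otimes>\<^sub>M P) (RD D)"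
    and mom: "\<And>x. x \<in> space (RD D) \<Longrightarrow>
      (\<integral>\<^sup>+\<omega>. ennreal ((1 + vnorm D (f x \<omega>))\<^sup>2) \<partial>P) \<le> ennreal A * ennreal ((1 + vnorm D x)\<^sup>2)"
    and \<nu>[measurable_cong]: "sets \<nu> = sets (RD D)" and \<nu>_mom: "(\<integral>\<^sup>+x. ennreal ((1 + vnorm D x)\<^sup>2) \<partial>\<nu>) \<le> ennreal \<kappa>"
    and A: "A \<ge> 0"
  shows "(\<integral>\<^sup>+z. ennreal ((1 + vnorm D z)\<^sup>2) \<partial>distr (\<nu> \<Otimes>\<^sub>M P) (RD D) (\<lambda>(x, \<omega>). f x \<omega>)) \<le> ennreal (A * \<kappa>)"
proof -
  have sp: "space \<nu> = space (RD D)" using \<nu> by (rule sets_eq_imp_space_eq)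
  have "(\<integral>\<^sup>+x. \<integral>\<^sup>+\<omega>. ennreal ((1 + vnorm D (f x \<omega>))\<^sup>2) \<partial>P \<partial>\<nu>) \<le> (\<integral>\<^sup>+x. ennreal A * ennreal ((1 + vnorm D x)\<^sup>2) \<partial>\<nu>)"
    using mom sp by (auto intro!: nn_integral_mono)
  also have "\<dots> = ennreal A * (\<integral>\<^sup>+x. ennreal ((1 + vnorm D x)\<^sup>2) \<partial>\<nu>)"
    by (rule nn_integral_cmult) measurable
  also have "\<dots> \<le> ennreal A * ennreal \<kappa>" by (intro mult_left_mono \<nu>_mom) auto
  finally show ?thesis
    using A by (subst nn_integral_transition[OF ps f \<nu>]) (auto simp: ennreal_mult')
qed

text \<open>Two errors add up. Replacing \<open>V\<close> by \<open>h\<close> under the expectation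
  costs at most \<delta> by Jensen's inequality; replacing the expectation of \<open>h\<close> by an
  average over \<open>n\<close> realisations costs at most 2 v / n. Here \<open>v\<close> bounds the
  second moment of \<open>h\<close> after a transition. No growth of \<open>h\<close> is known, so
  this moment is controlled through \<open>V\<close> and the error: h^2 is at most 2 V^2 + 2 (V -
  h)^2.\<close>

lemma expectation_approx:
  fixes f :: "(nat \<Rightarrow> real) \<Rightarrow> 'a \<Rightarrow> nat \<Rightarrow> real" and u :: "'a \<Rightarrow> nat \<Rightarrow> nat \<Rightarrow> nat \<Rightarrow> real"
  assumes ps: "prob_space P"
    and f[measurable]: "(\<lambda>(x, \<omega>). f x \<omega>) \<in> measurable (RD D \<Otimes>\<^sub>M P) (RD D)"
    and mom: "\<And>x. x \<in> space (RD D) \<Longrightarrow>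
      (\<integral>\<^sup>+\<omega>. ennreal ((1 + vnorm D (f x \<omega>))\<^sup>2) \<partial>P) \<le> ennreal A * ennreal ((1 + vnorm D x)\<^sup>2)"
    and u: "\<And>i m j. (\<lambda>\<omega>. u \<omega> i m j) \<in> borel_measurable P"
    and rep: "AE \<omega> in P. \<forall>x\<in>space (RD D). f x \<omega> = rnn_fun D D I (u \<omega>) x"
    and size: "(\<integral>\<^sup>+\<omega>. rnn_size (u \<omega>) \<partial>P) \<le> ennreal s"
    and \<nu>[measurable_cong]: "sets \<nu> = sets (RD D)" and \<nu>_mom: "(\<integral>\<^sup>+x. ennreal ((1 + vnorm D x)\<^sup>2) \<partial>\<nu>) \<le> ennreal \<kappa>"
    and V[measurable]: "V \<in> borel_measurable (RD D)"
    and V_le: "\<And>x. x \<in> space (RD D) \<Longrightarrow> \<bar>V x\<bar> \<le> K * (1 + vnorm D x)"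
    and h: "relu_computable D t h"
    and err: "(\<integral>\<^sup>+z. ennreal ((V z - h z)\<^sup>2) \<partial>distr (\<nu> \<Otimes>\<^sub>M P) (RD D) (\<lambda>(x, \<omega>). f x \<omega>)) \<le> ennreal \<delta>"
    and pos: "A \<ge> 0" "s > 0" "\<kappa> \<ge> 0" "\<delta> > 0" "n \<ge> 1"
  defines "v \<equiv> 2 * K\<^sup>2 * (A * \<kappa>) + 2 * \<delta>"
  shows "\<exists>r H. relu_computable D r H \<and> real r \<le> real n * (real t + 2 * s) \<and>
    (\<integral>\<^sup>+x. ennreal (((\<integral>\<omega>. V (f x \<omega>) \<partial>P) - H x)\<^sup>2) \<partial>\<nu>) \<le> ennreal (2 * \<delta> + 4 * v / real n)"
proof -
  interpret prob_space P by fact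
  have sp: "space \<nu> = space (RD D)" using \<nu> by (rule sets_eq_imp_space_eq)
  have [measurable]: "h \<in> borel_measurable (RD D)" using h by (rule relu_computable_measurable)
  have f'[measurable]: "(\<lambda>(x, \<omega>). f x \<omega>) \<in> measurable (\<nu> \<Otimes>\<^sub>M P) (RD D)"
    using f by (subst measurable_cong_sets[OF sets_pair_measure_cong[OF \<nu> refl] refl])
  have fx[measurable]: "f x \<in> measurable P (RD D)" if "x \<in> space (RD D)" for x
    using measurable_compose[OF measurable_Pair1'[OF that] f] by simp
  \<comment> \<open>The integrand is at least 1, so the moment bound alone makes \<nu> a finite
    measure, as Fubini's theorem and the sampling lemma require.\<close>
  have "emeasure \<nu> (space \<nu>) = (\<integral>\<^sup>+x. 1 \<partial>\<nu>)" by simp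
  also have "\<dots> \<le> (\<integral>\<^sup>+x. ennreal ((1 + vnorm D x)\<^sup>2) \<partial>\<nu>)"
    by (intro nn_integral_mono) (simp add: one_le_power flip: ennreal_1)
  also note \<nu>_mom
  finally have "finite_measure \<nu>" by (intro finite_measureI) (auto simp: top_unique)
  then interpret \<nu>: finite_measure \<nu> .
  define \<nu>' where "\<nu>' = distr (\<nu> \<Otimes>\<^sub>M P) (RD D) (\<lambda>(x, \<omega>). f x \<omega>)"
  note \<nu>' = nn_integral_transition[OF ps f \<nu>, folded \<nu>'_def]
  have \<nu>'_mom: "(\<integral>\<^sup>+z. ennreal ((1 + vnorm D z)\<^sup>2) \<partial>\<nu>') \<le> ennreal (A * \<kappa>)"
    using transition_moment[OF ps f mom \<nu> \<nu>_mom pos(1)] unfolding \<nu>'_def .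
  have spsp: "space \<nu>' = space (RD D)" by (simp add: \<nu>'_def)
  have h2: "(\<integral>\<^sup>+x. \<integral>\<^sup>+\<omega>. ennreal ((h (f x \<omega>))\<^sup>2) \<partial>P \<partial>\<nu>) \<le> ennreal v"
  proof -
    have "(\<integral>\<^sup>+x. \<integral>\<^sup>+\<omega>. ennreal ((h (f x \<omega>))\<^sup>2) \<partial>P \<partial>\<nu>) = (\<integral>\<^sup>+z. ennreal ((h z)\<^sup>2) \<partial>\<nu>')"
      by (rule \<nu>'[symmetric]) measurable
    also have "\<dots> \<le> (\<integral>\<^sup>+z. ennreal (2 * K\<^sup>2) * ennreal ((1 + vnorm D z)\<^sup>2) + 2 * ennreal ((V z - h z)\<^sup>2) \<partial>\<nu>')"
    proof (rule nn_integral_mono)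
      fix z assume "z \<in> space \<nu>'"
      then have "\<bar>V z\<bar> \<le> \<bar>K * (1 + vnorm D z)\<bar>" using V_le[of z] spsp by auto
      then have "(V z)\<^sup>2 \<le> (K * (1 + vnorm D z))\<^sup>2" by (simp only: abs_le_square_iff)
      moreover have "(h z)\<^sup>2 \<le> 2 * (V z)\<^sup>2 + 2 * (V z - h z)\<^sup>2"
      proof -
        have "0 \<le> (2 * V z - h z)\<^sup>2" by simp
        then show ?thesis by (simp add: power2_eq_square algebra_simps)
      qed
      ultimately have "(h z)\<^sup>2 \<le> 2 * K\<^sup>2 * (1 + vnorm D z)\<^sup>2 + 2 * (V z - h z)\<^sup>2"
        by (simp add: power_mult_distrib)
      then have "ennreal ((h z)\<^sup>2) \<le> ennreal (2 * K\<^sup>2 * (1 + vnorm D z)\<^sup>2 + 2 * (V z - h z)\<^sup>2)" by (rule ennreal_leI)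
      also have "\<dots> = ennreal (2 * K\<^sup>2) * ennreal ((1 + vnorm D z)\<^sup>2) + 2 * ennreal ((V z - h z)\<^sup>2)"
        by (simp add: ennreal_mult')
      finally show "ennreal ((h z)\<^sup>2) \<le> ennreal (2 * K\<^sup>2) * ennreal ((1 + vnorm D z)\<^sup>2) + 2 * ennreal ((V z - h z)\<^sup>2)" .
    qed
    also have "\<dots> = ennreal (2 * K\<^sup>2) * (\<integral>\<^sup>+z. ennreal ((1 + vnorm D z)\<^sup>2) \<partial>\<nu>') + 2 * (\<integral>\<^sup>+z. ennreal ((V z - h z)\<^sup>2) \<partial>\<nu>')"
      unfolding \<nu>'_def by (simp add: nn_integral_add nn_integral_cmult)
    also have "\<dots> \<le> ennreal (2 * K\<^sup>2) * ennreal (A * \<kappa>) + 2 * ennreal \<delta>"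
      using err \<nu>'_mom unfolding \<nu>'_def by (intro add_mono mult_left_mono) auto
    also have "\<dots> = ennreal v" using pos unfolding v_def
      by (simp add: ennreal_mult' ennreal_plus)
    finally show ?thesis .
  qed
  have v: "v > 0" unfolding v_def using pos by (intro add_nonneg_pos mult_nonneg_nonneg) auto
  have \<phi>: "(\<lambda>(x, \<omega>). h (f x \<omega>)) \<in> borel_measurable (\<nu> \<Otimes>\<^sub>M P)" by measurable
  obtain \<omega>s :: "nat \<Rightarrow> 'a" where \<omega>s: "\<forall>i<n. \<omega>s i \<in> space P \<and> (\<forall>x\<in>space (RD D). f x (\<omega>s i) = rnn_fun D D I (u (\<omega>s i)) x)"
    and pot: "ennreal s * (\<integral>\<^sup>+x. ennreal ((\<Sum>i<n. h (f x (\<omega>s i)) - (\<integral>\<omega>. h (f x \<omega>) \<partial>P))\<^sup>2) \<partial>\<nu>)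
       + ennreal v * (\<Sum>i<n. rnn_size (u (\<omega>s i))) \<le> 2 * of_nat n * (ennreal s * ennreal v)"
    using monte_carlo_greedy[OF \<nu>.sigma_finite_measure_axioms \<phi> rnn_size_measurable[OF u] size _ h2 _ rep, of n]
    by auto
  define Er where "Er = (\<integral>\<^sup>+x. ennreal ((\<Sum>i<n. h (f x (\<omega>s i)) - (\<integral>\<omega>. h (f x \<omega>) \<partial>P))\<^sup>2) \<partial>\<nu>)"
  define Sz where "Sz = (\<Sum>i<n. rnn_size (u (\<omega>s i)))"
  \<comment> \<open>Dropping one summand of the potential and cancelling the positive finite factor
    of the other bounds, for the same samples, first the error and then the total size.\<close>
  have "ennreal s * Er \<le> ennreal s * (2 * of_nat n * ennreal v)"
  proof -
    have "ennreal s * Er \<le> ennreal s * Er + ennreal v * Sz" by simp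
    also have "\<dots> \<le> 2 * of_nat n * (ennreal s * ennreal v)" using pot unfolding Er_def Sz_def .
    finally show ?thesis by (simp add: ac_simps)
  qed
  then have Er: "Er \<le> 2 * of_nat n * ennreal v" using pos by (subst (asm) ennreal_mult_le_mult_iff) auto
  have "ennreal v * Sz \<le> ennreal v * (2 * of_nat n * ennreal s)"
  proof -
    have "ennreal v * Sz \<le> ennreal s * Er + ennreal v * Sz" by simp
    also have "\<dots> \<le> 2 * of_nat n * (ennreal s * ennreal v)" using pot unfolding Er_def Sz_def .
    finally show ?thesis by (simp add: ac_simps)
  qed
  then have Sz: "Sz \<le> 2 * of_nat n * ennreal s" using v by (subst (asm) ennreal_mult_le_mult_iff) auto
  have Er': "Er \<le> ennreal (2 * real n * v)" and Sz': "Sz \<le> ennreal (2 * real n * s)"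
    using Er Sz v pos by (simp_all add: ennreal_mult' ennreal_of_nat_eq_real_of_nat)
  have "rnn_size (u (\<omega>s i)) < \<infinity>" if "i < n" for i
  proof -
    have "rnn_size (u (\<omega>s i)) \<le> Sz" unfolding Sz_def using that
      by (intro member_le_sum) auto
    also have "\<dots> < \<infinity>" using Sz' by (rule le_less_trans) simp
    finally show ?thesis .
  qed
  then have "\<forall>i\<in>{..<n}. \<exists>k::nat. rnn_size (u (\<omega>s i)) = of_nat k"
    using rnn_size_finite_nat by blast
  then obtain k :: "nat \<Rightarrow> nat" where "\<forall>i\<in>{..<n}. rnn_size (u (\<omega>s i)) = of_nat (k i)"
    by (auto dest!: bchoice)
  then have k: "\<And>i. i < n \<Longrightarrow> rnn_size (u (\<omega>s i)) = of_nat (k i)" by auto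
  have "Sz = of_nat (\<Sum>i<n. k i)" unfolding Sz_def using k by simp
  then have ksum: "real (\<Sum>i<n. k i) \<le> 2 * real n * s"
    using Sz' pos by (simp add: ennreal_of_nat_eq_real_of_nat del: of_nat_sum)
  define H where "H x = (1 / real n) * (\<Sum>i<n. h (rnn_fun D D I (u (\<omega>s i)) x))" for x
  have "relu_computable D (t + k i) (\<lambda>x. h (rnn_fun D D I (u (\<omega>s i)) x))" if i: "i < n" for i
  proof -
    obtain fs where fs: "relu_circuit D fs" "length fs \<le> k i"
      "\<And>j. j < D \<Longrightarrow> (\<lambda>x. rnn_fun D D I (u (\<omega>s i)) x j) \<in> aff_span D (set fs)"
      by (rule rnn_fun_circuit[of "u (\<omega>s i)" "k i" D D I]) (use k[OF i] in auto)
    have "relu_computable D (t + length fs) (\<lambda>x. h (rnn_fun D D I (u (\<omega>s i)) x))"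
      by (rule relu_computable_compose[OF h fs(1)]) (rule fs(3))
    then show ?thesis using fs(2) by (auto intro: relu_computable_mono)
  qed
  then have "relu_computable D (\<Sum>i<n. t + k i) (\<lambda>x. \<Sum>i<n. h (rnn_fun D D I (u (\<omega>s i)) x))"
    by (intro relu_computable_sum) auto
  then have H: "relu_computable D (\<Sum>i<n. t + k i) H" unfolding H_def by (rule relu_computable_scale)
  have "real (\<Sum>i<n. t + k i) = real n * real t + real (\<Sum>i<n. k i)" by (simp add: sum.distrib)
  then have size_le: "real (\<Sum>i<n. t + k i) \<le> real n * (real t + 2 * s)"
    using ksum by (simp add: algebra_simps)
  have [measurable]: "H \<in> borel_measurable (RD D)" using H by (rule relu_computable_measurable)
  define mh where "mh x = (\<integral>\<omega>. h (f x \<omega>) \<partial>P)" for x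
  define mV where "mV x = (\<integral>\<omega>. V (f x \<omega>) \<partial>P)" for x
  have [measurable]: "mh \<in> borel_measurable \<nu>" "mV \<in> borel_measurable \<nu>"
    unfolding mh_def mV_def by (rule borel_measurable_lebesgue_integral, measurable)+
  have e1: "(\<integral>\<^sup>+x. ennreal ((mV x - mh x)\<^sup>2) \<partial>\<nu>) \<le> ennreal \<delta>"
  proof -
    \<comment> \<open>Subtracting the two expectations needs both integrands to be integrable. For
      \<open>V\<close> the growth bound gives this at every \<open>x\<close>; for \<open>h\<close>
      only the finite double integral is at hand, hence almost every \<open>x\<close>.\<close>
    have "AE x in \<nu>. (\<integral>\<^sup>+\<omega>. ennreal ((h (f x \<omega>))\<^sup>2) \<partial>P) \<noteq> \<infinity>"
      using le_less_trans[OF h2, of \<infinity>] by (intro nn_integral_PInf_AE) auto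
    then have "AE x in \<nu>. ennreal ((mV x - mh x)\<^sup>2) \<le> (\<integral>\<^sup>+\<omega>. ennreal ((V (f x \<omega>) - h (f x \<omega>))\<^sup>2) \<partial>P)"
      using AE_space
    proof eventually_elim
      case (elim x)
      then have x: "x \<in> space (RD D)" using sp by simp
      note [measurable] = fx[OF x]
      have "integrable P (\<lambda>\<omega>. (h (f x \<omega>))\<^sup>2)" using elim(1) by (intro integrableI_bounded) (auto simp: less_top)
      then have ih: "integrable P (\<lambda>\<omega>. h (f x \<omega>))" by (rule square_integrable_imp_integrable[rotated]) simp
      have "(\<integral>\<^sup>+\<omega>. ennreal (norm ((V (f x \<omega>))\<^sup>2)) \<partial>P) \<le> (\<integral>\<^sup>+\<omega>. ennreal (K\<^sup>2) * ennreal ((1 + vnorm D (f x \<omega>))\<^sup>2) \<partial>P)"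
      proof (rule nn_integral_mono)
        fix \<omega> assume "\<omega> \<in> space P"
        then have "f x \<omega> \<in> space (RD D)" using measurable_space[OF fx[OF x]] by auto
        then have "\<bar>V (f x \<omega>)\<bar> \<le> \<bar>K * (1 + vnorm D (f x \<omega>))\<bar>" using V_le[of "f x \<omega>"] by auto
        then have "(V (f x \<omega>))\<^sup>2 \<le> (K * (1 + vnorm D (f x \<omega>)))\<^sup>2" by (simp only: abs_le_square_iff)
        then show "ennreal (norm ((V (f x \<omega>))\<^sup>2)) \<le> ennreal (K\<^sup>2) * ennreal ((1 + vnorm D (f x \<omega>))\<^sup>2)"
          by (simp add: ennreal_mult'[symmetric] power_mult_distrib ennreal_leI)
      qed
      also have "\<dots> = ennreal (K\<^sup>2) * (\<integral>\<^sup>+\<omega>. ennreal ((1 + vnorm D (f x \<omega>))\<^sup>2) \<partial>P)"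
        by (rule nn_integral_cmult) measurable
      also have "\<dots> \<le> ennreal (K\<^sup>2) * (ennreal A * ennreal ((1 + vnorm D x)\<^sup>2))"
        using mom[OF x] by (intro mult_left_mono) auto
      also have "\<dots> < \<infinity>" by (simp add: ennreal_mult_less_top)
      finally have "integrable P (\<lambda>\<omega>. (V (f x \<omega>))\<^sup>2)" by (intro integrableI_bounded) auto
      then have iV: "integrable P (\<lambda>\<omega>. V (f x \<omega>))" by (rule square_integrable_imp_integrable[rotated]) simp
      have "mV x - mh x = (\<integral>\<omega>. V (f x \<omega>) - h (f x \<omega>) \<partial>P)" unfolding mV_def mh_def using ih iV by simp
      then show ?case using square_integral_le_nn_integral[of "\<lambda>\<omega>. V (f x \<omega>) - h (f x \<omega>)"] by simp
    qed
    then have "(\<integral>\<^sup>+x. ennreal ((mV x - mh x)\<^sup>2) \<partial>\<nu>) \<le> (\<integral>\<^sup>+x. \<integral>\<^sup>+\<omega>. ennreal ((V (f x \<omega>) - h (f x \<omega>))\<^sup>2) \<partial>P \<partial>\<nu>)"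
      by (rule nn_integral_mono_AE)
    also have "\<dots> = (\<integral>\<^sup>+z. ennreal ((V z - h z)\<^sup>2) \<partial>\<nu>')" by (rule \<nu>'[symmetric]) measurable
    finally show ?thesis using err unfolding \<nu>'_def by simp
  qed
  have e2: "(\<integral>\<^sup>+x. ennreal ((mh x - H x)\<^sup>2) \<partial>\<nu>) \<le> ennreal (2 * v / real n)"
  proof -
    have "(\<integral>\<^sup>+x. ennreal ((mh x - H x)\<^sup>2) \<partial>\<nu>) = (\<integral>\<^sup>+x. ennreal (1 / (real n)\<^sup>2) * ennreal ((\<Sum>i<n. h (f x (\<omega>s i)) - mh x)\<^sup>2) \<partial>\<nu>)"
    proof (rule nn_integral_cong)
      fix x assume "x \<in> space \<nu>"
      then have "(\<Sum>i<n. h (f x (\<omega>s i)) - mh x) = real n * (H x - mh x)"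
        using \<omega>s pos sp unfolding H_def by (simp add: sum_subtractf right_diff_distrib)
      then have "(mh x - H x)\<^sup>2 = 1 / (real n)\<^sup>2 * (\<Sum>i<n. h (f x (\<omega>s i)) - mh x)\<^sup>2"
        using pos by (simp add: power_mult_distrib power2_commute)
      then show "ennreal ((mh x - H x)\<^sup>2) = ennreal (1 / (real n)\<^sup>2) * ennreal ((\<Sum>i<n. h (f x (\<omega>s i)) - mh x)\<^sup>2)"
        by (simp add: ennreal_mult'[symmetric])
    qed
    also have "\<dots> = ennreal (1 / (real n)\<^sup>2) * Er"
    proof -
      have [measurable]: "(\<lambda>x. h (f x (\<omega>s i))) \<in> borel_measurable \<nu>" if "i < n" for i
        using measurable_compose[OF measurable_Pair2' \<phi>, of "\<omega>s i"] \<omega>s that by simp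
      have "(\<lambda>x. \<Sum>i<n. h (f x (\<omega>s i)) - mh x) \<in> borel_measurable \<nu>"
        by (intro borel_measurable_sum borel_measurable_diff) auto
      then show ?thesis unfolding Er_def mh_def by (subst nn_integral_cmult) auto
    qed
    also have "\<dots> \<le> ennreal (1 / (real n)\<^sup>2) * ennreal (2 * real n * v)" by (intro mult_left_mono Er') auto
    also have "\<dots> = ennreal (2 * v / real n)"
      using pos v by (simp add: ennreal_mult'[symmetric] power2_eq_square)
    finally show ?thesis .
  qed
  have "(\<integral>\<^sup>+x. ennreal ((mV x - H x)\<^sup>2) \<partial>\<nu>) \<le> (\<integral>\<^sup>+x. 2 * ennreal ((mV x - mh x)\<^sup>2) + 2 * ennreal ((mh x - H x)\<^sup>2) \<partial>\<nu>)"
  proof (rule nn_integral_mono)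
    fix x
    have "0 \<le> ((mV x - mh x) - (mh x - H x))\<^sup>2" by simp
    then have "(mV x - H x)\<^sup>2 \<le> 2 * (mV x - mh x)\<^sup>2 + 2 * (mh x - H x)\<^sup>2"
      by (simp add: power2_eq_square algebra_simps)
    then have "ennreal ((mV x - H x)\<^sup>2) \<le> ennreal (2 * (mV x - mh x)\<^sup>2 + 2 * (mh x - H x)\<^sup>2)" by (rule ennreal_leI)
    then show "ennreal ((mV x - H x)\<^sup>2) \<le> 2 * ennreal ((mV x - mh x)\<^sup>2) + 2 * ennreal ((mh x - H x)\<^sup>2)"
      by (simp add: ennreal_mult')
  qed
  also have "\<dots> = 2 * (\<integral>\<^sup>+x. ennreal ((mV x - mh x)\<^sup>2) \<partial>\<nu>) + 2 * (\<integral>\<^sup>+x. ennreal ((mh x - H x)\<^sup>2) \<partial>\<nu>)"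
    by (simp add: nn_integral_add nn_integral_cmult)
  also have "\<dots> \<le> 2 * ennreal \<delta> + 2 * ennreal (2 * v / real n)"
    using e1 e2 by (intro add_mono mult_left_mono) auto
  also have "\<dots> = ennreal (2 * \<delta> + 4 * v / real n)"
  proof -
    have two: "2 * ennreal x = ennreal (2 * x)" for x by (simp add: ennreal_mult')
    show ?thesis unfolding two using pos v by (simp flip: ennreal_plus)
  qed
  finally show ?thesis using H size_le unfolding mV_def by blast
qed

section \<open>Backward induction for the value functions\<close>

definition transition_ok :: "'a measure \<Rightarrow> nat \<Rightarrow> ((nat \<Rightarrow> real) \<Rightarrow> 'a \<Rightarrow> nat \<Rightarrow> real) \<Rightarrow> real \<Rightarrow> bool" where
  "transition_ok P D f B \<longleftrightarrow> prob_space P \<and>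
     (\<lambda>(x, \<omega>). f x \<omega>) \<in> measurable (RD D \<Otimes>\<^sub>M P) (RD D) \<and>
     (\<forall>x\<in>space (RD D). (\<integral>\<^sup>+\<omega>. ennreal ((1 + vnorm D (f x \<omega>))\<^sup>2) \<partial>P) \<le> ennreal B * ennreal ((1 + vnorm D x)\<^sup>2)) \<and>
     (\<exists>I u. (\<forall>i m j. (\<lambda>\<omega>. u \<omega> i m j) \<in> borel_measurable P) \<and>
        (AE \<omega> in P. \<forall>x\<in>space (RD D). f x \<omega> = rnn_fun D D I (u \<omega>) x) \<and>
        (\<integral>\<^sup>+\<omega>. rnn_size (u \<omega>) \<partial>P) \<le> ennreal B)"

text \<open>Below, the single parameter \<open>\<kappa>\<close> bounds the second moment of \<open>\<nu>\<close> and the inverse of the squared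
  error, and it will also dominate the dimension, so that every polynomial bound becomes a power
  of \<open>\<kappa>\<close>.\<close>

definition obstacle_ok :: "nat \<Rightarrow> ((nat \<Rightarrow> real) \<Rightarrow> real) \<Rightarrow> real \<Rightarrow> real \<Rightarrow> bool" where
  "obstacle_ok D g B \<kappa> \<longleftrightarrow> g \<in> borel_measurable (RD D) \<and>
     (\<forall>x\<in>space (RD D). \<bar>g x\<bar> \<le> B * (1 + vnorm D x)) \<and>
     (\<exists>s h. relu_computable D s h \<and> real s \<le> B \<and>
        (\<forall>x\<in>space (RD D). \<bar>g x - h x\<bar> \<le> 1 / \<kappa> * (1 + vnorm D x)))"

definition value_ok :: "nat \<Rightarrow> ((nat \<Rightarrow> real) \<Rightarrow> real) \<Rightarrow> real \<Rightarrow> real \<Rightarrow> bool" where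
  "value_ok D V B \<kappa> \<longleftrightarrow> V \<in> borel_measurable (RD D) \<and>
     (\<forall>x\<in>space (RD D). \<bar>V x\<bar> \<le> B * (1 + vnorm D x)) \<and>
     (\<forall>\<nu>. sets \<nu> = sets (RD D) \<longrightarrow> (\<integral>\<^sup>+x. ennreal ((1 + vnorm D x)\<^sup>2) \<partial>\<nu>) \<le> ennreal \<kappa> \<longrightarrow>
        (\<exists>s h. relu_computable D s h \<and> real s \<le> B \<and>
           (\<integral>\<^sup>+x. ennreal ((V x - h x)\<^sup>2) \<partial>\<nu>) \<le> ennreal (1 / \<kappa>)))"

lemma nn_integral_square_le_moment:
  assumes "sets \<nu> = sets (RD D)" "(\<integral>\<^sup>+x. ennreal ((1 + vnorm D x)\<^sup>2) \<partial>\<nu>) \<le> ennreal \<kappa>"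
    and le: "\<And>x. x \<in> space (RD D) \<Longrightarrow> \<bar>g x\<bar> \<le> c * (1 + vnorm D x)"
  shows "(\<integral>\<^sup>+x. ennreal ((g x)\<^sup>2) \<partial>\<nu>) \<le> ennreal (c\<^sup>2 * \<kappa>)"
proof -
  note [measurable_cong] = assms(1)
  have sp: "space \<nu> = space (RD D)" using assms(1) by (rule sets_eq_imp_space_eq)
  have "(\<integral>\<^sup>+x. ennreal ((g x)\<^sup>2) \<partial>\<nu>) \<le> (\<integral>\<^sup>+x. ennreal (c\<^sup>2) * ennreal ((1 + vnorm D x)\<^sup>2) \<partial>\<nu>)"
  proof (rule nn_integral_mono)
    fix x assume "x \<in> space \<nu>"
    then have "\<bar>g x\<bar> \<le> \<bar>c * (1 + vnorm D x)\<bar>" using le[of x] sp by auto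
    then have "(g x)\<^sup>2 \<le> (c * (1 + vnorm D x))\<^sup>2" by (simp only: abs_le_square_iff)
    then show "ennreal ((g x)\<^sup>2) \<le> ennreal (c\<^sup>2) * ennreal ((1 + vnorm D x)\<^sup>2)"
      by (simp add: ennreal_mult'[symmetric] power_mult_distrib ennreal_leI)
  qed
  also have "\<dots> = ennreal (c\<^sup>2) * (\<integral>\<^sup>+x. ennreal ((1 + vnorm D x)\<^sup>2) \<partial>\<nu>)"
    by (rule nn_integral_cmult) measurable
  also have "\<dots> \<le> ennreal (c\<^sup>2) * ennreal \<kappa>" by (intro mult_left_mono assms) auto
  finally show ?thesis by (simp add: ennreal_mult')
qed

text \<open>A pointwise relative error of 1/\<kappa>^2 has square 1/\<kappa>^4, and the moment costs
  one factor \<kappa>. The resulting third power leaves room for the other errors of the induction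
  step.\<close>

lemma obstacle_ok_L2:
  assumes "obstacle_ok D g B (\<kappa>\<^sup>2)" "\<kappa> > 0"
    and "sets \<nu> = sets (RD D)" "(\<integral>\<^sup>+x. ennreal ((1 + vnorm D x)\<^sup>2) \<partial>\<nu>) \<le> ennreal \<kappa>"
  shows "\<exists>s h. relu_computable D s h \<and> real s \<le> B \<and> (\<integral>\<^sup>+x. ennreal ((g x - h x)\<^sup>2) \<partial>\<nu>) \<le> ennreal (1 / \<kappa> ^ 3)"
proof -
  obtain s h where h: "relu_computable D s h" "real s \<le> B"
    "\<And>x. x \<in> space (RD D) \<Longrightarrow> \<bar>g x - h x\<bar> \<le> 1 / \<kappa>\<^sup>2 * (1 + vnorm D x)"
    using assms(1) unfolding obstacle_ok_def by blast
  have "(1 / \<kappa>\<^sup>2)\<^sup>2 * \<kappa> = 1 / \<kappa> ^ 3" using assms(2) by (simp add: field_simps power2_eq_square power3_eq_cube)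
  then show ?thesis
    using h nn_integral_square_le_moment[OF assms(3,4) h(3)] by auto
qed

lemma value_ok_obstacle:
  assumes "obstacle_ok D g B (\<kappa>\<^sup>2)" "\<kappa> \<ge> 1"
  shows "value_ok D g B \<kappa>"
  unfolding value_ok_def
proof (intro conjI allI impI)
  fix \<nu> assume \<nu>: "sets \<nu> = sets (RD D)" "(\<integral>\<^sup>+x. ennreal ((1 + vnorm D x)\<^sup>2) \<partial>\<nu>) \<le> ennreal \<kappa>"
  have "\<kappa> ^ 1 \<le> \<kappa> ^ 3" using assms(2) by (intro power_increasing) auto
  then have "1 / \<kappa> ^ 3 \<le> 1 / \<kappa>" using assms(2) by (intro divide_left_mono) auto
  then have le: "ennreal (1 / \<kappa> ^ 3) \<le> ennreal (1 / \<kappa>)" by (rule ennreal_leI)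
  obtain s h where "relu_computable D s h" "real s \<le> B" "(\<integral>\<^sup>+x. ennreal ((g x - h x)\<^sup>2) \<partial>\<nu>) \<le> ennreal (1 / \<kappa> ^ 3)"
    using obstacle_ok_L2[OF assms(1) _ \<nu>] assms(2) by auto
  then show "\<exists>s h. relu_computable D s h \<and> real s \<le> B \<and> (\<integral>\<^sup>+x. ennreal ((g x - h x)\<^sup>2) \<partial>\<nu>) \<le> ennreal (1 / \<kappa>)"
    using le by (blast intro: order_trans)
qed (use assms(1) in \<open>auto simp: obstacle_ok_def\<close>)

text \<open>The maximum is nonexpansive for the sup norm, so already one of the two squares
  dominates.\<close>

lemma square_diff_max_le:
  fixes a b c d :: real
  shows "(max a b - max c d)\<^sup>2 \<le> (a - c)\<^sup>2 + (b - d)\<^sup>2"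
proof -
  have "\<bar>max a b - max c d\<bar> \<le> \<bar>a - c\<bar> \<or> \<bar>max a b - max c d\<bar> \<le> \<bar>b - d\<bar>" by linarith
  then have "(max a b - max c d)\<^sup>2 \<le> (a - c)\<^sup>2 \<or> (max a b - max c d)\<^sup>2 \<le> (b - d)\<^sup>2"
    by (simp only: abs_le_square_iff)
  then show ?thesis by (smt (verit) zero_le_power2)
qed

text \<open>Jensen's inequality bounds the square of the expectation by the second moment of
  \<open>V\<close> under the law of \<open>f x\<close>. Weakening \<open>B\<close> to B^2 makes the
  right side a perfect square, so that the root can be taken.\<close>

lemma abs_expectation_le:
  assumes tr: "transition_ok P D f B" and V[measurable]: "V \<in> borel_measurable (RD D)"
    and V_le: "\<And>x. x \<in> space (RD D) \<Longrightarrow> \<bar>V x\<bar> \<le> K * (1 + vnorm D x)"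
    and x: "x \<in> space (RD D)" and "B \<ge> 1" "K \<ge> 0"
  shows "\<bar>\<integral>\<omega>. V (f x \<omega>) \<partial>P\<bar> \<le> K * B * (1 + vnorm D x)"
proof -
  interpret prob_space P using tr by (simp add: transition_ok_def)
  have [measurable]: "f x \<in> measurable P (RD D)"
    using measurable_compose[OF measurable_Pair1'[OF x], of "\<lambda>(x, \<omega>). f x \<omega>" P "RD D"] tr
    by (simp add: transition_ok_def)
  have "ennreal ((\<integral>\<omega>. V (f x \<omega>) \<partial>P)\<^sup>2) \<le> (\<integral>\<^sup>+\<omega>. ennreal ((V (f x \<omega>))\<^sup>2) \<partial>P)"
    by (rule square_integral_le_nn_integral) measurable
  also have "\<dots> = (\<integral>\<^sup>+z. ennreal ((V z)\<^sup>2) \<partial>distr P (RD D) (f x))" by (subst nn_integral_distr) auto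
  also have "\<dots> \<le> ennreal (K\<^sup>2 * (B * (1 + vnorm D x)\<^sup>2))"
  proof (rule nn_integral_square_le_moment)
    have "(\<integral>\<^sup>+z. ennreal ((1 + vnorm D z)\<^sup>2) \<partial>distr P (RD D) (f x)) = (\<integral>\<^sup>+\<omega>. ennreal ((1 + vnorm D (f x \<omega>))\<^sup>2) \<partial>P)"
      by (subst nn_integral_distr) auto
    then show "(\<integral>\<^sup>+z. ennreal ((1 + vnorm D z)\<^sup>2) \<partial>distr P (RD D) (f x)) \<le> ennreal (B * (1 + vnorm D x)\<^sup>2)"
      using tr x \<open>B \<ge> 1\<close> by (simp add: transition_ok_def ennreal_mult')
  qed (use V_le in auto)
  finally have "(\<integral>\<omega>. V (f x \<omega>) \<partial>P)\<^sup>2 \<le> K\<^sup>2 * (B * (1 + vnorm D x)\<^sup>2)"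
    using assms(5) by (subst (asm) ennreal_le_iff) auto
  also have "\<dots> \<le> K\<^sup>2 * (B\<^sup>2 * (1 + vnorm D x)\<^sup>2)"
    using assms(5) by (intro mult_left_mono mult_right_mono) (auto simp: power2_eq_square)
  also have "\<dots> = (K * B * (1 + vnorm D x))\<^sup>2" by (simp add: power_mult_distrib)
  finally have "\<bar>\<integral>\<omega>. V (f x \<omega>) \<partial>P\<bar> \<le> \<bar>K * B * (1 + vnorm D x)\<bar>" by (simp only: abs_le_square_iff)
  then show ?thesis using assms(5,6) by simp
qed

text \<open>The hypothesis on \<open>V\<close> enters at two scales: at \<kappa> for the growth
  bound \<kappa>^b, which governs the variance, and at \<kappa>^(a+5) for the approximation after
  the transition. \<open>E\<close> adds up the exponents of the number of samples, of the size of
  one sample and of the obstacle network, plus the spare powers of \<kappa> that absorb numerical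
  factors.\<close>

lemma value_ok_step:
  assumes \<kappa>: "\<kappa> \<ge> 2" and tr: "transition_ok P D f (\<kappa> ^ a)" and ob: "obstacle_ok D g (\<kappa> ^ (2 * a)) (\<kappa>\<^sup>2)"
    and V1: "value_ok D V (\<kappa> ^ b) \<kappa>" and V2: "value_ok D V (\<kappa> ^ ((a + 5) * b)) (\<kappa> ^ (a + 5))"
  defines "E \<equiv> 2 * b + (a + 5) * b + 4 * a + 14"
  shows "value_ok D (\<lambda>x. max (g x) (\<integral>\<omega>. V (f x \<omega>) \<partial>P)) (\<kappa> ^ E) \<kappa>"
proof -
  interpret prob_space P using tr by (simp add: transition_ok_def)
  have f[measurable]: "(\<lambda>(x, \<omega>). f x \<omega>) \<in> measurable (RD D \<Otimes>\<^sub>M P) (RD D)"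
    and mom: "\<And>x. x \<in> space (RD D) \<Longrightarrow> (\<integral>\<^sup>+\<omega>. ennreal ((1 + vnorm D (f x \<omega>))\<^sup>2) \<partial>P) \<le> ennreal (\<kappa> ^ a) * ennreal ((1 + vnorm D x)\<^sup>2)"
    using tr by (auto simp: transition_ok_def)
  obtain I u where u: "\<And>i m j. (\<lambda>\<omega>. u \<omega> i m j) \<in> borel_measurable P"
    "AE \<omega> in P. \<forall>x\<in>space (RD D). f x \<omega> = rnn_fun D D I (u \<omega>) x"
    "(\<integral>\<^sup>+\<omega>. rnn_size (u \<omega>) \<partial>P) \<le> ennreal (\<kappa> ^ a)"
    using tr by (auto simp: transition_ok_def)
  have V[measurable]: "V \<in> borel_measurable (RD D)"
    and V_le: "\<And>x. x \<in> space (RD D) \<Longrightarrow> \<bar>V x\<bar> \<le> \<kappa> ^ b * (1 + vnorm D x)"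
    using V1 by (auto simp: value_ok_def)
  have g[measurable]: "g \<in> borel_measurable (RD D)"
    and g_le: "\<And>x. x \<in> space (RD D) \<Longrightarrow> \<bar>g x\<bar> \<le> \<kappa> ^ (2 * a) * (1 + vnorm D x)"
    using ob by (auto simp: obstacle_ok_def)
  define W where "W x = (\<integral>\<omega>. V (f x \<omega>) \<partial>P)" for x
  have [measurable]: "W \<in> borel_measurable (RD D)"
    unfolding W_def by (rule borel_measurable_lebesgue_integral) measurable
  have pinc: "\<kappa> ^ i \<le> \<kappa> ^ j" if "i \<le> j" for i j using \<kappa> that by (intro power_increasing) auto
  have p1: "1 \<le> \<kappa> ^ i" for i using \<kappa> by (intro one_le_power) auto
  have two: "2 * \<kappa> ^ i \<le> \<kappa> ^ Suc i" for i using \<kappa> by (auto intro: mult_right_mono)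
  have W_le: "\<bar>W x\<bar> \<le> \<kappa> ^ E * (1 + vnorm D x)" if "x \<in> space (RD D)" for x
  proof -
    have "\<bar>W x\<bar> \<le> \<kappa> ^ b * \<kappa> ^ a * (1 + vnorm D x)"
      unfolding W_def using \<kappa> p1 by (intro abs_expectation_le[OF tr V V_le that]) auto
    also have "\<dots> \<le> \<kappa> ^ E * (1 + vnorm D x)"
      unfolding power_add[symmetric] by (intro mult_right_mono pinc) (auto simp: E_def)
    finally show ?thesis .
  qed
  have max_le: "\<bar>max (g x) (W x)\<bar> \<le> \<kappa> ^ E * (1 + vnorm D x)" if "x \<in> space (RD D)" for x
  proof -
    have "\<kappa> ^ (2 * a) * (1 + vnorm D x) \<le> \<kappa> ^ E * (1 + vnorm D x)"
      by (intro mult_right_mono pinc) (auto simp: E_def)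
    then show ?thesis using W_le[OF that] g_le[OF that] by (auto simp: max_def)
  qed
  have approx: "\<exists>s h. relu_computable D s h \<and> real s \<le> \<kappa> ^ E \<and>
      (\<integral>\<^sup>+x. ennreal ((max (g x) (W x) - h x)\<^sup>2) \<partial>\<nu>) \<le> ennreal (1 / \<kappa>)"
    if \<nu>: "sets \<nu> = sets (RD D)" and \<nu>_mom: "(\<integral>\<^sup>+x. ennreal ((1 + vnorm D x)\<^sup>2) \<partial>\<nu>) \<le> ennreal \<kappa>" for \<nu>
  proof -
    note [measurable_cong] = \<nu>
    let ?\<nu>' = "distr (\<nu> \<Otimes>\<^sub>M P) (RD D) (\<lambda>(x, \<omega>). f x \<omega>)"
    \<comment> \<open>The scale \<kappa>^(a+5) serves two purposes: it exceeds \<kappa>^(a+1), the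
      moment bound after the transition, and its inverse is at most 1/\<kappa>^5, so that 2 \<delta>
      uses only part of the error budget 3/\<kappa>^3.\<close>
    define \<delta> where "\<delta> = 1 / \<kappa> ^ (a + 5)"
    have \<delta>: "\<delta> > 0" "\<delta> \<le> 1 / \<kappa> ^ 5" "\<delta> \<le> 1"
      using \<kappa> p1[of "a + 5"] by (auto simp: \<delta>_def intro!: divide_left_mono pinc)
    have "(\<integral>\<^sup>+z. ennreal ((1 + vnorm D z)\<^sup>2) \<partial>?\<nu>') \<le> ennreal (\<kappa> ^ a * \<kappa>)"
      using \<kappa> by (intro transition_moment[OF prob_space_axioms f mom \<nu> \<nu>_mom]) auto
    also have "\<dots> \<le> ennreal (\<kappa> ^ (a + 5))"
      using pinc[of "a + 1" "a + 5"] by (intro ennreal_leI) (simp add: mult.commute)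
    finally have "\<exists>s h. relu_computable D s h \<and> real s \<le> \<kappa> ^ ((a + 5) * b) \<and>
        (\<integral>\<^sup>+x. ennreal ((V x - h x)\<^sup>2) \<partial>?\<nu>') \<le> ennreal (1 / \<kappa> ^ (a + 5))"
      by (intro V2[unfolded value_ok_def, THEN conjunct2, THEN conjunct2, rule_format]) simp
    then obtain t h where h: "relu_computable D t h" "real t \<le> \<kappa> ^ ((a + 5) * b)"
      "(\<integral>\<^sup>+x. ennreal ((V x - h x)\<^sup>2) \<partial>?\<nu>') \<le> ennreal \<delta>"
      unfolding \<delta>_def by blast
    define v where "v = 2 * (\<kappa> ^ b)\<^sup>2 * (\<kappa> ^ a * \<kappa>) + 2 * \<delta>"
    \<comment> \<open>The number of samples that makes 4 v / n at most 1/\<kappa>^3: v is at most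
      \<kappa>^(2b+a+3), and the factor 4 is absorbed by \<kappa>^2.\<close>
    define n where "n = nat \<lceil>\<kappa> ^ (2 * b + a + 8)\<rceil>"
    have n_ge: "\<kappa> ^ (2 * b + a + 8) \<le> real n" unfolding n_def by linarith
    have n1: "n \<ge> 1" using n_ge p1[of "2 * b + a + 8"] by linarith
    have n_le: "real n \<le> \<kappa> ^ (2 * b + a + 9)"
    proof -
      have "real n \<le> \<kappa> ^ (2 * b + a + 8) + 1" unfolding n_def using p1[of "2 * b + a + 8"] by linarith
      also have "\<dots> \<le> 2 * \<kappa> ^ (2 * b + a + 8)" using p1[of "2 * b + a + 8"] by linarith
      also have "\<dots> \<le> \<kappa> ^ Suc (2 * b + a + 8)" by (rule two)
      also have "\<dots> \<le> \<kappa> ^ (2 * b + a + 9)" by (rule pinc) simp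
      finally show ?thesis .
    qed
    have v_le: "v \<le> \<kappa> ^ (2 * b + a + 3)"
    proof -
      have "(\<kappa> ^ b)\<^sup>2 * (\<kappa> ^ a * \<kappa>) = \<kappa> ^ (2 * b + a + 1)"
        by (simp add: power_add power_mult power2_eq_square algebra_simps power_mult_distrib)
      then have "v \<le> 2 * (2 * \<kappa> ^ (2 * b + a + 1))"
        unfolding v_def using \<delta>(3) p1[of "2 * b + a + 1"] by linarith
      also have "\<dots> \<le> 2 * \<kappa> ^ Suc (2 * b + a + 1)" by (intro mult_left_mono two) auto
      also have "\<dots> \<le> \<kappa> ^ Suc (Suc (2 * b + a + 1))" by (rule two)
      also have "\<dots> \<le> \<kappa> ^ (2 * b + a + 3)" by (rule pinc) simp
      finally show ?thesis .
    qed
    obtain r H where H: "relu_computable D r H" "real r \<le> real n * (real t + 2 * \<kappa> ^ a)"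
      "(\<integral>\<^sup>+x. ennreal ((W x - H x)\<^sup>2) \<partial>\<nu>) \<le> ennreal (2 * \<delta> + 4 * v / real n)"
      using expectation_approx[OF prob_space_axioms f mom u \<nu> \<nu>_mom V V_le h(1,3) _ _ _ \<delta>(1) n1] \<kappa>
      unfolding W_def v_def by auto
    have "4 * v / real n \<le> 1 / \<kappa> ^ 3"
    proof -
      have "4 * v \<le> 2 * (2 * \<kappa> ^ (2 * b + a + 3))" using v_le by linarith
      also have "\<dots> \<le> 2 * \<kappa> ^ Suc (2 * b + a + 3)" by (intro mult_left_mono two) auto
      also have "\<dots> \<le> \<kappa> ^ Suc (Suc (2 * b + a + 3))" by (rule two)
      also have "\<dots> \<le> \<kappa> ^ (2 * b + a + 5)" by (rule pinc) simp
      finally have "4 * v \<le> \<kappa> ^ (2 * b + a + 5)" .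
      then have "4 * v * \<kappa> ^ 3 \<le> \<kappa> ^ (2 * b + a + 5) * \<kappa> ^ 3" using \<kappa> by (intro mult_right_mono) auto
      also have "\<dots> \<le> \<kappa> ^ (2 * b + a + 8)" unfolding power_add[symmetric] by (rule pinc) simp
      also note n_ge
      finally show ?thesis using \<kappa> n1 by (simp add: field_simps)
    qed
    moreover have "1 / \<kappa> ^ 5 \<le> 1 / \<kappa> ^ 3" using \<kappa> by (intro divide_left_mono pinc) auto
    ultimately have "2 * \<delta> + 4 * v / real n \<le> 3 / \<kappa> ^ 3" using \<delta>(2) by auto
    then have H': "(\<integral>\<^sup>+x. ennreal ((W x - H x)\<^sup>2) \<partial>\<nu>) \<le> ennreal (3 / \<kappa> ^ 3)"
      using H(3) by (auto intro: order_trans ennreal_leI)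
    obtain s k where k: "relu_computable D s k" "real s \<le> \<kappa> ^ (2 * a)"
      "(\<integral>\<^sup>+x. ennreal ((g x - k x)\<^sup>2) \<partial>\<nu>) \<le> ennreal (1 / \<kappa> ^ 3)"
      using obstacle_ok_L2[OF ob _ \<nu> \<nu>_mom] \<kappa> by auto
    have [measurable]: "H \<in> borel_measurable (RD D)" "k \<in> borel_measurable (RD D)"
      using H(1) k(1) by (auto intro: relu_computable_measurable)
    have "(\<integral>\<^sup>+x. ennreal ((max (g x) (W x) - max (k x) (H x))\<^sup>2) \<partial>\<nu>)
        \<le> (\<integral>\<^sup>+x. ennreal ((g x - k x)\<^sup>2) + ennreal ((W x - H x)\<^sup>2) \<partial>\<nu>)"
      by (intro nn_integral_mono) (simp add: ennreal_leI square_diff_max_le flip: ennreal_plus)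
    also have "\<dots> = (\<integral>\<^sup>+x. ennreal ((g x - k x)\<^sup>2) \<partial>\<nu>) + (\<integral>\<^sup>+x. ennreal ((W x - H x)\<^sup>2) \<partial>\<nu>)"
      by (rule nn_integral_add) measurable
    also have "\<dots> \<le> ennreal (1 / \<kappa> ^ 3) + ennreal (3 / \<kappa> ^ 3)" by (intro add_mono k(3) H')
    also have "\<dots> = ennreal (4 / \<kappa> ^ 3)" using \<kappa> by (simp flip: ennreal_plus add: add_divide_distrib[symmetric])
    also have "\<dots> \<le> ennreal (1 / \<kappa>)"
    proof (rule ennreal_leI)
      have "4 \<le> \<kappa> ^ 2" using \<kappa> power_mono[of 2 \<kappa> 2] by simp
      then show "4 / \<kappa> ^ 3 \<le> 1 / \<kappa>" using \<kappa> by (simp add: field_simps power2_eq_square power3_eq_cube)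
    qed
    finally have err: "(\<integral>\<^sup>+x. ennreal ((max (g x) (W x) - max (k x) (H x))\<^sup>2) \<partial>\<nu>) \<le> ennreal (1 / \<kappa>)" .
    have sz: "real (2 * s + r + 1) \<le> \<kappa> ^ E"
    proof -
      define e where "e = (a + 5) * b + a"
      define d where "d = 2 * b + a + 9"
      have "real t + 2 * \<kappa> ^ a \<le> \<kappa> ^ e + 2 * \<kappa> ^ e"
        using h(2) pinc[of "(a + 5) * b" e] pinc[of a e] by (simp add: e_def)
      also have "\<dots> \<le> 2 * (2 * \<kappa> ^ e)" using p1[of e] by simp
      also have "\<dots> \<le> 2 * \<kappa> ^ Suc e" by (intro mult_left_mono two) auto
      also have "\<dots> \<le> \<kappa> ^ Suc (Suc e)" by (rule two)
      finally have "real n * (real t + 2 * \<kappa> ^ a) \<le> \<kappa> ^ d * \<kappa> ^ Suc (Suc e)"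
        using n_le \<kappa> unfolding d_def by (intro mult_mono) auto
      then have r: "real r \<le> \<kappa> ^ (d + Suc (Suc e))" using H(2) unfolding power_add by linarith
      define m where "m = d + e + 2 + 2 * a"
      have "real (2 * s + r + 1) \<le> 2 * \<kappa> ^ m + \<kappa> ^ m + \<kappa> ^ m"
        using r k(2) p1[of m] pinc[of "2 * a" m] pinc[of "d + Suc (Suc e)" m] by (simp add: m_def)
      also have "\<dots> = 2 * (2 * \<kappa> ^ m)" by simp
      also have "\<dots> \<le> 2 * \<kappa> ^ Suc m" by (intro mult_left_mono two) auto
      also have "\<dots> \<le> \<kappa> ^ Suc (Suc m)" by (rule two)
      also have "\<dots> \<le> \<kappa> ^ E" by (rule pinc) (simp add: m_def d_def e_def E_def)
      finally show ?thesis .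
    qed
    show ?thesis using relu_computable_max[OF k(1) H(1)] sz err by blast
  qed
  show ?thesis
    unfolding value_ok_def W_def[symmetric] using max_le approx by auto
qed

text \<open>The exponent \<open>b\<close> is chosen before \<open>D\<close> and \<kappa>. Having the
  claim for all admissible \<kappa> is what permits the step to use it at \<kappa> and at
  \<kappa>^(a+5) with the same \<open>b\<close>.\<close>

lemma Vaux_value_ok:
  fixes P :: "nat \<Rightarrow> 'a measure"
  assumes tr: "\<And>D \<kappa> n. D \<ge> 1 \<Longrightarrow> \<kappa> \<ge> 2 \<Longrightarrow> real D \<le> \<kappa> \<Longrightarrow> n < N \<Longrightarrow> transition_ok (P D) D (f D n) (\<kappa> ^ a)"
    and ob: "\<And>D \<kappa> n. D \<ge> 1 \<Longrightarrow> \<kappa> \<ge> 2 \<Longrightarrow> real D \<le> \<kappa> \<Longrightarrow> n \<le> N \<Longrightarrow> obstacle_ok D (g D (tgrid T N n)) (\<kappa> ^ a) \<kappa>"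
    and "k \<le> N"
  shows "\<exists>b. \<forall>D \<kappa>. D \<ge> 1 \<longrightarrow> \<kappa> \<ge> 2 \<longrightarrow> real D \<le> \<kappa> \<longrightarrow>
    value_ok D (Vaux (P D) T N (g D) (f D) k) (\<kappa> ^ b) \<kappa>"
  using assms(3)
proof (induction k)
  \<comment> \<open>Reading the assumption on the payoff at \<kappa>^2 squares its accuracy and
    doubles the exponent, which is the form that the step expects.\<close>
  have obs: "obstacle_ok D (g D (tgrid T N n)) (\<kappa> ^ (2 * a)) (\<kappa>\<^sup>2)"
    if "D \<ge> 1" "\<kappa> \<ge> 2" "real D \<le> \<kappa>" "n \<le> N" for D n and \<kappa> :: real
  proof -
    have "\<kappa> \<le> \<kappa>\<^sup>2" using that power_increasing[of 1 2 \<kappa>] by simp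
    then show ?thesis using ob[of D "\<kappa>\<^sup>2" n] that by (simp add: power_mult)
  qed
  {
    case 0
    have "value_ok D (Vaux (P D) T N (g D) (f D) 0) (\<kappa> ^ (2 * a)) \<kappa>"
      if "D \<ge> 1" "\<kappa> \<ge> 2" "real D \<le> \<kappa>" for D and \<kappa> :: real
    proof -
      have "Vaux (P D) T N (g D) (f D) 0 = g D (tgrid T N N)" by (rule ext) simp
      then show ?thesis using value_ok_obstacle[OF obs[OF that order_refl]] that by simp
    qed
    then show ?case by blast
  next
    case (Suc k)
    then obtain b where b: "\<And>D \<kappa>. D \<ge> 1 \<Longrightarrow> \<kappa> \<ge> 2 \<Longrightarrow> real D \<le> \<kappa> \<Longrightarrow>
      value_ok D (Vaux (P D) T N (g D) (f D) k) (\<kappa> ^ b) \<kappa>" by auto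
    have "value_ok D (Vaux (P D) T N (g D) (f D) (Suc k)) (\<kappa> ^ (2 * b + (a + 5) * b + 4 * a + 14)) \<kappa>"
      if "D \<ge> 1" "\<kappa> \<ge> 2" "real D \<le> \<kappa>" for D and \<kappa> :: real
    proof -
      have "\<kappa> \<le> \<kappa> ^ (a + 5)" using that power_increasing[of 1 "a + 5" \<kappa>] by simp
      then have 2: "value_ok D (Vaux (P D) T N (g D) (f D) k) (\<kappa> ^ ((a + 5) * b)) (\<kappa> ^ (a + 5))"
        using b[of D "\<kappa> ^ (a + 5)"] that by (simp add: power_mult)
      have "Vaux (P D) T N (g D) (f D) (Suc k) = (\<lambda>x. max (g D (tgrid T N (N - Suc k)) x)
          (\<integral>\<omega>. Vaux (P D) T N (g D) (f D) k (f D (N - Suc k) x \<omega>) \<partial>P D))" by (rule ext) simp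
      then show ?thesis
        using value_ok_step[OF that(2) tr[OF that, of "N - Suc k"] obs[OF that, of "N - Suc k"] b[OF that] 2] Suc.prems
        by simp
    qed
    then show ?case by blast
  }
qed

section \<open>Polynomial bounds\<close>

text \<open>Asking for \<kappa> \<ge> 2 rather than \<kappa> \<ge> 1 lets a power of \<kappa> absorb
  the constant as well: the absolute value of \<open>c\<close> is at most 2^k, hence at most
  \<kappa>^k.\<close>

lemma poly_le_power:
  fixes c q :: real
  shows "\<exists>b::nat. \<forall>\<kappa>\<ge>2. \<forall>d. 1 \<le> d \<and> d \<le> \<kappa> \<longrightarrow> c * d powr q \<le> \<kappa> ^ b"
proof -
  obtain k where k: "\<bar>c\<bar> \<le> (2::real) ^ k"
    using real_arch_pow[of 2 "\<bar>c\<bar>"] by (auto intro: less_imp_le)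
  obtain l :: nat where l: "q \<le> real l" using real_arch_simple by blast
  have "c * d powr q \<le> \<kappa> ^ (k + l)" if "2 \<le> \<kappa>" "1 \<le> d" "d \<le> \<kappa>" for \<kappa> d :: real
  proof -
    have "d powr q \<le> d powr real l" using that l by (intro powr_mono) auto
    also have "\<dots> \<le> \<kappa> powr real l" using that by (intro powr_mono2) auto
    also have "\<dots> = \<kappa> ^ l" using that by (simp add: powr_realpow)
    finally have 1: "d powr q \<le> \<kappa> ^ l" .
    have "\<bar>c\<bar> \<le> \<kappa> ^ k" using k power_mono[of 2 \<kappa> k] that by linarith
    then have "\<bar>c\<bar> * d powr q \<le> \<kappa> ^ k * \<kappa> ^ l" using 1 that by (intro mult_mono) auto
    moreover have "c * d powr q \<le> \<bar>c\<bar> * d powr q" by (intro mult_right_mono) auto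
    ultimately show ?thesis by (simp add: power_add)
  qed
  then show ?thesis by blast
qed

lemma ennpow_half_le:
  assumes "J \<le> ennreal (\<epsilon>\<^sup>2)" "\<epsilon> > 0"
  shows "ennpow J (1 / 2) \<le> ennreal \<epsilon>"
proof -
  have J: "J \<noteq> \<infinity>" using assms(1) by (auto simp: top_unique)
  have "enn2real J \<le> \<epsilon>\<^sup>2" using enn2real_mono[OF assms(1)] by simp
  then have "enn2real J powr (1 / 2) \<le> (\<epsilon>\<^sup>2) powr (1 / 2)" by (intro powr_mono2) auto
  also have "\<dots> = \<epsilon>" using assms(2) by (simp add: powr_half_sqrt)
  finally show ?thesis using J by (simp add: ennpow_def ennreal_leI)
qed

lemma ennpow_mono_ennreal:
  assumes "ennreal y \<le> G" "0 \<le> y" "0 \<le> p"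
  shows "ennreal (y powr p) \<le> ennpow G p"
proof (cases "G = \<infinity>")
  case False
  then have "y \<le> enn2real G" using enn2real_mono[OF assms(1)] assms(2) by (simp add: less_top)
  then show ?thesis using False assms by (simp add: ennpow_def ennreal_leI powr_mono2)
qed (simp add: ennpow_def)

text \<open>The supremum over all points stands inside the mean and dominates the ratio at the given
  \<open>x\<close> for every \<omega>.\<close>

lemma growth_moment:
  assumes gr: "ennpow (\<integral>\<^sup>+\<omega>. ennpow (growth_vec D D (\<lambda>x. f x \<omega>)) p \<partial>P) (1 / p) \<le> ennreal C"
    and "p > 0" "C \<ge> 0" "x \<in> space (RD D)"
  shows "(\<integral>\<^sup>+\<omega>. ennreal ((vnorm D (f x \<omega>) / (1 + vnorm D x)) powr p) \<partial>P) \<le> ennreal (C powr p)"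
proof -
  define J where "J = (\<integral>\<^sup>+\<omega>. ennpow (growth_vec D D (\<lambda>x. f x \<omega>)) p \<partial>P)"
  have J: "J \<noteq> \<infinity>" using gr unfolding J_def[symmetric] by (auto simp: ennpow_def top_unique)
  then have "enn2real J powr (1 / p) \<le> C"
    using gr assms(3) unfolding J_def[symmetric] by (simp add: ennpow_def)
  then have "(enn2real J powr (1 / p)) powr p \<le> C powr p" using assms(2) by (intro powr_mono2) auto
  then have "enn2real J \<le> C powr p" using assms(2) by (simp add: powr_powr)
  then have "J \<le> ennreal (C powr p)" using J by (metis ennreal_enn2real ennreal_leI infinity_ennreal_def less_top)
  moreover have "(\<integral>\<^sup>+\<omega>. ennreal ((vnorm D (f x \<omega>) / (1 + vnorm D x)) powr p) \<partial>P) \<le> J"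
    unfolding J_def
  proof (intro nn_integral_mono ennpow_mono_ennreal)
    show "ennreal (vnorm D (f x \<omega>) / (1 + vnorm D x)) \<le> growth_vec D D (\<lambda>x. f x \<omega>)" for \<omega>
      unfolding growth_vec_def using assms(4) by (rule SUP_upper2) simp
  qed (use assms(2) in \<open>auto intro!: divide_nonneg_nonneg add_nonneg_nonneg\<close>)
  ultimately show ?thesis by (rule order_trans[rotated])
qed

lemma growth_moment_power:
  assumes "ennpow (\<integral>\<^sup>+\<omega>. ennpow (growth_vec D D (\<lambda>x. f x \<omega>)) p \<partial>P) (1 / p) \<le> ennreal C"
    and "p > 0" "C \<ge> 0" "x \<in> space (RD D)" and [measurable]: "f x \<in> measurable P (RD D)"
  shows "(\<integral>\<^sup>+\<omega>. ennreal (vnorm D (f x \<omega>) powr p) \<partial>P) \<le> ennreal (C powr p) * ennreal ((1 + vnorm D x) powr p)"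
proof -
  have "(\<integral>\<^sup>+\<omega>. ennreal (vnorm D (f x \<omega>) powr p) \<partial>P)
      = (\<integral>\<^sup>+\<omega>. ennreal ((1 + vnorm D x) powr p) * ennreal ((vnorm D (f x \<omega>) / (1 + vnorm D x)) powr p) \<partial>P)"
  proof (rule nn_integral_cong)
    fix \<omega>
    have "1 + vnorm D x > 0" by (simp add: add_pos_nonneg)
    then have "vnorm D (f x \<omega>) powr p = (1 + vnorm D x) powr p * (vnorm D (f x \<omega>) / (1 + vnorm D x)) powr p"
      by (simp add: powr_mult[symmetric])
    then show "ennreal (vnorm D (f x \<omega>) powr p) =
        ennreal ((1 + vnorm D x) powr p) * ennreal ((vnorm D (f x \<omega>) / (1 + vnorm D x)) powr p)"
      by (simp add: ennreal_mult')
  qed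
  also have "\<dots> = ennreal ((1 + vnorm D x) powr p) * (\<integral>\<^sup>+\<omega>. ennreal ((vnorm D (f x \<omega>) / (1 + vnorm D x)) powr p) \<partial>P)"
    by (rule nn_integral_cmult) measurable
  also have "\<dots> \<le> ennreal ((1 + vnorm D x) powr p) * ennreal (C powr p)"
    by (intro mult_left_mono growth_moment[OF assms(1-4)]) auto
  finally show ?thesis by (simp add: mult.commute)
qed

text \<open>For the ratio y = |f(x)| / (1 + |x|), the square of 1 + y is at most 2 + 2 y^2, and y^2
  \<le> 1 + y^p because p > 2. This gives the factor 4 + 2 C^p without an interpolation of
  norms.\<close>

lemma growth_second_moment:
  assumes "prob_space P" "ennpow (\<integral>\<^sup>+\<omega>. ennpow (growth_vec D D (\<lambda>x. f x \<omega>)) p \<partial>P) (1 / p) \<le> ennreal C"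
    and "p > 2" "C \<ge> 0" "x \<in> space (RD D)" and [measurable]: "f x \<in> measurable P (RD D)"
  shows "(\<integral>\<^sup>+\<omega>. ennreal ((1 + vnorm D (f x \<omega>))\<^sup>2) \<partial>P) \<le> ennreal (4 + 2 * C powr p) * ennreal ((1 + vnorm D x)\<^sup>2)"
proof -
  interpret prob_space P by fact
  let ?y = "\<lambda>\<omega>. vnorm D (f x \<omega>) / (1 + vnorm D x)"
  have x1: "1 + vnorm D x \<ge> 1" by simp
  have "(\<integral>\<^sup>+\<omega>. ennreal ((1 + vnorm D (f x \<omega>))\<^sup>2) \<partial>P)
      \<le> (\<integral>\<^sup>+\<omega>. ennreal ((1 + vnorm D x)\<^sup>2) * (4 + 2 * ennreal (?y \<omega> powr p)) \<partial>P)"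
  proof (rule nn_integral_mono)
    fix \<omega>
    have y: "?y \<omega> \<ge> 0" using x1 by (intro divide_nonneg_nonneg) auto
    have y2: "(?y \<omega>)\<^sup>2 \<le> 1 + ?y \<omega> powr p"
    proof (cases "?y \<omega> \<le> 1")
      case True
      then have "(?y \<omega>)\<^sup>2 \<le> 1" using y by (simp add: power_le_one)
      then show ?thesis using powr_ge_zero[of "?y \<omega>" p] by linarith
    next
      case False
      then have "?y \<omega> powr 2 \<le> ?y \<omega> powr p" using assms(3) by (intro powr_mono) auto
      moreover have "?y \<omega> powr 2 = (?y \<omega>)\<^sup>2" using False by (subst powr_numeral) auto
      ultimately show ?thesis by linarith
    qed
    have "1 + vnorm D x \<noteq> 0" using vnorm_nonneg[of D x] by linarith
    then have "(1 + vnorm D x) * ?y \<omega> = vnorm D (f x \<omega>)" by (metis nonzero_mult_div_cancel_left times_divide_eq_right)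
    then have "1 + vnorm D (f x \<omega>) \<le> (1 + vnorm D x) * (1 + ?y \<omega>)"
      unfolding distrib_left by simp
    then have "(1 + vnorm D (f x \<omega>))\<^sup>2 \<le> ((1 + vnorm D x) * (1 + ?y \<omega>))\<^sup>2" by (intro power_mono) auto
    also have "\<dots> = (1 + vnorm D x)\<^sup>2 * (1 + ?y \<omega>)\<^sup>2" by (rule power_mult_distrib)
    also have "\<dots> \<le> (1 + vnorm D x)\<^sup>2 * (4 + 2 * ?y \<omega> powr p)"
    proof (rule mult_left_mono)
      have "0 \<le> (1 - ?y \<omega>)\<^sup>2" by (rule zero_le_power2)
      then have "(1 + ?y \<omega>)\<^sup>2 \<le> 2 + 2 * (?y \<omega>)\<^sup>2" by (simp only: power2_sum power2_diff) simp
      then show "(1 + ?y \<omega>)\<^sup>2 \<le> 4 + 2 * ?y \<omega> powr p" using y2 by linarith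
    qed simp
    finally have "ennreal ((1 + vnorm D (f x \<omega>))\<^sup>2) \<le> ennreal ((1 + vnorm D x)\<^sup>2 * (4 + 2 * ?y \<omega> powr p))"
      by (rule ennreal_leI)
    also have "\<dots> = ennreal ((1 + vnorm D x)\<^sup>2) * (4 + 2 * ennreal (?y \<omega> powr p))"
      by (simp add: ennreal_mult' ennreal_plus)
    finally show "ennreal ((1 + vnorm D (f x \<omega>))\<^sup>2) \<le> ennreal ((1 + vnorm D x)\<^sup>2) * (4 + 2 * ennreal (?y \<omega> powr p))" .
  qed
  also have "\<dots> = ennreal ((1 + vnorm D x)\<^sup>2) * (4 + 2 * (\<integral>\<^sup>+\<omega>. ennreal (?y \<omega> powr p) \<partial>P))"
    by (simp add: nn_integral_cmult nn_integral_add emeasure_space_1)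
  also have "\<dots> \<le> ennreal ((1 + vnorm D x)\<^sup>2) * (4 + 2 * ennreal (C powr p))"
    using growth_moment[OF assms(2) _ assms(4,5)] assms(3) by (intro mult_left_mono add_left_mono) auto
  also have "\<dots> = ennreal (4 + 2 * C powr p) * ennreal ((1 + vnorm D x)\<^sup>2)"
    by (simp add: ennreal_mult' ennreal_plus mult.commute)
  finally show ?thesis .
qed

section \<open>Moments of the process along the dates\<close>

lemma measurable_pair_subalgebra:
  assumes "subalgebra P G" "h \<in> measurable (M \<Otimes>\<^sub>M G) K"
  shows "h \<in> measurable (M \<Otimes>\<^sub>M P) K"
proof -
  have "snd \<in> measurable (M \<Otimes>\<^sub>M P) G"
    using measurable_compose[OF measurable_snd measurable_from_subalg[OF assms(1) measurable_ident]] by simp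
  then have "(\<lambda>z. (fst z, snd z)) \<in> measurable (M \<Otimes>\<^sub>M P) (M \<Otimes>\<^sub>M G)" by (intro measurable_Pair) auto
  from measurable_compose[OF this assms(2)] show ?thesis by simp
qed

text \<open>A finite mean size makes almost every realisation a finite circuit, and circuits are
  continuous. The quantifiers over points and sequences stand inside the almost sure statement, so
  they may later be filled with random points.\<close>

lemma rnn_AE_continuous:
  assumes u: "\<And>i m j. (\<lambda>\<omega>. u \<omega> i m j) \<in> borel_measurable P"
    and rep: "AE \<omega> in P. \<forall>x\<in>space (RD D). f x \<omega> = rnn_fun D D I (u \<omega>) x"
    and size: "(\<integral>\<^sup>+\<omega>. rnn_size (u \<omega>) \<partial>P) \<le> ennreal s"
  shows "AE \<omega> in P. \<forall>y x. x \<in> space (RD D) \<longrightarrow> (\<forall>k. y k \<in> space (RD D)) \<longrightarrow>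
        (\<forall>i<D. (\<lambda>k. y k i) \<longlonglongrightarrow> x i) \<longrightarrow> (\<forall>i<D. (\<lambda>k. f (y k) \<omega> i) \<longlonglongrightarrow> f x \<omega> i)"
proof -
  have "AE \<omega> in P. rnn_size (u \<omega>) \<noteq> \<infinity>"
    using size by (intro nn_integral_PInf_AE rnn_size_measurable u) (auto simp: top_unique)
  with rep show ?thesis
  proof eventually_elim
    case (elim \<omega>)
    obtain k where k: "rnn_size (u \<omega>) = of_nat k" using rnn_size_finite_nat[of "u \<omega>"] elim(2) by (auto simp: less_top)
    obtain fs where fs: "relu_circuit D fs" "length fs \<le> k"
      "\<And>i. i < D \<Longrightarrow> (\<lambda>x. rnn_fun D D I (u \<omega>) x i) \<in> aff_span D (set fs)"
      by (rule rnn_fun_circuit[of "u \<omega>" k D D I]) (use k in auto)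
    show ?case
    proof (intro allI impI)
      fix y x i assume *: "x \<in> space (RD D)" "\<forall>k. y k \<in> space (RD D)" "\<forall>i<D. (\<lambda>k. y k i) \<longlonglongrightarrow> x i" "i < D"
      have "(\<lambda>k. rnn_fun D D I (u \<omega>) (y k) i) \<longlonglongrightarrow> rnn_fun D D I (u \<omega>) x i"
        by (rule aff_span_tendsto[OF fs(3)[OF *(4)], where y = y and x = x])
           (use *(3) relu_circuit_tendsto[OF fs(1), of y x] in auto)
      then show "(\<lambda>k. f (y k) \<omega> i) \<longlonglongrightarrow> f x \<omega> i" using elim(1) * by simp
    qed
  qed
qed

text \<open>The factor 2^p comes from (1 + y)^p \<le> 2^p (1 + y^p), and (1 + D)^p from the additive
  \<open>D\<close> that rounding to a grid leaves in \<open>moment_freezing\<close>. For fixed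
  \<open>p\<close>, a polynomial bound at one date thus passes to the next.\<close>

lemma process_moment_step:
  assumes ps: "prob_space P" and sub: "subalgebra P G" and Z: "Z \<in> measurable G (RD D)"
    and f: "(\<lambda>(x, \<omega>). f x \<omega>) \<in> measurable (RD D \<Otimes>\<^sub>M P) (RD D)"
    and ind: "\<And>x. x \<in> space (RD D) \<Longrightarrow> indep_of P G (f x) (RD D)"
    and X: "AE \<omega> in P. X \<omega> = f (Z \<omega>) \<omega>"
    and gr: "ennpow (\<integral>\<^sup>+\<omega>. ennpow (growth_vec D D (\<lambda>x. f x \<omega>)) p \<partial>P) (1 / p) \<le> ennreal C"
    and u: "\<And>i m j. (\<lambda>\<omega>. u \<omega> i m j) \<in> borel_measurable P"
    and rep: "AE \<omega> in P. \<forall>x\<in>space (RD D). f x \<omega> = rnn_fun D D I (u \<omega>) x"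
    and size: "(\<integral>\<^sup>+\<omega>. rnn_size (u \<omega>) \<partial>P) \<le> ennreal s"
    and p: "p > 0" and C: "C \<ge> 0"
    and Z_mom: "(\<integral>\<^sup>+\<omega>. ennreal ((1 + vnorm D (Z \<omega>)) powr p) \<partial>P) \<le> ennreal m" and m: "m \<ge> 0"
  shows "(\<integral>\<^sup>+\<omega>. ennreal ((1 + vnorm D (X \<omega>)) powr p) \<partial>P)
    \<le> ennreal (2 powr p * (1 + C powr p * ((1 + real D) powr p * m)))"
proof -
  interpret prob_space P by fact
  note [measurable] = f measurable_from_subalg[OF sub Z]
  have fx: "f x \<in> measurable P (RD D)" if "x \<in> space (RD D)" for x
    using measurable_compose[OF measurable_Pair1'[OF that] f] by simp
  have "(\<integral>\<^sup>+\<omega>. ennreal ((1 + vnorm D (X \<omega>)) powr p) \<partial>P)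
      \<le> (\<integral>\<^sup>+\<omega>. ennreal (2 powr p) * (1 + ennreal (vnorm D (f (Z \<omega>) \<omega>) powr p)) \<partial>P)"
  proof (rule nn_integral_mono_AE)
    show "AE \<omega> in P. ennreal ((1 + vnorm D (X \<omega>)) powr p) \<le> ennreal (2 powr p) * (1 + ennreal (vnorm D (f (Z \<omega>) \<omega>) powr p))"
      using X
    proof eventually_elim
      case (elim \<omega>)
      let ?y = "vnorm D (X \<omega>)"
      have "(1 + ?y) powr p \<le> (2 * max 1 ?y) powr p" using p by (intro powr_mono2) auto
      also have "\<dots> = 2 powr p * (max 1 ?y) powr p" by (rule powr_mult)
      also have "\<dots> \<le> 2 powr p * (1 + ?y powr p)"
        by (intro mult_left_mono) (auto simp: max_def)
      finally have "ennreal ((1 + ?y) powr p) \<le> ennreal (2 powr p * (1 + ?y powr p))" by (rule ennreal_leI)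
      then show ?case unfolding elim by (simp add: ennreal_mult' ennreal_plus)
    qed
  qed
  also have "\<dots> = ennreal (2 powr p) * (1 + (\<integral>\<^sup>+\<omega>. ennreal (vnorm D (f (Z \<omega>) \<omega>) powr p) \<partial>P))"
    by (simp add: nn_integral_cmult nn_integral_add emeasure_space_1)
  also have "(\<integral>\<^sup>+\<omega>. ennreal (vnorm D (f (Z \<omega>) \<omega>) powr p) \<partial>P)
      \<le> ennreal (C powr p) * (\<integral>\<^sup>+\<omega>. ennreal ((1 + real D + vnorm D (Z \<omega>)) powr p) \<partial>P)"
    by (rule moment_freezing[OF ps sub Z f ind rnn_AE_continuous[OF u rep size] growth_moment_power[OF gr p C _ fx] p])
  also have "(\<integral>\<^sup>+\<omega>. ennreal ((1 + real D + vnorm D (Z \<omega>)) powr p) \<partial>P)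
      \<le> (\<integral>\<^sup>+\<omega>. ennreal ((1 + real D) powr p) * ennreal ((1 + vnorm D (Z \<omega>)) powr p) \<partial>P)"
  proof (rule nn_integral_mono)
    fix \<omega>
    have "(1 + real D + vnorm D (Z \<omega>)) powr p \<le> ((1 + real D) * (1 + vnorm D (Z \<omega>))) powr p"
      using p by (intro powr_mono2) (auto simp: algebra_simps)
    also have "\<dots> = (1 + real D) powr p * (1 + vnorm D (Z \<omega>)) powr p" by (rule powr_mult)
    finally show "ennreal ((1 + real D + vnorm D (Z \<omega>)) powr p)
        \<le> ennreal ((1 + real D) powr p) * ennreal ((1 + vnorm D (Z \<omega>)) powr p)"
      by (simp add: ennreal_mult'[symmetric] ennreal_leI)
  qed
  also have "\<dots> = ennreal ((1 + real D) powr p) * (\<integral>\<^sup>+\<omega>. ennreal ((1 + vnorm D (Z \<omega>)) powr p) \<partial>P)"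
    by (rule nn_integral_cmult) measurable
  also note Z_mom
  finally have "(\<integral>\<^sup>+\<omega>. ennreal ((1 + vnorm D (X \<omega>)) powr p) \<partial>P)
    \<le> ennreal (2 powr p) * (1 + ennreal (C powr p) * (ennreal ((1 + real D) powr p) * ennreal m))"
    by (simp add: mult_left_mono add_left_mono)
  also have "\<dots> = ennreal (2 powr p * (1 + C powr p * ((1 + real D) powr p * m)))"
    using m by (simp add: ennreal_mult' ennreal_plus)
  finally show ?thesis .
qed

section \<open>Payoff approximation and clipping\<close>

lemma vnorm_vzero [simp]: "vnorm D (vzero D) = 0"
  by (simp add: vnorm_def vzero_def L2_set_def)

text \<open>Points of \<open>RD D\<close> are extensional, so vanishing norm means equality with
  \<open>vzero D\<close>. Away from that point the quotient in \<open>lip\<close> has a positive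
  denominator and can be cleared.\<close>

lemma lip_vnorm_le:
  assumes "lip D h \<le> ennreal C" "C \<ge> 0" "x \<in> space (RD D)"
  shows "\<bar>h x - h (vzero D)\<bar> \<le> C * vnorm D x"
proof (cases "x = vzero D")
  case False
  have z: "vzero D \<in> space (RD D)" by (simp add: space_RD vzero_def)
  have "vdiff D x (vzero D) = x"
    using assms(3) unfolding space_RD vdiff_def vzero_def by (intro ext) (auto simp: extensional_def)
  then have "ennreal (\<bar>h x - h (vzero D)\<bar> / vnorm D x) \<le> lip D h"
    unfolding lip_def using False assms(3) z by (intro SUP_upper2[of "(x, vzero D)"]) auto
  then have le: "\<bar>h x - h (vzero D)\<bar> / vnorm D x \<le> C"
    using assms(1,2) by (meson ennreal_le_iff order_trans)
  have "vnorm D x \<noteq> 0"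
  proof
    assume "vnorm D x = 0"
    then have "\<forall>i<D. x i = 0" unfolding vnorm_def by (subst (asm) L2_set_eq_0_iff) auto
    then have "x = vzero D" using assms(3) unfolding space_RD vzero_def by (intro ext) (auto simp: extensional_def)
    with False show False by simp
  qed
  then have "vnorm D x > 0" using vnorm_nonneg[of D x] by linarith
  with le show ?thesis by (simp add: pos_divide_le_eq)
qed (use assms in auto)

text \<open>Measurability of \<open>g\<close> is obtained from its being a pointwise limit of
  networks. Its linear growth comes from the network at accuracy 1: two approximation errors, at x
  and at zero, the Lipschitz bound between these points and the value at zero add up to the constant
  4 C.\<close>

lemma obstacle_ok_of_nn:
  assumes nn: "\<And>\<epsilon>. \<epsilon> > 0 \<Longrightarrow> \<exists>L. nn_wf D 1 L \<and>
      (\<forall>x\<in>space (RD D). \<bar>nn_real D L x - g x\<bar> \<le> \<epsilon> * C * (1 + vnorm D x)) \<and>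
      real (nn_size L) \<le> C * \<epsilon> powr (- r) \<and> lip D (nn_real D L) \<le> ennreal C \<and> \<bar>g (vzero D)\<bar> \<le> C"
    and C: "C > 0" and \<kappa>: "\<kappa> > 0" and B: "4 * C \<le> B" "C * (\<kappa> * C) powr r \<le> B"
  shows "obstacle_ok D g B \<kappa>"
  unfolding obstacle_ok_def
proof (intro conjI ballI)
  obtain Ls where Ls: "\<And>j::nat. nn_wf D 1 (Ls j)"
    "\<And>j x. x \<in> space (RD D) \<Longrightarrow> \<bar>nn_real D (Ls j) x - g x\<bar> \<le> inverse (real (Suc j)) * C * (1 + vnorm D x)"
  proof -
    have "\<forall>j::nat. \<exists>L. nn_wf D 1 L \<and> (\<forall>x\<in>space (RD D). \<bar>nn_real D L x - g x\<bar> \<le> inverse (real (Suc j)) * C * (1 + vnorm D x))"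
    proof
      fix j :: nat
      have "inverse (real (Suc j)) > 0" by simp
      from nn[OF this] show "\<exists>L. nn_wf D 1 L \<and> (\<forall>x\<in>space (RD D). \<bar>nn_real D L x - g x\<bar> \<le> inverse (real (Suc j)) * C * (1 + vnorm D x))"
        by blast
    qed
    then show ?thesis using that by (metis (no_types, lifting))
  qed
  show "g \<in> borel_measurable (RD D)"
  proof (rule borel_measurable_LIMSEQ_real)
    show "nn_real D (Ls j) \<in> borel_measurable (RD D)" for j
      using Ls(1) by (rule relu_computable_measurable[OF nn_real_computable])
    fix x assume x: "x \<in> space (RD D)"
    have "(\<lambda>j. inverse (real (Suc j)) * (C * (1 + vnorm D x))) \<longlonglongrightarrow> 0"
      by (rule tendsto_mult_left_zero[OF LIMSEQ_inverse_real_of_nat])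
    then have "(\<lambda>j. nn_real D (Ls j) x - g x) \<longlonglongrightarrow> 0"
      by (rule Lim_null_comparison[rotated]) (use Ls(2)[OF x] in \<open>auto simp: mult.assoc\<close>)
    then show "(\<lambda>j. nn_real D (Ls j) x) \<longlonglongrightarrow> g x" by (rule LIM_zero_cancel)
  qed
next
  fix x assume x: "x \<in> space (RD D)"
  have z: "vzero D \<in> space (RD D)" by (simp add: space_RD vzero_def)
  obtain L where L: "\<And>x. x \<in> space (RD D) \<Longrightarrow> \<bar>nn_real D L x - g x\<bar> \<le> C * (1 + vnorm D x)"
    "lip D (nn_real D L) \<le> ennreal C" "\<bar>g (vzero D)\<bar> \<le> C"
    using nn[of 1] by auto
  have "\<bar>g x\<bar> \<le> C * (1 + vnorm D x) + C * vnorm D x + C + C"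
    using L(1)[OF x] L(1)[OF z] L(3) lip_vnorm_le[OF L(2) _ x] C by simp
  also have "\<dots> \<le> 4 * C * (1 + vnorm D x)"
    using C vnorm_nonneg[of D x] by (simp add: algebra_simps)
  also have "\<dots> \<le> B * (1 + vnorm D x)" by (intro mult_right_mono B) auto
  finally show "\<bar>g x\<bar> \<le> B * (1 + vnorm D x)" .
next
  \<comment> \<open>With this accuracy the factor \<open>C\<close> in the error bound cancels and
    leaves exactly 1/\<kappa>, while the size bound becomes C (\<kappa> C)^r.\<close>
  have e: "1 / (\<kappa> * C) > 0" using C \<kappa> by simp
  obtain L where L: "nn_wf D 1 L" "\<forall>x\<in>space (RD D). \<bar>nn_real D L x - g x\<bar> \<le> 1 / (\<kappa> * C) * C * (1 + vnorm D x)"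
      "real (nn_size L) \<le> C * (1 / (\<kappa> * C)) powr (- r)"
    using nn[OF e] by blast
  have "(1 / (\<kappa> * C)) powr (- r) = (\<kappa> * C) powr r"
    using e by (simp add: powr_divide powr_minus inverse_eq_divide)
  then have "real (nn_size L) \<le> B" using L(3) B(2) by simp
  moreover have "\<forall>x\<in>space (RD D). \<bar>g x - nn_real D L x\<bar> \<le> 1 / \<kappa> * (1 + vnorm D x)"
    using L(2) C by (simp add: abs_minus_commute)
  ultimately show "\<exists>s h. relu_computable D s h \<and> real s \<le> B \<and>
        (\<forall>x\<in>space (RD D). \<bar>g x - h x\<bar> \<le> 1 / \<kappa> * (1 + vnorm D x))"
    using nn_real_computable[OF L(1)] by blast
qed

text \<open>Clipping at a multiple of \<open>1 + \<Sum>\<^sub>i \<bar>x\<^sub>i\<bar>\<close>, which is itself a small network, bounds the growth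
  without any information about the growth of the sampled transitions.\<close>

lemma relu_computable_clip:
  assumes h: "relu_computable D s h" and D: "D \<ge> 1" and K: "K \<ge> 0"
    and V: "\<And>x. x \<in> space (RD D) \<Longrightarrow> \<bar>V x\<bar> \<le> K * (1 + vnorm D x)"
  shows "\<exists>h'. relu_computable D (2 * s + 6 * D + 2) h' \<and> growth D h' \<le> ennreal (K * real D) \<and>
    (\<forall>x\<in>space (RD D). \<bar>V x - h' x\<bar> \<le> \<bar>V x - h x\<bar>)"
proof -
  define \<beta> where "\<beta> x = K * (1 + (\<Sum>i<D. relu (x i) + relu (-1 * x i)))" for x :: "nat \<Rightarrow> real"
  have abs: "relu a + relu (-1 * a) = \<bar>a\<bar>" for a by (auto simp: relu_def max_def)
  have "relu_computable D (\<Sum>i<D. Suc 0 + Suc 0) (\<lambda>x. \<Sum>i<D. relu (x i) + relu (-1 * x i))" (is "relu_computable D _ ?\<sigma>")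
    by (intro relu_computable_sum relu_computable_add relu_computable_relu relu_computable_scale relu_computable_coord) auto
  moreover have "(\<Sum>i<D. Suc 0 + Suc 0) = 2 * D" by simp
  ultimately have \<sigma>: "relu_computable D (2 * D) ?\<sigma>" by (simp only:)
  have "relu_computable D (0 + 2 * D) \<beta>"
    unfolding \<beta>_def by (intro relu_computable_scale relu_computable_add relu_computable_const \<sigma>)
  then have \<beta>: "relu_computable D (2 * D) \<beta>" by simp
  define h' where "h' x = max (-1 * \<beta> x) (min (h x) (\<beta> x))" for x
  have "relu_computable D (2 * (2 * D) + (2 * s + 2 * D + 1) + 1) h'"
    unfolding h'_def by (intro relu_computable_max relu_computable_min relu_computable_scale \<beta> h)
  moreover have "2 * (2 * D) + (2 * s + 2 * D + 1) + 1 = 2 * s + 6 * D + 2" by simp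
  ultimately have 1: "relu_computable D (2 * s + 6 * D + 2) h'" by (simp only:)
  have \<beta>_ge: "K * (1 + vnorm D x) \<le> \<beta> x" for x
    unfolding \<beta>_def abs vnorm_def using K L2_set_le_sum_abs[of x "{..<D}"] by (intro mult_left_mono) auto
  have \<beta>_le: "\<beta> x \<le> K * real D * (1 + vnorm D x)" for x
  proof -
    have "\<bar>x i\<bar> \<le> vnorm D x" if "i < D" for i
      using member_le_L2_set[of "{..<D}" i "\<lambda>i. \<bar>x i\<bar>"] that by (simp add: vnorm_def L2_set_def)
    then have "(\<Sum>i<D. \<bar>x i\<bar>) \<le> (\<Sum>i<D. vnorm D x)" by (intro sum_mono) auto
    then have "1 + (\<Sum>i<D. \<bar>x i\<bar>) \<le> real D * (1 + vnorm D x)" using D by (simp add: distrib_left)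
    then show ?thesis unfolding \<beta>_def abs using K by (simp add: mult_left_mono mult.assoc)
  qed
  have \<beta>0: "0 \<le> \<beta> x" for x
  proof -
    have "0 \<le> K * (1 + vnorm D x)" using K by simp
    then show ?thesis using \<beta>_ge[of x] by linarith
  qed
  have 2: "growth D h' \<le> ennreal (K * real D)"
    unfolding growth_def
  proof (intro SUP_least ennreal_leI)
    fix x
    have "\<bar>h' x\<bar> \<le> \<beta> x" unfolding h'_def using \<beta>0[of x] by (auto simp: max_def min_def)
    also note \<beta>_le
    finally have "\<bar>h' x\<bar> \<le> K * real D * (1 + vnorm D x)" .
    moreover have "1 + vnorm D x > 0" by (simp add: add_pos_nonneg)
    ultimately show "\<bar>h' x\<bar> / (1 + vnorm D x) \<le> K * real D" by (simp add: pos_divide_le_eq)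
  qed
  \<comment> \<open>V x lies between -\<beta> x and \<beta> x, and projecting h x onto this interval
    cannot move it away from a point of the interval.\<close>
  have "\<bar>V x - h' x\<bar> \<le> \<bar>V x - h x\<bar>" if "x \<in> space (RD D)" for x
    using V[OF that] \<beta>_ge[of x] unfolding h'_def by (auto simp: max_def min_def)
  with 1 2 show ?thesis by blast
qed

text \<open>For large \<epsilon> the permitted size falls below 1, so only a network without nonzero
  parameters is admissible.\<close>

lemma zero_network:
  "\<exists>L. nn_wf D 1 L \<and> nn_size L = 0 \<and> nn_real D L = (\<lambda>x. 0)"
proof (intro exI conjI)
  let ?L = "[([replicate D (0::real)], [0::real])]"
  show "nn_wf D 1 ?L" by (simp add: nn_wf_def)
  show "nn_size ?L = 0" by (simp add: nn_size_def)
  show "nn_real D ?L = (\<lambda>x. 0)"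
    by (rule ext) (simp add: nn_real_def affine_conv_zip sum_list_map2_zero)
qed

section \<open>Collecting the exponents and choosing \<kappa>\<close>

theorem theorem6:
  fixes T :: real and N :: nat
    and P :: "nat \<Rightarrow> 'a measure"
    and F :: "nat \<Rightarrow> real \<Rightarrow> 'a measure"
    and W :: "nat \<Rightarrow> real \<Rightarrow> 'a \<Rightarrow> nat \<Rightarrow> real"
    and X :: "nat \<Rightarrow> real \<Rightarrow> 'a \<Rightarrow> nat \<Rightarrow> real"
    and x0 :: "nat \<Rightarrow> nat \<Rightarrow> real"
    and f :: "nat \<Rightarrow> nat \<Rightarrow> (nat \<Rightarrow> real) \<Rightarrow> 'a \<Rightarrow> (nat \<Rightarrow> real)"
    and g :: "nat \<Rightarrow> real \<Rightarrow> (nat \<Rightarrow> real) \<Rightarrow> real"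
  assumes T_pos: "T > 0" and N_pos: "N \<ge> 1"
    and setting: "\<And>D. D \<ge> 1 \<Longrightarrow>
        prob_space (P D) \<and> is_filtration (P D) T (F D) \<and> is_BM (P D) T (F D) D (W D) \<and>
        (\<forall>t\<in>{0..T}. X D t \<in> measurable (F D t) (RD D)) \<and>
        x0 D \<in> space (RD D) \<and> (\<forall>\<omega>\<in>space (P D). X D 0 \<omega> = x0 D)"
    and C3: "\<exists>p>2. \<exists>c>0. \<exists>q>0. \<forall>D\<ge>1.
        markov_dis (P D) T N (F D) D (X D) \<and>
        vnorm D (x0 D) \<le> c * real D powr q \<and>
        (\<forall>n<N.
          (\<lambda>(x,\<omega>). f D n x \<omega>) \<in> measurable (RD D \<Otimes>\<^sub>M F D (tgrid T N (Suc n))) (RD D) \<and>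
          (AE \<omega> in P D. X D (tgrid T N (Suc n)) \<omega> = f D n (X D (tgrid T N n) \<omega>) \<omega>) \<and>
          (\<forall>x\<in>space (RD D). indep_of (P D) (F D (tgrid T N n)) (f D n x) (RD D)) \<and>
          (\<forall>i<D. AE \<omega> in P D.
              real_cond_exp (P D) (F D (tgrid T N n)) (\<lambda>\<omega>. X D (tgrid T N (Suc n)) \<omega> i) \<omega>
                = real_cond_exp (P D) (gen_alg (P D) (X D (tgrid T N n)) (RD D))
                    (\<lambda>\<omega>. X D (tgrid T N (Suc n)) \<omega> i) \<omega>
              \<and> real_cond_exp (P D) (gen_alg (P D) (X D (tgrid T N n)) (RD D))
                    (\<lambda>\<omega>. X D (tgrid T N (Suc n)) \<omega> i) \<omega>
                = (\<integral>\<omega>'. f D n (X D (tgrid T N n) \<omega>) \<omega>' i \<partial>P D)) \<and>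
          ennpow (\<integral>\<^sup>+\<omega>. ennpow (growth_vec D D (\<lambda>x. f D n x \<omega>)) p \<partial>P D) (1 / p)
              \<le> ennreal (c * real D powr q) \<and>
          (\<exists>I u. real I \<le> c * real D powr q \<and>
             (\<forall>i m j. (\<lambda>\<omega>. u \<omega> i m j) \<in> borel_measurable (P D)) \<and>
             (AE \<omega> in P D. rnn_param D D I (u \<omega>) \<and>
                 (\<forall>x\<in>space (RD D). f D n x \<omega> = rnn_fun D D I (u \<omega>) x)) \<and>
             (\<integral>\<^sup>+\<omega>. rnn_size (u \<omega>) \<partial>P D) \<le> ennreal (c * real D powr q)))"
    and C5: "\<exists>c>0. \<exists>q>0. \<exists>r>0. \<forall>D\<ge>1. \<forall>\<epsilon>>0. \<forall>n\<le>N.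
        \<exists>L. nn_wf D 1 L \<and>
          (\<forall>x\<in>space (RD D). \<bar>nn_real D L x - g D (tgrid T N n) x\<bar>
                                \<le> \<epsilon> * c * real D powr q * (1 + vnorm D x)) \<and>
          real (nn_size L) \<le> c * real D powr q * \<epsilon> powr (- r) \<and>
          lip D (nn_real D L) \<le> ennreal (c * real D powr q) \<and>
          \<bar>g D (tgrid T N n) (vzero D)\<bar> \<le> c * real D powr q"
  shows "\<forall>n<N. \<exists>c' q' \<tau>. c' \<ge> 1 \<and> q' \<ge> 1 \<and> \<tau> \<ge> 1 \<and>
          (\<forall>D\<ge>1. \<forall>\<epsilon>>0. \<forall>N0\<ge>1. \<exists>L. nn_wf D 1 L \<and>
             ennpow (\<integral>\<^sup>+z. ennreal ((Vfun (P D) T N (g D) (f D) (Suc n) z - nn_real D L z)\<^sup>2)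
                        \<partial>rho_tilde (P D) T N D (W D) (X D) N0 n) (1 / 2) \<le> ennreal \<epsilon> \<and>
             real (nn_size L) \<le> c' * real D powr q' * \<epsilon> powr (- \<tau>) \<and>
             growth D (nn_real D L) \<le> ennreal (c' * real D powr q' * \<epsilon> powr (- \<tau>)))"
proof (intro allI impI)
  fix n assume n: "n < N"
  obtain p c q where p: "p > 2" and c: "c > 0" and q: "q > 0" and C3': "\<forall>D\<ge>1.
        markov_dis (P D) T N (F D) D (X D) \<and>
        vnorm D (x0 D) \<le> c * real D powr q \<and>
        (\<forall>n<N.
          (\<lambda>(x,\<omega>). f D n x \<omega>) \<in> measurable (RD D \<Otimes>\<^sub>M F D (tgrid T N (Suc n))) (RD D) \<and>
          (AE \<omega> in P D. X D (tgrid T N (Suc n)) \<omega> = f D n (X D (tgrid T N n) \<omega>) \<omega>) \<and>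
          (\<forall>x\<in>space (RD D). indep_of (P D) (F D (tgrid T N n)) (f D n x) (RD D)) \<and>
          (\<forall>i<D. AE \<omega> in P D.
              real_cond_exp (P D) (F D (tgrid T N n)) (\<lambda>\<omega>. X D (tgrid T N (Suc n)) \<omega> i) \<omega>
                = real_cond_exp (P D) (gen_alg (P D) (X D (tgrid T N n)) (RD D))
                    (\<lambda>\<omega>. X D (tgrid T N (Suc n)) \<omega> i) \<omega>
              \<and> real_cond_exp (P D) (gen_alg (P D) (X D (tgrid T N n)) (RD D))
                    (\<lambda>\<omega>. X D (tgrid T N (Suc n)) \<omega> i) \<omega>
                = (\<integral>\<omega>'. f D n (X D (tgrid T N n) \<omega>) \<omega>' i \<partial>P D)) \<and>
          ennpow (\<integral>\<^sup>+\<omega>. ennpow (growth_vec D D (\<lambda>x. f D n x \<omega>)) p \<partial>P D) (1 / p)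
              \<le> ennreal (c * real D powr q) \<and>
          (\<exists>I u. real I \<le> c * real D powr q \<and>
             (\<forall>i m j. (\<lambda>\<omega>. u \<omega> i m j) \<in> borel_measurable (P D)) \<and>
             (AE \<omega> in P D. rnn_param D D I (u \<omega>) \<and>
                 (\<forall>x\<in>space (RD D). f D n x \<omega> = rnn_fun D D I (u \<omega>) x)) \<and>
             (\<integral>\<^sup>+\<omega>. rnn_size (u \<omega>) \<partial>P D) \<le> ennreal (c * real D powr q)))"
    using C3 by blast
  obtain c2 q2 r where c2: "c2 > 0" and r: "r > 0" and C5': "\<forall>D\<ge>1. \<forall>\<epsilon>>0. \<forall>n\<le>N.
        \<exists>L. nn_wf D 1 L \<and>
          (\<forall>x\<in>space (RD D). \<bar>nn_real D L x - g D (tgrid T N n) x\<bar>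
                                \<le> \<epsilon> * c2 * real D powr q2 * (1 + vnorm D x)) \<and>
          real (nn_size L) \<le> c2 * real D powr q2 * \<epsilon> powr (- r) \<and>
          lip D (nn_real D L) \<le> ennreal (c2 * real D powr q2) \<and>
          \<bar>g D (tgrid T N n) (vzero D)\<bar> \<le> c2 * real D powr q2"
    using C5 by blast
  have ps: "prob_space (P D)" and fil: "is_filtration (P D) T (F D)" and BM: "is_BM (P D) T (F D) D (W D)"
    and XF: "\<And>t. t \<in> {0..T} \<Longrightarrow> X D t \<in> measurable (F D t) (RD D)"
    and X0: "\<And>\<omega>. \<omega> \<in> space (P D) \<Longrightarrow> X D 0 \<omega> = x0 D" if "D \<ge> 1" for D
    using setting[OF that] by auto
  have x0_le: "vnorm D (x0 D) \<le> c * real D powr q" if "D \<ge> 1" for D using C3' that by blast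
  have f0: "(\<lambda>(x,\<omega>). f D k x \<omega>) \<in> measurable (RD D \<Otimes>\<^sub>M F D (tgrid T N (Suc k))) (RD D)"
    and Xf: "AE \<omega> in P D. X D (tgrid T N (Suc k)) \<omega> = f D k (X D (tgrid T N k) \<omega>) \<omega>"
    and ind: "\<And>x. x \<in> space (RD D) \<Longrightarrow> indep_of (P D) (F D (tgrid T N k)) (f D k x) (RD D)"
    and gr: "ennpow (\<integral>\<^sup>+\<omega>. ennpow (growth_vec D D (\<lambda>x. f D k x \<omega>)) p \<partial>P D) (1 / p) \<le> ennreal (c * real D powr q)"
    if "D \<ge> 1" "k < N" for D k
    using C3' that by blast+
  have rnn: "\<exists>I u. (\<forall>i m j. (\<lambda>\<omega>. u \<omega> i m j) \<in> borel_measurable (P D)) \<and>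
       (AE \<omega> in P D. \<forall>x\<in>space (RD D). f D k x \<omega> = rnn_fun D D I (u \<omega>) x) \<and>
       (\<integral>\<^sup>+\<omega>. rnn_size (u \<omega>) \<partial>P D) \<le> ennreal (c * real D powr q)"
    if Dk: "D \<ge> 1" "k < N" for D k
  proof -
    obtain I u where "\<forall>i m j. (\<lambda>\<omega>. u \<omega> i m j) \<in> borel_measurable (P D)"
      and rep: "AE \<omega> in P D. rnn_param D D I (u \<omega>) \<and> (\<forall>x\<in>space (RD D). f D k x \<omega> = rnn_fun D D I (u \<omega>) x)"
      and "(\<integral>\<^sup>+\<omega>. rnn_size (u \<omega>) \<partial>P D) \<le> ennreal (c * real D powr q)"
      using C3' Dk by blast
    moreover have "AE \<omega> in P D. \<forall>x\<in>space (RD D). f D k x \<omega> = rnn_fun D D I (u \<omega>) x"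
      using rep by eventually_elim simp
    ultimately show ?thesis by blast
  qed
  have tg: "tgrid T N k \<in> {0..T}" if "k \<le> N" for k
  proof -
    have "real k * T / real N \<le> real N * T / real N" using that T_pos by (intro divide_right_mono mult_right_mono) auto
    then show ?thesis using T_pos N_pos by (simp add: tgrid_def)
  qed
  have sub: "subalgebra (P D) (F D (tgrid T N k))" if "D \<ge> 1" "k \<le> N" for D k
    using fil[OF that(1)] tg[OF that(2)] by (auto simp: is_filtration_def)
  have fP: "(\<lambda>(x,\<omega>). f D k x \<omega>) \<in> measurable (RD D \<Otimes>\<^sub>M P D) (RD D)" if "D \<ge> 1" "k < N" for D k
    using measurable_pair_subalgebra[OF sub f0] that by simp
  have XP: "X D (tgrid T N k) \<in> measurable (P D) (RD D)" if "D \<ge> 1" "k \<le> N" for D k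
    using measurable_from_subalg[OF sub[OF that] XF[OF that(1) tg[OF that(2)]]] .

  obtain mp :: nat where mp: "p \<le> real mp" using real_arch_simple by blast
  obtain l :: nat where l: "r \<le> real l" using real_arch_simple by blast
  have pow_le: "y powr s \<le> \<kappa> ^ (i * k)" if "0 \<le> y" "y \<le> \<kappa> ^ i" "\<kappa> \<ge> 2" "0 \<le> s" "s \<le> real k" for y \<kappa> s :: real and i k
  proof -
    have 1: "1 \<le> \<kappa> ^ i" using that by (intro one_le_power) auto
    have "y powr s \<le> (\<kappa> ^ i) powr s" using that by (intro powr_mono2) auto
    also have "\<dots> \<le> (\<kappa> ^ i) powr real k" using that 1 by (intro powr_mono) auto
    also have "\<dots> = \<kappa> ^ (i * k)" using 1 by (subst powr_realpow) (auto simp: power_mult)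
    finally show ?thesis .
  qed
  have pinc: "\<kappa> ^ i \<le> \<kappa> ^ j" if "\<kappa> \<ge> 2" "i \<le> j" for i j and \<kappa> :: real using that by (intro power_increasing) auto
  have p1: "1 \<le> \<kappa> ^ i" if "\<kappa> \<ge> 2" for i and \<kappa> :: real using that by (intro one_le_power) auto
  have four: "4 * \<kappa> ^ i \<le> \<kappa> ^ (i + 2)" if "\<kappa> \<ge> 2" for i and \<kappa> :: real
  proof -
    have "2\<^sup>2 \<le> \<kappa>\<^sup>2" using that by (intro power_mono) auto
    then have "4 * \<kappa> ^ i \<le> \<kappa>\<^sup>2 * \<kappa> ^ i" using that by (intro mult_right_mono) auto
    then show ?thesis unfolding power_add by (simp only: mult.commute)
  qed
  obtain b1 where b1: "\<And>\<kappa> D. \<kappa> \<ge> 2 \<Longrightarrow> D \<ge> 1 \<Longrightarrow> real D \<le> \<kappa> \<Longrightarrow> c * real D powr q \<le> \<kappa> ^ b1"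
    using poly_le_power[of c q] by (metis of_nat_1 of_nat_le_iff)
  obtain b3 where b3: "\<And>\<kappa> D. \<kappa> \<ge> 2 \<Longrightarrow> D \<ge> 1 \<Longrightarrow> real D \<le> \<kappa> \<Longrightarrow> c2 * real D powr q2 \<le> \<kappa> ^ b3"
    using poly_le_power[of c2 q2] by (metis of_nat_1 of_nat_le_iff)

  \<comment> \<open>One exponent for four bounds: the mean size of the transition, its second moment
    factor, the growth of the payoff and the size of its network, in this order.\<close>
  define a where "a = b1 + (b1 * mp + 4) + (b3 + 2) + (b3 + (b3 + 1) * l)"
  have tr: "transition_ok (P D) D (f D k) (\<kappa> ^ a)" if D: "D \<ge> 1" and \<kappa>: "\<kappa> \<ge> 2" "real D \<le> \<kappa>" and k: "k < N" for D \<kappa> k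
  proof -
    let ?C = "c * real D powr q"
    have C0: "?C \<ge> 0" using c by simp
    have "?C powr p \<le> \<kappa> ^ (b1 * mp)" using pow_le[OF C0 b1[OF \<kappa>(1) D \<kappa>(2)] \<kappa>(1) _ mp] p by simp
    then have "4 + 2 * ?C powr p \<le> 4 * (4 * \<kappa> ^ (b1 * mp))" using p1[OF \<kappa>(1), of "b1 * mp"] by linarith
    also have "\<dots> \<le> 4 * \<kappa> ^ (b1 * mp + 2)" using four[OF \<kappa>(1)] by (intro mult_left_mono) auto
    also have "\<dots> \<le> \<kappa> ^ (b1 * mp + 2 + 2)" by (rule four[OF \<kappa>(1)])
    also have "\<dots> \<le> \<kappa> ^ a" by (rule pinc[OF \<kappa>(1)]) (simp add: a_def)
    finally have A: "4 + 2 * ?C powr p \<le> \<kappa> ^ a" .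
    have "?C \<le> \<kappa> ^ a" using b1[OF \<kappa>(1) D \<kappa>(2)] pinc[OF \<kappa>(1), of b1 a] by (simp add: a_def)
    then have sz: "ennreal ?C \<le> ennreal (\<kappa> ^ a)" by (rule ennreal_leI)
    have mom: "(\<integral>\<^sup>+\<omega>. ennreal ((1 + vnorm D (f D k x \<omega>))\<^sup>2) \<partial>P D) \<le> ennreal (\<kappa> ^ a) * ennreal ((1 + vnorm D x)\<^sup>2)"
      if x: "x \<in> space (RD D)" for x
    proof -
      have fx: "f D k x \<in> measurable (P D) (RD D)"
        using measurable_compose[OF measurable_Pair1'[OF x] fP[OF D k]] by simp
      have "(\<integral>\<^sup>+\<omega>. ennreal ((1 + vnorm D (f D k x \<omega>))\<^sup>2) \<partial>P D) \<le> ennreal (4 + 2 * ?C powr p) * ennreal ((1 + vnorm D x)\<^sup>2)"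
        by (rule growth_second_moment[OF ps[OF D] gr[OF D k] p C0 x fx])
      also have "\<dots> \<le> ennreal (\<kappa> ^ a) * ennreal ((1 + vnorm D x)\<^sup>2)" using A by (intro mult_right_mono ennreal_leI) auto
      finally show ?thesis .
    qed
    have "\<exists>I u. (\<forall>i m j. (\<lambda>\<omega>. u \<omega> i m j) \<in> borel_measurable (P D)) \<and>
       (AE \<omega> in P D. \<forall>x\<in>space (RD D). f D k x \<omega> = rnn_fun D D I (u \<omega>) x) \<and>
       (\<integral>\<^sup>+\<omega>. rnn_size (u \<omega>) \<partial>P D) \<le> ennreal (\<kappa> ^ a)"
      using rnn[OF D k] sz by (meson order_trans)
    then show ?thesis unfolding transition_ok_def using ps[OF D] fP[OF D k] mom by blast
  qed
  have ob: "obstacle_ok D (g D (tgrid T N k)) (\<kappa> ^ a) \<kappa>" if D: "D \<ge> 1" and \<kappa>: "\<kappa> \<ge> 2" "real D \<le> \<kappa>" and k: "k \<le> N" for D \<kappa> k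
  proof (rule obstacle_ok_of_nn)
    let ?C = "c2 * real D powr q2"
    note C = b3[OF \<kappa>(1) D \<kappa>(2)]
    show C0: "?C > 0" using c2 D by simp
    show "\<kappa> > 0" using \<kappa> by simp
    have "4 * ?C \<le> 4 * \<kappa> ^ b3" using C by simp
    also have "\<dots> \<le> \<kappa> ^ (b3 + 2)" by (rule four[OF \<kappa>(1)])
    also have "\<dots> \<le> \<kappa> ^ a" by (rule pinc[OF \<kappa>(1)]) (simp add: a_def)
    finally show "4 * ?C \<le> \<kappa> ^ a" .
    have "\<kappa> * ?C \<le> \<kappa> ^ (b3 + 1)" using C \<kappa> by simp
    then have "(\<kappa> * ?C) powr r \<le> \<kappa> ^ ((b3 + 1) * l)" using pow_le[OF _ _ \<kappa>(1) _ l, of "\<kappa> * ?C" "b3 + 1"] C0 \<kappa> r by simp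
    then have "?C * (\<kappa> * ?C) powr r \<le> \<kappa> ^ b3 * \<kappa> ^ ((b3 + 1) * l)" using C \<kappa> by (intro mult_mono) auto
    also have "\<dots> \<le> \<kappa> ^ a" unfolding power_add[symmetric] by (rule pinc[OF \<kappa>(1)]) (simp add: a_def)
    finally show "?C * (\<kappa> * ?C) powr r \<le> \<kappa> ^ a" .
    fix \<epsilon> :: real assume "\<epsilon> > 0"
    then show "\<exists>L. nn_wf D 1 L \<and> (\<forall>x\<in>space (RD D). \<bar>nn_real D L x - g D (tgrid T N k) x\<bar> \<le> \<epsilon> * ?C * (1 + vnorm D x)) \<and>
        real (nn_size L) \<le> ?C * \<epsilon> powr - r \<and> lip D (nn_real D L) \<le> ennreal ?C \<and> \<bar>g D (tgrid T N k) (vzero D)\<bar> \<le> ?C"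
      using C5'[rule_format, OF D _ k, of \<epsilon>] by (simp add: mult.assoc)
  qed
  have "\<exists>b. \<forall>D \<kappa>. D \<ge> 1 \<longrightarrow> \<kappa> \<ge> 2 \<longrightarrow> real D \<le> \<kappa> \<longrightarrow>
      value_ok D (Vaux (P D) T N (g D) (f D) (N - Suc n)) (\<kappa> ^ b) \<kappa>"
    by (rule Vaux_value_ok[where P = P and f = f and g = g and T = T and N = N and a = a]) (use tr ob in auto)
  then obtain b where b: "\<And>D \<kappa>. D \<ge> 1 \<Longrightarrow> \<kappa> \<ge> 2 \<Longrightarrow> real D \<le> \<kappa> \<Longrightarrow>
      value_ok D (Vfun (P D) T N (g D) (f D) (Suc n)) (\<kappa> ^ b) \<kappa>"
    unfolding Vfun_def by blast

  \<comment> \<open>The exponent may change with the date, but there are finitely many dates and it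
    depends on neither \<open>D\<close> nor \<kappa>.\<close>
  have X_mom: "\<exists>b. \<forall>D \<kappa>. D \<ge> 1 \<longrightarrow> \<kappa> \<ge> 2 \<longrightarrow> real D \<le> \<kappa> \<longrightarrow>
      (\<integral>\<^sup>+\<omega>. ennreal ((1 + vnorm D (X D (tgrid T N k) \<omega>)) powr p) \<partial>P D) \<le> ennreal (\<kappa> ^ b)" if "k \<le> N" for k
    using that
  proof (induction k)
    case 0
    have "(\<integral>\<^sup>+\<omega>. ennreal ((1 + vnorm D (X D (tgrid T N 0) \<omega>)) powr p) \<partial>P D) \<le> ennreal (\<kappa> ^ ((b1 + 2) * mp))"
      if D: "D \<ge> 1" and \<kappa>: "\<kappa> \<ge> 2" "real D \<le> \<kappa>" for D and \<kappa> :: real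
    proof -
      interpret prob_space "P D" using ps[OF D] .
      have "1 + vnorm D (x0 D) \<le> 4 * \<kappa> ^ b1" using x0_le[OF D] b1[OF \<kappa>(1) D \<kappa>(2)] p1[OF \<kappa>(1), of b1] by linarith
      also have "\<dots> \<le> \<kappa> ^ (b1 + 2)" by (rule four[OF \<kappa>(1)])
      finally have "(1 + vnorm D (x0 D)) powr p \<le> \<kappa> ^ ((b1 + 2) * mp)" using pow_le[OF _ _ \<kappa>(1) _ mp, of "1 + vnorm D (x0 D)" "b1 + 2"] p by simp
      then have "(\<integral>\<^sup>+\<omega>. ennreal ((1 + vnorm D (X D (tgrid T N 0) \<omega>)) powr p) \<partial>P D) \<le> (\<integral>\<^sup>+\<omega>. ennreal (\<kappa> ^ ((b1 + 2) * mp)) \<partial>P D)"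
        using X0[OF D] by (intro nn_integral_mono ennreal_leI) (simp add: tgrid_def)
      then show ?thesis by (simp add: emeasure_space_1)
    qed
    then show ?case by blast
  next
    case (Suc k)
    then obtain e where e: "\<And>D \<kappa>. D \<ge> 1 \<Longrightarrow> \<kappa> \<ge> 2 \<Longrightarrow> real D \<le> \<kappa> \<Longrightarrow>
      (\<integral>\<^sup>+\<omega>. ennreal ((1 + vnorm D (X D (tgrid T N k) \<omega>)) powr p) \<partial>P D) \<le> ennreal (\<kappa> ^ e)" by auto
    have k: "k < N" "k \<le> N" using Suc.prems by auto
    define d where "d = b1 * mp + (3 * mp + e)"
    have "(\<integral>\<^sup>+\<omega>. ennreal ((1 + vnorm D (X D (tgrid T N (Suc k)) \<omega>)) powr p) \<partial>P D) \<le> ennreal (\<kappa> ^ (1 * mp + (d + 2)))"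
      if D: "D \<ge> 1" and \<kappa>: "\<kappa> \<ge> 2" "real D \<le> \<kappa>" for D and \<kappa> :: real
    proof -
      let ?C = "c * real D powr q"
      have C0: "?C \<ge> 0" using c by simp
      obtain I u where u: "\<And>i m j. (\<lambda>\<omega>. u \<omega> i m j) \<in> borel_measurable (P D)"
        "AE \<omega> in P D. \<forall>x\<in>space (RD D). f D k x \<omega> = rnn_fun D D I (u \<omega>) x"
        "(\<integral>\<^sup>+\<omega>. rnn_size (u \<omega>) \<partial>P D) \<le> ennreal ?C"
        using rnn[OF D k(1)] by blast
      have "(\<integral>\<^sup>+\<omega>. ennreal ((1 + vnorm D (X D (tgrid T N (Suc k)) \<omega>)) powr p) \<partial>P D)
          \<le> ennreal (2 powr p * (1 + ?C powr p * ((1 + real D) powr p * \<kappa> ^ e)))"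
        using p \<kappa>
        by (intro process_moment_step[OF ps[OF D] sub[OF D k(2)] XF[OF D tg[OF k(2)]] fP[OF D k(1)] ind[OF D k(1)]
              Xf[OF D k(1)] gr[OF D k(1)] u _ C0 e[OF D \<kappa>]]) auto
      also have "\<dots> \<le> ennreal (\<kappa> ^ (1 * mp + (d + 2)))"
      proof (rule ennreal_leI)
        have 1: "2 powr p \<le> \<kappa> ^ (1 * mp)" using pow_le[OF _ _ \<kappa>(1) _ mp, of 2 1] \<kappa> p by simp
        have 2: "?C powr p \<le> \<kappa> ^ (b1 * mp)" using pow_le[OF C0 b1[OF \<kappa>(1) D \<kappa>(2)] \<kappa>(1) _ mp] p by simp
        have "1 + real D \<le> 4 * \<kappa> ^ 1" using \<kappa> by simp
        also have "\<dots> \<le> \<kappa> ^ (1 + 2)" by (rule four[OF \<kappa>(1)])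
        also have "1 + 2 = (3::nat)" by simp
        finally have 3: "(1 + real D) powr p \<le> \<kappa> ^ (3 * mp)" using pow_le[OF _ _ \<kappa>(1) _ mp, of "1 + real D" 3] p by simp
        have "?C powr p * ((1 + real D) powr p * \<kappa> ^ e) \<le> \<kappa> ^ (b1 * mp) * (\<kappa> ^ (3 * mp) * \<kappa> ^ e)"
          using 2 3 \<kappa> by (intro mult_mono) auto
        also have "\<dots> = \<kappa> ^ d" by (simp add: d_def power_add)
        finally have "1 + ?C powr p * ((1 + real D) powr p * \<kappa> ^ e) \<le> 4 * \<kappa> ^ d" using p1[OF \<kappa>(1), of d] by linarith
        also have "\<dots> \<le> \<kappa> ^ (d + 2)" by (rule four[OF \<kappa>(1)])
        finally have "2 powr p * (1 + ?C powr p * ((1 + real D) powr p * \<kappa> ^ e)) \<le> \<kappa> ^ (1 * mp) * \<kappa> ^ (d + 2)"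
          using 1 \<kappa> by (intro mult_mono) auto
        then show "2 powr p * (1 + ?C powr p * ((1 + real D) powr p * \<kappa> ^ e)) \<le> \<kappa> ^ (1 * mp + (d + 2))"
          unfolding power_add .
      qed
      finally show ?thesis .
    qed
    then show ?case by blast
  qed

  obtain m0 :: nat where m0: "p / (p - 2) \<le> real m0" using real_arch_simple by blast
  \<comment> \<open>Doubling makes the exponent even, as the power mean inequality demands, and
    keeps it above p / (p - 2).\<close>
  define m where "m = 2 * m0"
  have m: "even m" "real m \<ge> p / (p - 2)" using m0 by (auto simp: m_def)
  define cm where "cm = fact (2 * m) / (2 ^ m * fact m) * (T / real N) ^ m"
  obtain b4 where b4: "\<And>\<kappa> D. \<kappa> \<ge> 2 \<Longrightarrow> D \<ge> 1 \<Longrightarrow> real D \<le> \<kappa> \<Longrightarrow> cm * real D powr real m \<le> \<kappa> ^ b4"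
    using poly_le_power[of cm "real m"] by (metis of_nat_1 of_nat_le_iff)
  obtain b5 where b5: "\<And>D \<kappa>. D \<ge> 1 \<Longrightarrow> \<kappa> \<ge> 2 \<Longrightarrow> real D \<le> \<kappa> \<Longrightarrow>
      (\<integral>\<^sup>+\<omega>. ennreal ((1 + vnorm D (X D (tgrid T N (Suc n)) \<omega>)) powr p) \<partial>P D) \<le> ennreal (\<kappa> ^ b5)"
    using X_mom[of "Suc n"] n by auto
  have rho_mom: "(\<integral>\<^sup>+z. ennreal ((1 + vnorm D z)\<^sup>2) \<partial>rho_tilde (P D) T N D (W D) (X D) N0 n) \<le> ennreal (\<kappa> ^ (b4 + b5 + 2))"
    if D: "D \<ge> 1" and \<kappa>: "\<kappa> \<ge> 2" "real D \<le> \<kappa>" and N0: "N0 \<ge> 1" for D N0 and \<kappa> :: real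
  proof -
    have "fact (2 * m) / (2 ^ m * fact m) * (real D * T / real N) ^ m = cm * real D powr real m"
      using D by (simp add: cm_def powr_realpow power_mult_distrib power_divide)
    then have le: "fact (2 * m) / (2 ^ m * fact m) * (real D * T / real N) ^ m \<le> \<kappa> ^ b4" using b4[OF \<kappa>(1) D \<kappa>(2)] by simp
    have "(\<integral>\<^sup>+z. ennreal ((1 + vnorm D z)\<^sup>2) \<partial>rho_tilde (P D) T N D (W D) (X D) N0 n)
        \<le> (\<integral>\<^sup>+\<omega>. ennreal ((1 + vnorm D (X D (tgrid T N (Suc n)) \<omega>)) powr p) \<partial>P D) + 1
          + ennreal (fact (2 * m) / (2 ^ m * fact m) * (real D * T / real N) ^ m)"
      by (rule rho_tilde_moment[OF ps[OF D] fil[OF D] BM[OF D] T_pos n N0 D _ p m]) (rule XP[OF D], use n in simp)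
    also have "\<dots> \<le> ennreal (\<kappa> ^ b5) + 1 + ennreal (\<kappa> ^ b4)"
      by (intro add_mono b5[OF D \<kappa>] ennreal_leI le) auto
    also have "\<dots> = ennreal (\<kappa> ^ b5 + 1 + \<kappa> ^ b4)" using \<kappa> by (simp add: ennreal_plus)
    also have "\<dots> \<le> ennreal (\<kappa> ^ (b4 + b5 + 2))"
    proof (rule ennreal_leI)
      have "\<kappa> ^ b5 + 1 + \<kappa> ^ b4 \<le> 4 * \<kappa> ^ (b4 + b5)"
        using p1[OF \<kappa>(1), of "b4 + b5"] pinc[OF \<kappa>(1), of b4 "b4 + b5"] pinc[OF \<kappa>(1), of b5 "b4 + b5"] by simp
      also have "\<dots> \<le> \<kappa> ^ (b4 + b5 + 2)" by (rule four[OF \<kappa>(1)])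
      finally show "\<kappa> ^ b5 + 1 + \<kappa> ^ b4 \<le> \<kappa> ^ (b4 + b5 + 2)" .
    qed
    finally show ?thesis .
  qed

  \<comment> \<open>\<open>B\<close> is the exponent of the bound for the integral of V^2 under
    \<rho>: the squared growth times the second moment. \<open>e\<close> reflects that the network
    size is cubic in a quantity of at most \<kappa>^(b+5). The constant \<open>c'\<close> is the
    power of 2 that arises when (2 D)^(2 B) is raised to the power \<open>e\<close>.\<close>
  define B where "B = 2 * b + (b4 + b5 + 2)"
  define e where "e = 3 * (b + 5)"
  define c' :: real where "c' = 2 ^ (2 * B * e)"
  have Be: "2 * B * e \<ge> 1" by (simp add: B_def e_def)
  show "\<exists>c' q' \<tau>. c' \<ge> 1 \<and> q' \<ge> 1 \<and> \<tau> \<ge> 1 \<and>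
          (\<forall>D\<ge>1. \<forall>\<epsilon>>0. \<forall>N0\<ge>1. \<exists>L. nn_wf D 1 L \<and>
             ennpow (\<integral>\<^sup>+z. ennreal ((Vfun (P D) T N (g D) (f D) (Suc n) z - nn_real D L z)\<^sup>2)
                        \<partial>rho_tilde (P D) T N D (W D) (X D) N0 n) (1 / 2) \<le> ennreal \<epsilon> \<and>
             real (nn_size L) \<le> c' * real D powr q' * \<epsilon> powr (- \<tau>) \<and>
             growth D (nn_real D L) \<le> ennreal (c' * real D powr q' * \<epsilon> powr (- \<tau>)))"
  proof (rule exI[of _ c'], rule exI[of _ "real (2 * B * e)"], rule exI[of _ "real (2 * e)"], intro conjI allI impI)
    show "c' \<ge> 1" unfolding c'_def by (rule one_le_power) simp
    show "1 \<le> real (2 * B * e)" using Be by linarith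
    show "1 \<le> real (2 * e)" by (simp add: e_def)
    fix D :: nat and \<epsilon> :: real and N0 :: nat assume D: "D \<ge> 1" and \<epsilon>: "\<epsilon> > 0" and N0: "N0 \<ge> 1"
    let ?V = "Vfun (P D) T N (g D) (f D) (Suc n)"
    let ?\<rho> = "rho_tilde (P D) T N D (W D) (X D) N0 n"
    define \<kappa>0 where "\<kappa>0 = 2 * real D"
    have \<kappa>0: "\<kappa>0 \<ge> 2" "real D \<le> \<kappa>0" using D by (auto simp: \<kappa>0_def)
    have sets: "sets ?\<rho> = sets (RD D)" unfolding rho_tilde_def Let_def by (simp add: sets.sigma_sets_eq)
    have mom: "(\<integral>\<^sup>+z. ennreal ((1 + vnorm D z)\<^sup>2) \<partial>?\<rho>) \<le> ennreal (\<kappa>0 ^ (b4 + b5 + 2))" by (rule rho_mom[OF D \<kappa>0 N0])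
    have V_le: "\<bar>?V x\<bar> \<le> \<kappa>0 ^ b * (1 + vnorm D x)" if "x \<in> space (RD D)" for x
      using b[OF D \<kappa>0] that by (auto simp: value_ok_def)
    define R where "R = c' * real D powr real (2 * B * e) * \<epsilon> powr (- real (2 * e))"
    have R0: "R \<ge> 0" unfolding R_def c'_def by simp
    show "\<exists>L. nn_wf D 1 L \<and> ennpow (\<integral>\<^sup>+z. ennreal ((?V z - nn_real D L z)\<^sup>2) \<partial>?\<rho>) (1 / 2) \<le> ennreal \<epsilon> \<and>
       real (nn_size L) \<le> c' * real D powr real (2 * B * e) * \<epsilon> powr (- real (2 * e)) \<and>
       growth D (nn_real D L) \<le> ennreal (c' * real D powr real (2 * B * e) * \<epsilon> powr (- real (2 * e)))"
      unfolding R_def[symmetric]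
    proof (cases "\<kappa>0 ^ B \<le> \<epsilon>\<^sup>2")
      \<comment> \<open>Here the integral of V^2 is already at most \<epsilon>^2, so the zero
        network suffices.\<close>
      case True
      obtain L where L: "nn_wf D 1 L" "nn_size L = 0" "nn_real D L = (\<lambda>x. 0)" using zero_network by blast
      have "(\<integral>\<^sup>+z. ennreal ((?V z)\<^sup>2) \<partial>?\<rho>) \<le> ennreal ((\<kappa>0 ^ b)\<^sup>2 * \<kappa>0 ^ (b4 + b5 + 2))"
        by (rule nn_integral_square_le_moment[OF sets mom V_le])
      also have "(\<kappa>0 ^ b)\<^sup>2 * \<kappa>0 ^ (b4 + b5 + 2) = \<kappa>0 ^ B"
        unfolding B_def power_add power_mult[symmetric] by (simp add: mult.commute)
      also have "ennreal (\<kappa>0 ^ B) \<le> ennreal (\<epsilon>\<^sup>2)" using True by (rule ennreal_leI)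
      finally have "ennpow (\<integral>\<^sup>+z. ennreal ((?V z - nn_real D L z)\<^sup>2) \<partial>?\<rho>) (1 / 2) \<le> ennreal \<epsilon>"
        unfolding L(3) using \<epsilon> by (intro ennpow_half_le) auto
      moreover have "growth D (nn_real D L) \<le> ennreal R" unfolding growth_def L(3) by (auto intro!: SUP_least)
      ultimately show "\<exists>L. nn_wf D 1 L \<and> ennpow (\<integral>\<^sup>+z. ennreal ((?V z - nn_real D L z)\<^sup>2) \<partial>?\<rho>) (1 / 2) \<le> ennreal \<epsilon> \<and>
         real (nn_size L) \<le> R \<and> growth D (nn_real D L) \<le> ennreal R" using L R0 by (intro exI[of _ L]) auto
    next
      case False
      \<comment> \<open>Dividing by \<epsilon>^2 gives 1/\<kappa> \<le> \<epsilon>^2. The doubled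
        exponent pays for this division: since \<epsilon>^2 is below \<kappa>0^B in this case,
        \<kappa> is still at least \<kappa>0^B and dominates 2, D and the moment of \<rho>. Moreover
        \<kappa>^e is exactly the claimed bound \<open>R\<close>.\<close>
      define \<kappa> where "\<kappa> = \<kappa>0 ^ (2 * B) / \<epsilon>\<^sup>2"
      have e2: "\<epsilon>\<^sup>2 > 0" using \<epsilon> by simp
      have "\<kappa>0 ^ B * \<epsilon>\<^sup>2 \<le> \<kappa>0 ^ B * \<kappa>0 ^ B" using False \<kappa>0 by (intro mult_left_mono) auto
      also have "\<dots> = \<kappa>0 ^ (2 * B)" by (simp add: mult_2 power_add)
      finally have \<kappa>_ge: "\<kappa>0 ^ B \<le> \<kappa>" unfolding \<kappa>_def using e2 by (simp add: pos_le_divide_eq)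
      have \<kappa>0_le: "\<kappa>0 \<le> \<kappa>" using \<kappa>_ge pinc[OF \<kappa>0(1), of 1 B] by (simp add: B_def)
      have \<kappa>: "\<kappa> \<ge> 2" "real D \<le> \<kappa>" using \<kappa>0_le \<kappa>0 by auto
      have "1 / \<kappa> = \<epsilon>\<^sup>2 / \<kappa>0 ^ (2 * B)" unfolding \<kappa>_def by simp
      also have "\<dots> \<le> \<epsilon>\<^sup>2" using p1[OF \<kappa>0(1), of "2 * B"] e2 by (simp add: pos_divide_le_eq mult_le_cancel_left1)
      finally have inv: "1 / \<kappa> \<le> \<epsilon>\<^sup>2" .
      have "\<kappa>0 ^ (b4 + b5 + 2) \<le> \<kappa>" using \<kappa>_ge pinc[OF \<kappa>0(1), of "b4 + b5 + 2" B] by (simp add: B_def)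
      then have mom': "(\<integral>\<^sup>+z. ennreal ((1 + vnorm D z)\<^sup>2) \<partial>?\<rho>) \<le> ennreal \<kappa>"
        using mom by (meson ennreal_leI order_trans)
      obtain s h where h: "relu_computable D s h" "real s \<le> \<kappa> ^ b" "(\<integral>\<^sup>+z. ennreal ((?V z - h z)\<^sup>2) \<partial>?\<rho>) \<le> ennreal (1 / \<kappa>)"
        using b[OF D \<kappa>] sets mom' unfolding value_ok_def by blast
      obtain h' where h': "relu_computable D (2 * s + 6 * D + 2) h'" "growth D h' \<le> ennreal (\<kappa>0 ^ b * real D)"
        "\<And>x. x \<in> space (RD D) \<Longrightarrow> \<bar>?V x - h' x\<bar> \<le> \<bar>?V x - h x\<bar>"
        using relu_computable_clip[OF h(1) D _ V_le] \<kappa>0 by auto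
      obtain L where L: "nn_wf D 1 L" "nn_size L \<le> (2 * s + 6 * D + 2 + 2) * (2 * s + 6 * D + 2 + 2 * D + 1)\<^sup>2" "nn_real D L = h'"
        using relu_computable_nn_real[OF h'(1)] by blast
      have "(\<integral>\<^sup>+z. ennreal ((?V z - nn_real D L z)\<^sup>2) \<partial>?\<rho>) \<le> (\<integral>\<^sup>+z. ennreal ((?V z - h z)\<^sup>2) \<partial>?\<rho>)"
        unfolding L(3) using h'(3) sets_eq_imp_space_eq[OF sets]
        by (intro nn_integral_mono ennreal_leI) (simp add: abs_le_square_iff[symmetric])
      also note h(3)
      also have "ennreal (1 / \<kappa>) \<le> ennreal (\<epsilon>\<^sup>2)" using inv by (rule ennreal_leI)
      finally have err: "ennpow (\<integral>\<^sup>+z. ennreal ((?V z - nn_real D L z)\<^sup>2) \<partial>?\<rho>) (1 / 2) \<le> ennreal \<epsilon>"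
        using \<epsilon> by (intro ennpow_half_le) auto
      have R: "\<kappa> ^ e = R"
      proof -
        have "\<kappa> ^ e = (2 ^ (2 * B) * real D ^ (2 * B)) ^ e / (\<epsilon>\<^sup>2) ^ e"
          by (simp add: \<kappa>_def \<kappa>0_def power_divide power_mult_distrib)
        also have "\<dots> = c' * real D ^ (2 * B * e) / \<epsilon> ^ (2 * e)"
          by (simp add: c'_def power_mult_distrib power_mult)
        also have "\<dots> = R" using D \<epsilon> by (simp add: R_def powr_realpow powr_minus divide_inverse del: of_nat_mult)
        finally show ?thesis .
      qed
      have sz: "real (nn_size L) \<le> R"
      proof -
        have s1: "\<kappa> ^ b \<le> \<kappa> ^ (b + 1)" "\<kappa> \<le> \<kappa> ^ (b + 1)" "1 \<le> \<kappa> ^ (b + 1)"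
          using pinc[OF \<kappa>(1), of b "b + 1"] pinc[OF \<kappa>(1), of 1 "b + 1"] p1[OF \<kappa>(1), of "b + 1"] by simp_all
        have "real (2 * s + 6 * D + 2 + 2 * D + 1) \<le> 4 * (4 * \<kappa> ^ (b + 1))"
          using h(2) \<kappa>(2) s1 by simp
        also have "\<dots> \<le> 4 * \<kappa> ^ (b + 1 + 2)" using four[OF \<kappa>(1), of "b + 1"] by linarith
        also have "\<dots> \<le> \<kappa> ^ (b + 1 + 2 + 2)" by (rule four[OF \<kappa>(1)])
        also have "b + 1 + 2 + 2 = b + 5" by simp
        finally have x: "real (2 * s + 6 * D + 2 + 2 * D + 1) \<le> \<kappa> ^ (b + 5)" .
        then have y: "real (2 * s + 6 * D + 2 + 2) \<le> \<kappa> ^ (b + 5)" using D by simp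
        have "real (nn_size L) \<le> real ((2 * s + 6 * D + 2 + 2) * (2 * s + 6 * D + 2 + 2 * D + 1)\<^sup>2)"
          using L(2) by (simp only: of_nat_le_iff)
        also have "\<dots> = real (2 * s + 6 * D + 2 + 2) * (real (2 * s + 6 * D + 2 + 2 * D + 1))\<^sup>2" by (simp only: of_nat_mult of_nat_power)
        also have "\<dots> \<le> \<kappa> ^ (b + 5) * (\<kappa> ^ (b + 5))\<^sup>2"
          using x y \<kappa> by (intro mult_mono power_mono) auto
        also have "\<dots> = \<kappa> ^ e" unfolding e_def power_mult[symmetric] power_add[symmetric] by (simp add: algebra_simps)
        finally show ?thesis unfolding R .
      qed
      have "\<kappa>0 ^ b * real D \<le> \<kappa> ^ b * \<kappa>" using \<kappa>0_le \<kappa>0 \<kappa> by (intro mult_mono power_mono) auto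
      also have "\<dots> = \<kappa> ^ (b + 1)" by simp
      also have "\<dots> \<le> \<kappa> ^ e" by (rule pinc[OF \<kappa>(1)]) (simp add: e_def)
      finally have "growth D (nn_real D L) \<le> ennreal R"
        using h'(2) unfolding L(3) R by (meson ennreal_leI order_trans)
      with L(1) err sz show "\<exists>L. nn_wf D 1 L \<and> ennpow (\<integral>\<^sup>+z. ennreal ((?V z - nn_real D L z)\<^sup>2) \<partial>?\<rho>) (1 / 2) \<le> ennreal \<epsilon> \<and>
         real (nn_size L) \<le> R \<and> growth D (nn_real D L) \<le> ennreal R" by blast
    qed
  qed
qed

end
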